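(* Let $n\ge 1$ and let $k_1,k_2,\ell_1,\ell_2>0$. Let $C$ be the set of pairs $(f,g)$ of measurable functions $f,g:\mathbb R^n\to\mathbb R$ with $0\le f\le k_1$, $\int_{\mathbb R^n} f\,dx\le \ell_1$, $0\le g\le k_2$, $\int_{\mathbb R^n} g\,dx\le \ell_2$. Let $\Psi:\mathbb R_+\times\mathbb R_+\to\mathbb R$ be a Borel function and $j:[0,\infty)\to\mathbb R$ a function such that: ($\Psi$1) $\Psi(s_1,0)=\Psi(0,s_2)=0$ for all $s_1,s_2\ge 0$; ($\Psi$2) $\Psi(b,d)-\Psi(b,c)-\Psi(a,d)+\Psi(a,c)\ge 0$ for all $0\le a<b$ and $0\le c<d$; ($\Psi$3)(i) $\Psi(tx,b_2)-t\Psi(x,b_2)-\Psi(tx,b_1)+t\Psi(x,b_1)\le 0$ for all $x\ge 0$, $0\le b_1<b_2$ and $0<t<1$; ($\Psi$3)(ii) $\Psi(a_2,ty)-t\Psi(a_2,y)-\Psi(a_1,ty)+t\Psi(a_1,y)\le 0$ for all $y\ge 0$, $0\le a_1<a_2$ and $0<t<1$; (j1) $j$ is nonincreasing. Suppose in addition that $\Psi$ is continuous with respect to each variable and has the N-Luzin property (with respect to each variable). For $(f,g)\in C$ put $$J(f,g)=\int_{\mathbb R^n}\int_{\mathbb R^n}\Psi\bigl(f(x),g(y)\bigr)\,j(|x-y|)\,dx\,dy .$$ Let $B_1,B_2\subset\mathbb R^n$ be the balls centered at the origin with Lebesgue measures $\mu(B_1)=\ell_1/k_1$ and $\mu(B_2)=\ell_2/k_2$.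 Then for all $(f_1,f_2)\in C$, $$J(f_1,f_2)\le J\bigl(k_1\mathbf 1_{B_1},\,k_2\mathbf 1_{B_2}\bigr).$$ Moreover, if ($\Psi$2) holds with strict inequality, ($\Psi$3)(i) holds with strict inequality for all $x>0$ and ($\Psi$3)(ii) holds with strict inequality for all $y>0$, $j$ is strictly decreasing, and $J(f_1,f_2)<\infty$ for every $(f_1,f_2)\in C$, then a pair $(h_1,h_2)\in C$ attains $\sup_{(f,g)\in C}J(f,g)$ if and only if there is $x_0\in\mathbb R^n$ such that $h_1=k_1\mathbf 1_{B_1}(\cdot-x_0)$ and $h_2=k_2\mathbf 1_{B_2}(\cdot-x_0)$ almost everywhere (the same $x_0$ for both).
   Context: $\mathbb R_+=[0,\infty)$; $\mu$ is Lebesgue measure on $\mathbb R^n$; $\mathbf 1_B$ is the characteristic function of $B$. A real function $\phi$ on $\mathbb R_+$ has the N-Luzin property if $\phi(N)$ has Lebesgue measure zero for every $N\subset\mathbb R_+$ of Lebesgue measure zero. "$\Psi$ is continuous and has the N-Luzin property with respect to each variable" means that for every fixed $s_2\ge0$ the function $\Psi(\cdot,s_2)$, and for every fixed $s_1\ge0$ the function $\Psi(s_1,\cdot)$, is continuous and has the N-Luzin property.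
   Formalization: The function j is additionally assumed to be nonnegative on [0,∞); without this the claim fails, e.g. for Ψ(s₁,s₂)=s₁s₂ and j≡−1, where J(0,0)=0 exceeds the value at the pair of balls. *)

theory Defs
  imports "HOL-Analysis.Analysis"
begin

definition N_Luzin :: "(real \<Rightarrow> real) \<Rightarrow> bool" where
  "N_Luzin \<phi> \<longleftrightarrow> (\<forall>N \<subseteq> {0..}. N \<in> null_sets lebesgue \<longrightarrow> \<phi> ` N \<in> null_sets lebesgue)"

definition admissible :: "real \<Rightarrow> real \<Rightarrow> ((real ^ 'n) \<Rightarrow> real) set" where
  "admissible k l = {f. f \<in> borel_measurable lebesgue \<and> (\<forall>x. 0 \<le> f x \<and> f x \<le> k)
      \<and> (\<integral>\<^sup>+ x. ennreal (f x) \<partial>lebesgue) \<le> ennreal l}"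

definition admissible_pairs ::
  "real \<Rightarrow> real \<Rightarrow> real \<Rightarrow> real \<Rightarrow> (((real ^ 'n) \<Rightarrow> real) \<times> ((real ^ 'n) \<Rightarrow> real)) set" where
  "admissible_pairs k1 l1 k2 l2 = admissible k1 l1 \<times> admissible k2 l2"

text \<open>Functions on \<open>[0, \<infinity>)\<close> are represented by functions on the reals; only their values at
  nonnegative arguments matter.  The functional is meant for nonnegative \<open>f\<close>, \<open>g\<close>, \<open>j\<close>
  and for \<open>\<Psi>\<close> vanishing on the axes with nonnegative rectangular increments.  Then
  \<open>\<Psi> \<ge> 0\<close> on the quadrant (take \<open>a = c = 0\<close> in the increment), so the integrand is
  nonnegative, \<open>ennreal\<close> loses nothing, and the value \<open>\<infinity>\<close> is allowed.\<close>

definition J_functional ::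
  "(real \<Rightarrow> real \<Rightarrow> real) \<Rightarrow> (real \<Rightarrow> real) \<Rightarrow> ((real ^ 'n) \<Rightarrow> real) \<Rightarrow> ((real ^ 'n) \<Rightarrow> real) \<Rightarrow> ennreal" where
  "J_functional \<Psi> j f g =
     (\<integral>\<^sup>+ y. (\<integral>\<^sup>+ x. ennreal (\<Psi> (f x) (g y) * j (norm (x - y))) \<partial>lebesgue) \<partial>lebesgue)"

end

theory Submission
  imports Defs "HOL-Complex_Analysis.Great_Picard"
begin

text \<open>Since \<open>\<Psi>\<close> vanishes on the axes and its increments are star-shaped, \<open>\<Psi> (k\<^sub>1 u) (k\<^sub>2 v) \<le> u v \<Psi> k\<^sub>1 k\<^sub>2\<close>
  for \<open>u, v \<in> [0, 1]\<close>, with equality for \<open>u, v \<in> {0, 1}\<close>. This leaves a Riesz rearrangement inequality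
  for the bilinear energy \<open>\<integral>\<integral> u(x) v(y) K(x - y)\<close> with a radially decreasing kernel. Polarizing both
  densities across the same hyperplane does not decrease the energy. On a compact class of densities
  that is stable under polarization, the energy plus a small radial term has a maximizer; it is fixed
  by all polarizations towards the origin, so its potential is radially decreasing and the bathtub
  principle replaces the densities by balls. Approximation gives the inequality in general.

  If a pair attains the maximum for a strictly decreasing kernel, equality in the polarization
  inequality shows that across each hyperplane one of the densities is symmetric, or both are larger on
  the same side. Comparing masses, for every direction \<open>e\<close> there is a threshold at which the larger side
  changes, and both densities are strictly ordered at every other hyperplane. The induced comparison of
  values of the potentials is transitive, which forces the threshold to be \<open>x\<^sub>0 \<bullet> e\<close>
  with a single point \<open>x\<^sub>0\<close>. Both potentials are therefore strictly decreasing in the distance to \<open>x\<^sub>0\<close>,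
  and uniqueness in the bathtub principle identifies the densities with balls centred at \<open>x\<^sub>0\<close>.\<close>

section \<open>Reflections and polarization\<close>

text \<open>For a kernel that is merely nonincreasing, a maximizer of the bare energy need not be
  fixed by polarization: mass may move without any gain. The radial term has a strictly decreasing
  weight, so polarizing towards the origin raises it unless nothing moves; its coefficient is chosen
  according to the tolerated error. The class carrying the maximizer must be compact and stable
  under polarization at once, which a prescribed modulus of continuity and a bounded support
  achieve, because polarization worsens neither. In the equality case the obstacle is that a density
  symmetric in a mirror says nothing about the other density there. A nonzero integrable density has
  at most one mirror of symmetry per direction, so exceptional mirrors are finite in number, and
  comparing masses pushes them all onto the threshold. The centre is read off from the potentials
  rather than from the densities: the densities are ordered only almost everywhere and not strictly,
  whereas their potentials are strictly ordered at every point off the mirror.\<close>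

definition mirror :: "'a::euclidean_space \<Rightarrow> real \<Rightarrow> 'a \<Rightarrow> 'a" where
  "mirror e s x = x - (2 * (x \<bullet> e - s)) *\<^sub>R e"

text \<open>For \<open>s > 0\<close> the half-space receiving the larger values contains the origin
  in its interior, so mass moves towards the origin. On the hyperplane itself the two branches
  agree.\<close>

definition polarize :: "'a::euclidean_space \<Rightarrow> real \<Rightarrow> ('a \<Rightarrow> real) \<Rightarrow> 'a \<Rightarrow> real" where
  "polarize e s u x = (if x \<bullet> e \<le> s then max (u x) (u (mirror e s x)) else min (u x) (u (mirror e s x)))"

lemma inner_mirror: "norm e = 1 \<Longrightarrow> mirror e s x \<bullet> e = 2 * s - x \<bullet> e"
  by (simp add: mirror_def inner_diff_left algebra_simps norm_eq_1)

lemma mirror_mirror: "norm e = 1 \<Longrightarrow> mirror e s (mirror e s x) = x"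
  by (simp add: mirror_def inner_diff_left norm_eq_1 algebra_simps flip: scaleR_add_left)

lemma mirror_fixed: "x \<bullet> e = s \<Longrightarrow> mirror e s x = x"
  by (simp add: mirror_def)

lemma mirror_minus: "mirror (- e) (- s) x = mirror e s x"
  by (simp add: mirror_def algebra_simps)

text \<open>The sign of the product decides which of \<open>y\<close> and its mirror image is nearer
  to \<open>x\<close>; every later comparison of kernel values comes from this identity.\<close>

lemma norm_mirror_sq:
  assumes "norm e = 1"
  shows "(norm (x - mirror e s y))\<^sup>2 = (norm (x - y))\<^sup>2 + 4 * ((x \<bullet> e - s) * (y \<bullet> e - s))"
proof -
  have "e \<bullet> e = 1" using assms by (simp add: norm_eq_1)
  then show ?thesis
    unfolding mirror_def power2_norm_eq_inner
    by (simp add: algebra_simps inner_commute)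
qed

lemma norm_mirror_sq0:
  assumes "norm e = 1"
  shows "(norm (mirror e s x))\<^sup>2 = (norm x)\<^sup>2 - 4 * s * (x \<bullet> e - s)"
  using norm_mirror_sq[OF assms, of 0 s x] by simp

lemma norm_mirror_mirror:
  assumes "norm e = 1" shows "norm (mirror e s x - mirror e s y) = norm (x - y)"
proof -
  have "(norm (mirror e s x - mirror e s y))\<^sup>2 = (norm (x - y))\<^sup>2"
    using norm_mirror_sq[OF assms, of "mirror e s x" s y] norm_mirror_sq[OF assms, of y s x]
    by (simp add: inner_mirror[OF assms] norm_minus_commute algebra_simps)
  then show ?thesis by (simp add: power2_eq_iff_nonneg)
qed

lemma norm_mirror_swap:
  assumes "norm e = 1" shows "norm (mirror e s x - y) = norm (x - mirror e s y)"
  using norm_mirror_mirror[OF assms, of s "x" "mirror e s y"] by (simp add: mirror_mirror assms)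

lemma norm_mirror_same_side:
  assumes "norm e = 1" and "(x \<bullet> e - s) * (y \<bullet> e - s) \<ge> 0"
  shows "norm (x - y) \<le> norm (x - mirror e s y)"
proof -
  have "(norm (x - y))\<^sup>2 \<le> (norm (x - mirror e s y))\<^sup>2"
    using norm_mirror_sq[OF assms(1), of x s y] assms(2) by simp
  then show ?thesis by (simp add: power2_le_iff_abs_le)
qed

lemma norm_mirror_opp_side:
  assumes "norm e = 1" and "(x \<bullet> e - s) * (y \<bullet> e - s) \<le> 0"
  shows "norm (x - mirror e s y) \<le> norm (x - y)"
proof -
  have "(norm (x - mirror e s y))\<^sup>2 \<le> (norm (x - y))\<^sup>2"
    using norm_mirror_sq[OF assms(1), of x s y] assms(2) by simp
  then show ?thesis by (simp add: power2_le_iff_abs_le)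
qed

lemma norm_mirror_strict:
  assumes "norm e = 1" and "(x \<bullet> e - s) * (y \<bullet> e - s) > 0"
  shows "norm (x - y) < norm (x - mirror e s y)"
proof -
  have "(norm (x - y))\<^sup>2 < (norm (x - mirror e s y))\<^sup>2"
    using norm_mirror_sq[OF assms(1), of x s y] assms(2) by simp
  then show ?thesis by (rule power2_less_imp_less) simp
qed

lemma continuous_on_mirror: "continuous_on A (mirror e s)"
  unfolding mirror_def[abs_def] by (intro continuous_intros)

lemma borel_measurable_mirror[measurable]: "mirror e s \<in> borel_measurable borel"
  by (intro borel_measurable_continuous_onI continuous_on_mirror)

lemma borel_measurable_polarize[measurable]:
  assumes [measurable]: "u \<in> borel_measurable borel"
  shows "polarize e s u \<in> borel_measurable borel"
  unfolding polarize_def[abs_def] by measurable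

lemma nn_integral_translate:
  fixes f :: "'a::euclidean_space \<Rightarrow> ennreal"
  assumes [measurable]: "f \<in> borel_measurable borel"
  shows "(\<integral>\<^sup>+ x. f (x + a) \<partial>lborel) = (\<integral>\<^sup>+ x. f x \<partial>lborel)"
proof -
  have "(\<integral>\<^sup>+ x. f x \<partial>lborel) = (\<integral>\<^sup>+ x. f x \<partial>distr lborel borel ((+) a))"
    by (simp add: lborel_distr_plus)
  also have "\<dots> = (\<integral>\<^sup>+ x. f (a + x) \<partial>lborel)"
    by (subst nn_integral_distr) auto
  finally show ?thesis by (simp add: add.commute)
qed

text \<open>Lebesgue measure is the only translation invariant measure up to a factor; a ball,
  which the reflection preserves, fixes the factor.\<close>

lemma nn_integral_mirror0:
  fixes f :: "'a::euclidean_space \<Rightarrow> ennreal"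
  assumes [measurable]: "f \<in> borel_measurable borel" and e: "norm e = 1"
  shows "(\<integral>\<^sup>+ x. f (mirror e 0 x) \<partial>lborel) = (\<integral>\<^sup>+ x. f x \<partial>lborel)"
proof -
  let ?R = "mirror e 0"
  define h :: "'a \<Rightarrow> ennreal" where "h = indicator (ball 0 1)"
  have [measurable]: "h \<in> borel_measurable borel" unfolding h_def by (rule borel_measurable_indicator) simp
  define c where "c = (\<integral>\<^sup>+ x. h x \<partial>lborel)"
  have c: "c = emeasure lborel (ball 0 1 :: 'a set)" by (simp add: c_def h_def)
  have hR: "h (?R y) = h y" for y
    using norm_mirror_sq0[OF e, of 0 y] by (simp add: h_def indicator_def power2_eq_iff_nonneg)
  have hm: "h (- y) = h y" for y by (simp add: h_def indicator_def)
  \<comment> \<open>The reflection enters \<open>h\<close> for free by \<open>hR\<close>. After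
    Fubini \<open>y\<close> is shifted by \<open>- ?R x\<close>; by this identity the shift cancels
    \<open>x\<close> in the argument of \<open>f\<close> and leaves \<open>f (?R y)\<close>, so the
    reflection has passed from \<open>h\<close> to \<open>f\<close>.\<close>
  have Rsub: "?R (y - ?R x) = ?R y - x" for x y
    using mirror_mirror[OF e, of 0 x]
    by (simp add: mirror_def inner_diff_left inner_left_distrib algebra_simps)
  have "c * (\<integral>\<^sup>+ x. f x \<partial>lborel) = (\<integral>\<^sup>+ y. h (?R y) * (\<integral>\<^sup>+ x. f x \<partial>lborel) \<partial>lborel)"
    by (simp add: hR c_def nn_integral_multc)
  also have "\<dots> = (\<integral>\<^sup>+ y. (\<integral>\<^sup>+ x. h (?R y) * f (x + ?R y) \<partial>lborel) \<partial>lborel)"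
    by (simp add: nn_integral_cmult nn_integral_translate)
  also have "\<dots> = (\<integral>\<^sup>+ x. (\<integral>\<^sup>+ y. h (?R y) * f (x + ?R y) \<partial>lborel) \<partial>lborel)"
    by (rule lborel_pair.Fubini') simp
  also have "\<dots> = (\<integral>\<^sup>+ x. (\<integral>\<^sup>+ y. h (?R (y + - ?R x)) * f (x + ?R (y + - ?R x)) \<partial>lborel) \<partial>lborel)"
    by (intro nn_integral_cong nn_integral_translate[symmetric]) simp
  also have "\<dots> = (\<integral>\<^sup>+ x. (\<integral>\<^sup>+ y. h (?R y - x) * f (?R y) \<partial>lborel) \<partial>lborel)"
    by (simp add: Rsub)
  also have "\<dots> = (\<integral>\<^sup>+ y. (\<integral>\<^sup>+ x. h (?R y - x) * f (?R y) \<partial>lborel) \<partial>lborel)"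
    by (rule lborel_pair.Fubini') simp
  also have "\<dots> = (\<integral>\<^sup>+ y. (\<integral>\<^sup>+ x. h (x + - ?R y) * f (?R y) \<partial>lborel) \<partial>lborel)"
  proof -
    have "h (?R y - x) = h (x + - ?R y)" for x y
      using hm[of "?R y - x"] by simp
    then show ?thesis by simp
  qed
  also have "\<dots> = (\<integral>\<^sup>+ y. c * f (?R y) \<partial>lborel)"
  proof (rule nn_integral_cong)
    fix y :: 'a
    have "(\<integral>\<^sup>+ x. h (x + - ?R y) * f (?R y) \<partial>lborel) = (\<integral>\<^sup>+ x. h x * f (?R y) \<partial>lborel)"
      by (rule nn_integral_translate) simp
    then show "(\<integral>\<^sup>+ x. h (x + - ?R y) * f (?R y) \<partial>lborel) = c * f (?R y)"
      by (simp add: nn_integral_multc c_def)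
  qed
  also have "\<dots> = c * (\<integral>\<^sup>+ y. f (?R y) \<partial>lborel)"
    by (rule nn_integral_cmult) simp
  finally have eq: "c * (\<integral>\<^sup>+ x. f x \<partial>lborel) = c * (\<integral>\<^sup>+ y. f (?R y) \<partial>lborel)" .
  have "c \<noteq> 0"
    unfolding c using emeasure_lborel_ball_finite[of "0::'a" 1] content_ball_pos[of 1 "0::'a"]
    by (simp add: measure_def enn2real_positive_iff)
  moreover have "c \<noteq> top"
    unfolding c using emeasure_lborel_ball_finite[of "0::'a" 1] by simp
  ultimately show ?thesis
    using eq by (metis ennreal_mult_cancel_left)
qed

lemma nn_integral_mirror:
  fixes f :: "'a::euclidean_space \<Rightarrow> ennreal"
  assumes [measurable]: "f \<in> borel_measurable borel" and e: "norm e = 1"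
  shows "(\<integral>\<^sup>+ x. f (mirror e s x) \<partial>lborel) = (\<integral>\<^sup>+ x. f x \<partial>lborel)"
proof -
  have "(\<integral>\<^sup>+ x. f x \<partial>lborel) = (\<integral>\<^sup>+ x. f (x + (2 * s) *\<^sub>R e) \<partial>lborel)"
    by (rule nn_integral_translate[symmetric]) simp
  also have "\<dots> = (\<integral>\<^sup>+ x. f (mirror e 0 x + (2 * s) *\<^sub>R e) \<partial>lborel)"
    by (rule nn_integral_mirror0[OF _ e, symmetric]) simp
  also have "(\<lambda>x. mirror e 0 x + (2 * s) *\<^sub>R e) = mirror e s"
    by (auto simp: mirror_def algebra_simps)
  then have "(\<integral>\<^sup>+ x. f (mirror e 0 x + (2 * s) *\<^sub>R e) \<partial>lborel) = (\<integral>\<^sup>+ x. f (mirror e s x) \<partial>lborel)"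
    by metis
  finally show ?thesis by simp
qed

lemma AE_mirror:
  fixes P :: "'a::euclidean_space \<Rightarrow> bool"
  assumes e: "norm e = 1" and P: "AE x in lborel. P x"
  shows "AE x in lborel. P (mirror e s x)"
proof -
  obtain N where N: "{x. \<not> P x} \<subseteq> N" "emeasure lborel N = 0" and [measurable]: "N \<in> sets borel"
    using P by (auto elim: AE_E)
  have "(\<integral>\<^sup>+ x. indicator N (mirror e s x) \<partial>lborel) = emeasure lborel N"
    by (subst nn_integral_mirror[OF _ e]) auto
  then have "(\<integral>\<^sup>+ x. indicator N (mirror e s x) \<partial>lborel) = 0"
    using N by simp
  then have "AE x in lborel. indicator N (mirror e s x) = (0::ennreal)"
    by (subst (asm) nn_integral_0_iff_AE) auto
  then show ?thesis
    using N(1) by (auto elim!: eventually_mono simp: indicator_def split: if_splits)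
qed

lemma nn_integral_eq_imp_AE:
  assumes [measurable]: "f \<in> borel_measurable M" "g \<in> borel_measurable M"
    and "AE x in M. f x \<le> g x" "(\<integral>\<^sup>+ x. g x \<partial>M) \<le> (\<integral>\<^sup>+ x. f x \<partial>M)" "(\<integral>\<^sup>+ x. f x \<partial>M) \<noteq> \<infinity>"
  shows "AE x in M. f x = g x"
proof -
  have "AE x in M. g x \<le> f x"
    using nn_integral_less[OF assms(1,2,5,3)] assms(4) by (meson not_less)
  with assms(3) show ?thesis by eventually_elim auto
qed

section \<open>Energy of radially decreasing kernels\<close>

definition energy :: "('a::euclidean_space \<Rightarrow> real) \<Rightarrow> ('a \<Rightarrow> real) \<Rightarrow> ('a \<Rightarrow> real) \<Rightarrow> ennreal" where
  "energy K u v = (\<integral>\<^sup>+ y. (\<integral>\<^sup>+ x. ennreal (u x * v y * K (x - y)) \<partial>lborel) \<partial>lborel)"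

definition potential :: "('a::euclidean_space \<Rightarrow> real) \<Rightarrow> ('a \<Rightarrow> real) \<Rightarrow> 'a \<Rightarrow> ennreal" where
  "potential K u y = (\<integral>\<^sup>+ x. ennreal (u x * K (x - y)) \<partial>lborel)"

locale radial_kernel =
  fixes K :: "'a::euclidean_space \<Rightarrow> real"
  assumes K_measurable[measurable]: "K \<in> borel_measurable borel"
    and K_nonneg: "0 \<le> K z"
    and K_antimono: "norm x \<le> norm y \<Longrightarrow> K y \<le> K x"
begin

lemma K_cong: "norm x = norm y \<Longrightarrow> K x = K y"
  by (intro antisym K_antimono) auto

lemma energy_eq_potential:
  assumes [measurable]: "u \<in> borel_measurable borel" "v \<in> borel_measurable borel"
    and "\<And>x. 0 \<le> u x" "\<And>x. 0 \<le> v x"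
  shows "energy K u v = (\<integral>\<^sup>+ y. ennreal (v y) * potential K u y \<partial>lborel)"
  unfolding energy_def potential_def
proof (rule nn_integral_cong)
  fix y
  have "ennreal (u x * v y * K (x - y)) = ennreal (v y) * ennreal (u x * K (x - y))" for x
    using assms K_nonneg by (simp add: ennreal_mult[symmetric] ac_simps)
  then show "(\<integral>\<^sup>+ x. ennreal (u x * v y * K (x - y)) \<partial>lborel)
      = ennreal (v y) * (\<integral>\<^sup>+ x. ennreal (u x * K (x - y)) \<partial>lborel)"
    by (simp add: nn_integral_cmult)
qed

lemma energy_commute:
  assumes [measurable]: "u \<in> borel_measurable borel" "v \<in> borel_measurable borel"
  shows "energy K u v = energy K v u"
proof -
  have "energy K u v = (\<integral>\<^sup>+ x. (\<integral>\<^sup>+ y. ennreal (u x * v y * K (x - y)) \<partial>lborel) \<partial>lborel)"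
    unfolding energy_def by (rule lborel_pair.Fubini') measurable
  also have "\<dots> = energy K v u"
    unfolding energy_def
    by (intro nn_integral_cong) (simp add: ac_simps K_cong[OF norm_minus_commute])
  finally show ?thesis .
qed

text \<open>The sum of the energy integrand over the four pairs formed by \<open>x\<close> or its
  mirror image with \<open>y\<close> or its mirror image. Only two distances occur among them.
  Polarization permutes values within such a quadruple, so its effect can be compared
  pointwise.\<close>

definition sym_integrand :: "'a \<Rightarrow> real \<Rightarrow> ('a \<Rightarrow> real) \<Rightarrow> ('a \<Rightarrow> real) \<Rightarrow> 'a \<Rightarrow> 'a \<Rightarrow> real" where
  "sym_integrand e s u v x y =
     (u x * v y + u (mirror e s x) * v (mirror e s y)) * K (x - y)
   + (u x * v (mirror e s y) + u (mirror e s x) * v y) * K (x - mirror e s y)"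

lemma energy_sym_integrand:
  assumes [measurable]: "u \<in> borel_measurable borel" "v \<in> borel_measurable borel"
    and u: "\<And>x. 0 \<le> u x" and v: "\<And>x. 0 \<le> v x" and e: "norm e = 1"
  shows "4 * energy K u v
    = (\<integral>\<^sup>+ y. (\<integral>\<^sup>+ x. ennreal (sym_integrand e s u v x y) \<partial>lborel) \<partial>lborel)"
proof -
  let ?m = "mirror e s"
  let ?G = "\<lambda>x y. ennreal (u x * v y * K (x - y))"
  have G: "ennreal (sym_integrand e s u v x y) = ?G x y + ?G (?m x) y + ?G x (?m y) + ?G (?m x) (?m y)" for x y
  proof -
    have 1: "K (?m x - y) = K (x - ?m y)" "K (?m x - ?m y) = K (x - y)"
      using norm_mirror_swap[OF e, of s x y] norm_mirror_mirror[OF e, of s x y] by (auto intro!: K_cong)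
    have "?G x y + ?G (?m x) y + ?G x (?m y) + ?G (?m x) (?m y)
      = ennreal (u x * v y * K (x - y) + u (?m x) * v y * K (?m x - y)
         + u x * v (?m y) * K (x - ?m y) + u (?m x) * v (?m y) * K (?m x - ?m y))"
      using u v K_nonneg by simp
    also have "\<dots> = ennreal (sym_integrand e s u v x y)"
      unfolding sym_integrand_def 1 by (simp add: algebra_simps)
    finally show ?thesis by simp
  qed
  have x: "(\<integral>\<^sup>+ x. ?G (?m x) y \<partial>lborel) = (\<integral>\<^sup>+ x. ?G x y \<partial>lborel)" for y
    by (rule nn_integral_mirror[OF _ e]) measurable
  have y: "(\<integral>\<^sup>+ y. (\<integral>\<^sup>+ x. ?G x (?m y) \<partial>lborel) \<partial>lborel) = energy K u v"
    unfolding energy_def by (rule nn_integral_mirror[OF _ e]) measurable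
  have "(\<integral>\<^sup>+ y. (\<integral>\<^sup>+ x. ennreal (sym_integrand e s u v x y) \<partial>lborel) \<partial>lborel)
    = (\<integral>\<^sup>+ y. (\<integral>\<^sup>+ x. ?G x y \<partial>lborel) + (\<integral>\<^sup>+ x. ?G (?m x) y \<partial>lborel)
        + (\<integral>\<^sup>+ x. ?G x (?m y) \<partial>lborel) + (\<integral>\<^sup>+ x. ?G (?m x) (?m y) \<partial>lborel) \<partial>lborel)"
    unfolding G by (intro nn_integral_cong) (simp add: nn_integral_add)
  also have "\<dots> = (\<integral>\<^sup>+ y. (\<integral>\<^sup>+ x. ?G x y \<partial>lborel) + (\<integral>\<^sup>+ x. ?G x y \<partial>lborel)
        + (\<integral>\<^sup>+ x. ?G x (?m y) \<partial>lborel) + (\<integral>\<^sup>+ x. ?G x (?m y) \<partial>lborel) \<partial>lborel)"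
    by (simp add: x)
  also have "\<dots> = energy K u v + energy K u v + energy K u v + energy K u v"
    by (simp add: nn_integral_add y) (simp add: energy_def)
  also have "\<dots> = 4 * energy K u v"
  proof -
    have "(4 :: ennreal) = 1 + 1 + 1 + 1" by simp
    then show ?thesis by (simp only: distrib_right mult_1)
  qed
  finally show ?thesis by simp
qed

end

section \<open>The two-point inequality and polarization of the energy\<close>

text \<open>Maximum and minimum are half the sum plus or minus half the distance. Sorting both pairs
  keeps the sums, and the gain isolated here yields both the inequality and its equality
  case.\<close>

lemma two_point_identity:
  fixes a a' b b' p q :: real
  shows "(max a a' * max b b' + min a a' * min b b') * p + (max a a' * min b b' + min a a' * max b b') * q
    = (a * b + a' * b') * p + (a * b' + a' * b) * q
      + (p - q) * (\<bar>(a - a') * (b - b')\<bar> - (a - a') * (b - b')) / 2"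
proof -
  have "max a a' = (a + a' + \<bar>a - a'\<bar>) / 2" "min a a' = (a + a' - \<bar>a - a'\<bar>) / 2"
    "max b b' = (b + b' + \<bar>b - b'\<bar>) / 2" "min b b' = (b + b' - \<bar>b - b'\<bar>) / 2"
    by auto
  then show ?thesis unfolding abs_mult by (simp only:) (simp add: field_simps)
qed

lemma two_point_rearrangement:
  fixes a a' b b' p q :: real
  assumes "q \<le> p"
  shows "(a * b + a' * b') * p + (a * b' + a' * b) * q
    \<le> (max a a' * max b b' + min a a' * min b b') * p + (max a a' * min b b' + min a a' * max b b') * q"
  unfolding two_point_identity using assms by simp

lemma two_point_rearrangement_eq:
  fixes a a' b b' p q :: real
  assumes "q < p"
    and "(a * b + a' * b') * p + (a * b' + a' * b) * q
    = (max a a' * max b b' + min a a' * min b b') * p + (max a a' * min b b' + min a a' * max b b') * q"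
  shows "0 \<le> (a - a') * (b - b')"
  using assms unfolding two_point_identity by simp

context radial_kernel
begin

text \<open>For points on the same side, sorting lets the two larger values meet at the shorter
  distance. For points on opposite sides the nearer partner is the mirror image of \<open>y\<close>,
  and the same inequality applies with the values of \<open>v\<close> exchanged.\<close>

lemma sym_integrand_polarize:
  assumes e: "norm e = 1"
  shows "sym_integrand e s u v x y \<le> sym_integrand e s (polarize e s u) (polarize e s v) x y"
proof (cases "(x \<bullet> e - s) * (y \<bullet> e - s) > 0")
  case True
  then have K: "K (x - mirror e s y) \<le> K (x - y)"
    by (intro K_antimono norm_mirror_same_side[OF e]) simp
  consider "x \<bullet> e < s" "y \<bullet> e < s" | "x \<bullet> e > s" "y \<bullet> e > s"
    using True by (auto simp: zero_less_mult_iff)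
  then show ?thesis
    using two_point_rearrangement[OF K, of "u x" "v y" "u (mirror e s x)" "v (mirror e s y)"]
    by cases (simp_all add: sym_integrand_def polarize_def inner_mirror[OF e] mirror_mirror[OF e]
            max.commute min.commute algebra_simps)
next
  case False
  then have K: "K (x - y) \<le> K (x - mirror e s y)"
    by (intro K_antimono norm_mirror_opp_side[OF e]) simp
  consider "x \<bullet> e < s" "y \<bullet> e > s" | "x \<bullet> e > s" "y \<bullet> e < s" | "x \<bullet> e = s" | "y \<bullet> e = s"
    using False by (force simp: zero_less_mult_iff not_less)
  then show ?thesis
  proof cases
    \<comment> \<open>When \<open>x\<close> lies on the mirror the two distances coincide, so the
      order of the two values of \<open>v\<close> has no effect.\<close>
    case 3
    have "K (x - mirror e s y) = K (x - y)"
      using norm_mirror_swap[OF e, of s x y] by (intro K_cong) (simp add: mirror_fixed 3)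
    then show ?thesis using 3
      by (simp add: sym_integrand_def polarize_def inner_mirror[OF e] mirror_mirror[OF e]
            max.commute min.commute mirror_fixed max_def min_def algebra_simps)
  next
    case 4
    then show ?thesis
      by (simp add: sym_integrand_def polarize_def inner_mirror[OF e] mirror_mirror[OF e]
            max.commute min.commute mirror_fixed max_def min_def algebra_simps)
  qed (use two_point_rearrangement[OF K, of "u x" "v (mirror e s y)" "u (mirror e s x)" "v y"]
        in \<open>simp_all add: sym_integrand_def polarize_def inner_mirror[OF e] mirror_mirror[OF e]
            max.commute min.commute algebra_simps\<close>)
qed

lemma borel_measurable_sym_integrand[measurable]:
  assumes [measurable]: "u \<in> borel_measurable borel" "v \<in> borel_measurable borel"
  shows "(\<lambda>(y, x). sym_integrand e s u v x y) \<in> borel_measurable (lborel \<Otimes>\<^sub>M lborel)"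
  unfolding sym_integrand_def by measurable

lemma energy_polarize:
  assumes [measurable]: "u \<in> borel_measurable borel" "v \<in> borel_measurable borel"
    and u: "\<And>x. 0 \<le> u x" and v: "\<And>x. 0 \<le> v x" and e: "norm e = 1"
  shows "energy K u v \<le> energy K (polarize e s u) (polarize e s v)"
proof -
  have p: "0 \<le> polarize e s u x" "0 \<le> polarize e s v x" for x
    using u v by (auto simp: polarize_def max_def)
  have "4 * energy K u v \<le> 4 * energy K (polarize e s u) (polarize e s v)"
    using u v p e
    by (simp add: energy_sym_integrand[where s = s] nn_integral_mono ennreal_leI sym_integrand_polarize)
  then show ?thesis by (simp add: ennreal_mult_le_mult_iff)
qed

end

locale strict_radial_kernel = radial_kernel +
  assumes K_strict: "norm x < norm y \<Longrightarrow> K y < K x"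
begin

text \<open>Equal finite energies turn the pointwise inequality of the symmetrized integrands into
  an equality almost everywhere, first for the inner integrals and then for the integrands. On the
  same side the two kernel values differ, so the gain vanishes only if the differences agree in
  sign. The nested form of the conclusion allows a single \<open>y\<close> to be fixed against
  almost every \<open>x\<close>.\<close>

lemma energy_polarize_eq:
  assumes [measurable]: "u \<in> borel_measurable borel" "v \<in> borel_measurable borel"
    and u: "\<And>x. 0 \<le> u x" and v: "\<And>x. 0 \<le> v x" and e: "norm e = 1"
    and le: "energy K (polarize e s u) (polarize e s v) \<le> energy K u v"
    and fin: "energy K u v \<noteq> \<infinity>"
  shows "AE y in lborel. AE x in lborel. x \<bullet> e < s \<and> y \<bullet> e < s \<longrightarrow>
    0 \<le> (u x - u (mirror e s x)) * (v y - v (mirror e s y))"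
proof -
  let ?S = "\<lambda>y x. ennreal (sym_integrand e s u v x y)"
  let ?T = "\<lambda>y x. ennreal (sym_integrand e s (polarize e s u) (polarize e s v) x y)"
  have p: "0 \<le> polarize e s u x" "0 \<le> polarize e s v x" for x
    using u v by (auto simp: polarize_def max_def)
  have S: "(\<integral>\<^sup>+ y. (\<integral>\<^sup>+ x. ?S y x \<partial>lborel) \<partial>lborel) = 4 * energy K u v"
    by (rule energy_sym_integrand[symmetric]) (use u v e in auto)
  have T: "(\<integral>\<^sup>+ y. (\<integral>\<^sup>+ x. ?T y x \<partial>lborel) \<partial>lborel) = 4 * energy K (polarize e s u) (polarize e s v)"
    by (rule energy_sym_integrand[symmetric]) (use p e in auto)
  have fin4: "4 * energy K u v \<noteq> \<infinity>" using fin by (simp add: ennreal_mult_eq_top_iff)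
  have "AE y in lborel. (\<integral>\<^sup>+ x. ?S y x \<partial>lborel) = (\<integral>\<^sup>+ x. ?T y x \<partial>lborel)"
    by (rule nn_integral_eq_imp_AE)
      (use fin4 le in \<open>auto simp: S T intro!: mult_left_mono nn_integral_mono ennreal_leI sym_integrand_polarize[OF e]\<close>)
  moreover have "AE y in lborel. (\<integral>\<^sup>+ x. ?S y x \<partial>lborel) \<noteq> \<infinity>"
    by (rule nn_integral_noteq_infinite) (use fin4 in \<open>auto simp: S\<close>)
  ultimately show ?thesis
  proof eventually_elim
    case (elim y)
    have "AE x in lborel. ?S y x = ?T y x"
      by (rule nn_integral_eq_imp_AE)
        (use elim in \<open>auto intro!: ennreal_leI sym_integrand_polarize[OF e]\<close>)
    then show ?case
    proof eventually_elim
      case (elim x)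
      show ?case
      proof
        assume xy: "x \<bullet> e < s \<and> y \<bullet> e < s"
        have "K (x - mirror e s y) < K (x - y)"
          using xy by (intro K_strict norm_mirror_strict[OF e]) (simp add: mult_neg_neg)
        moreover have "sym_integrand e s u v x y = sym_integrand e s (polarize e s u) (polarize e s v) x y"
          using elim u v p K_nonneg by (subst (asm) ennreal_inj) (simp_all add: sym_integrand_def)
        ultimately show "0 \<le> (u x - u (mirror e s x)) * (v y - v (mirror e s y))"
          using xy
          by (intro two_point_rearrangement_eq[of "K (x - mirror e s y)" "K (x - y)"])
            (simp_all add: sym_integrand_def polarize_def inner_mirror[OF e] mirror_mirror[OF e]
              max.commute min.commute)
      qed
    qed
  qed
qed

end

section \<open>Potentials on the two sides of a mirror\<close>

context radial_kernel
begin

text \<open>Adding the mirrored copy of the integral makes the potentials at \<open>x\<close> and at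
  its mirror image comparable pointwise in \<open>z\<close>.\<close>

lemma potential_sym:
  assumes [measurable]: "v \<in> borel_measurable borel" and v: "\<And>x. 0 \<le> v x" and e: "norm e = 1"
  shows "2 * potential K v x
    = (\<integral>\<^sup>+ z. ennreal (v z * K (z - x) + v (mirror e s z) * K (z - mirror e s x)) \<partial>lborel)"
proof -
  have "(\<integral>\<^sup>+ z. ennreal (v z * K (z - x) + v (mirror e s z) * K (z - mirror e s x)) \<partial>lborel)
    = (\<integral>\<^sup>+ z. ennreal (v z * K (z - x)) + ennreal (v (mirror e s z) * K (mirror e s z - x)) \<partial>lborel)"
    using v K_nonneg K_cong[OF norm_mirror_swap[OF e]] by (intro nn_integral_cong) simp
  also have "\<dots> = potential K v x + (\<integral>\<^sup>+ z. ennreal (v (mirror e s z) * K (mirror e s z - x)) \<partial>lborel)"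
    unfolding potential_def by (rule nn_integral_add) measurable
  also have "(\<integral>\<^sup>+ z. ennreal (v (mirror e s z) * K (mirror e s z - x)) \<partial>lborel) = potential K v x"
    unfolding potential_def by (rule nn_integral_mirror[OF _ e]) measurable
  finally show ?thesis by (simp add: mult_2)
qed

lemma AE_mirror_order:
  assumes e: "norm e = 1" and ord: "AE z in lborel. z \<bullet> e < s \<longrightarrow> v (mirror e s z) \<le> (v z :: real)"
  shows "AE z in lborel. (z \<bullet> e < s \<longrightarrow> v (mirror e s z) \<le> v z) \<and> (z \<bullet> e > s \<longrightarrow> v z \<le> v (mirror e s z))"
  using AE_mirror[OF e ord, of s] ord
  by eventually_elim (simp add: inner_mirror[OF e] mirror_mirror[OF e])

text \<open>The difference of the two sides is a product of a difference of values of
  \<open>v\<close> and a difference of kernel values; both factors change sign together when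
  \<open>z\<close> crosses the mirror.\<close>

lemma sym_potential_le:
  assumes e: "norm e = 1" and x: "x \<bullet> e \<le> s"
    and ord: "z \<bullet> e < s \<longrightarrow> v (mirror e s z) \<le> v z" "z \<bullet> e > s \<longrightarrow> v z \<le> v (mirror e s z)"
  shows "v z * K (z - mirror e s x) + v (mirror e s z) * K (z - x)
    \<le> v z * K (z - x) + v (mirror e s z) * K (z - mirror e s x)"
proof -
  have "0 \<le> (v z - v (mirror e s z)) * (K (z - x) - K (z - mirror e s x))"
  proof (cases "z \<bullet> e" s rule: linorder_cases)
    case less
    then have "K (z - mirror e s x) \<le> K (z - x)"
      using x by (intro K_antimono norm_mirror_same_side[OF e]) (simp add: mult_nonpos_nonpos)
    then show ?thesis using less ord by simp
  next
    case greater
    then have "K (z - x) \<le> K (z - mirror e s x)"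
      using x by (intro K_antimono norm_mirror_opp_side[OF e]) (simp add: mult_nonneg_nonpos)
    then show ?thesis using greater ord by (simp add: mult_nonpos_nonpos)
  qed (simp add: mirror_fixed)
  then show ?thesis by (simp add: algebra_simps)
qed

lemma potential_mirror_le:
  assumes [measurable]: "v \<in> borel_measurable borel" and v: "\<And>x. 0 \<le> v x" and e: "norm e = 1"
    and ord: "AE z in lborel. z \<bullet> e < s \<longrightarrow> v (mirror e s z) \<le> v z"
    and x: "x \<bullet> e \<le> s"
  shows "potential K v (mirror e s x) \<le> potential K v x"
proof -
  have "2 * potential K v (mirror e s x) \<le> 2 * potential K v x"
    unfolding potential_sym[OF assms(1) v e, of _ s] mirror_mirror[OF e]
    using AE_mirror_order[OF e ord]
    by (intro nn_integral_mono_AE, eventually_elim) (auto intro!: ennreal_leI sym_potential_le[OF e x])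
  then show ?thesis by (simp add: ennreal_mult_le_mult_iff)
qed

end

text \<open>Equal finite potentials would make the symmetrized integrands agree almost everywhere.
  Off the mirror the kernel factor is nonzero, so \<open>v\<close> would have to be
  symmetric.\<close>

lemma (in strict_radial_kernel) potential_mirror_less:
  assumes [measurable]: "v \<in> borel_measurable borel" and v: "\<And>x. 0 \<le> v x" and e: "norm e = 1"
    and ord: "AE z in lborel. z \<bullet> e < s \<longrightarrow> v (mirror e s z) \<le> v z"
    and asym: "\<not> (AE z in lborel. v (mirror e s z) = v z)"
    and x: "x \<bullet> e < s" and fin: "potential K v (mirror e s x) \<noteq> \<infinity>"
  shows "potential K v (mirror e s x) < potential K v x"
proof (rule ccontr)
  assume n: "\<not> ?thesis"
  let ?f = "\<lambda>z. v z * K (z - mirror e s x) + v (mirror e s z) * K (z - x)"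
  let ?g = "\<lambda>z. v z * K (z - x) + v (mirror e s z) * K (z - mirror e s x)"
  have f: "(\<integral>\<^sup>+ z. ennreal (?f z) \<partial>lborel) = 2 * potential K v (mirror e s x)"
    unfolding potential_sym[OF assms(1) v e, of _ s] mirror_mirror[OF e] ..
  have g: "(\<integral>\<^sup>+ z. ennreal (?g z) \<partial>lborel) = 2 * potential K v x"
    unfolding potential_sym[OF assms(1) v e, of _ s] ..
  have "AE z in lborel. ennreal (?f z) = ennreal (?g z)"
  proof (rule nn_integral_eq_imp_AE)
    show "AE z in lborel. ennreal (?f z) \<le> ennreal (?g z)"
      using AE_mirror_order[OF e ord]
      by eventually_elim (use x in \<open>auto intro!: ennreal_leI sym_potential_le[OF e]\<close>)
    show "(\<integral>\<^sup>+ z. ennreal (?g z) \<partial>lborel) \<le> (\<integral>\<^sup>+ z. ennreal (?f z) \<partial>lborel)"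
      unfolding f g using n by (intro mult_left_mono) auto
    show "(\<integral>\<^sup>+ z. ennreal (?f z) \<partial>lborel) \<noteq> \<infinity>"
      unfolding f using fin by (simp add: ennreal_mult_eq_top_iff)
  qed measurable
  then have "AE z in lborel. v (mirror e s z) = v z"
  proof eventually_elim
    case (elim z)
    have "?f z = ?g z" using elim v K_nonneg by (subst (asm) ennreal_inj) simp_all
    then have 0: "(v z - v (mirror e s z)) * (K (z - x) - K (z - mirror e s x)) = 0"
      by (simp add: algebra_simps)
    show ?case
    proof (cases "z \<bullet> e" s rule: linorder_cases)
      case less
      then have "K (z - mirror e s x) < K (z - x)"
        using x by (intro K_strict norm_mirror_strict[OF e]) (simp add: mult_neg_neg)
      then show ?thesis using 0 by simp
    next
      case greater
      then have "K (z - x) < K (z - mirror e s x)"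
        using x norm_mirror_strict[OF e, of "z" s "mirror e s x"]
        by (intro K_strict) (simp add: inner_mirror[OF e] mirror_mirror[OF e])
      then show ?thesis using 0 by simp
    qed (simp add: mirror_fixed)
  qed
  with asym show False ..
qed

section \<open>The bathtub principle\<close>

lemma mult_split_ennreal:
  fixes p :: ennreal
  assumes "0 \<le> t" "t \<le> 1"
  shows "ennreal t * p + ennreal (1 - t) * p = p"
  using assms by (simp flip: distrib_right ennreal_plus)

text \<open>The set \<open>B\<close> is a level set of \<open>\<phi>\<close> at height
  \<open>c\<close>. Both bounds are non-strict, so points with \<open>\<phi> x = c\<close> may lie
  on either side.\<close>

locale bathtub =
  fixes B :: "'a::euclidean_space set" and \<phi> :: "'a \<Rightarrow> ennreal" and u :: "'a \<Rightarrow> real" and c :: ennreal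
  assumes B[measurable]: "B \<in> sets borel" and B_finite: "emeasure lborel B \<noteq> \<infinity>"
    and phi[measurable]: "\<phi> \<in> borel_measurable borel" and u[measurable]: "u \<in> borel_measurable borel"
    and u_range: "\<And>x. 0 \<le> u x" "\<And>x. u x \<le> 1"
    and mass: "(\<integral>\<^sup>+ x. ennreal (u x) \<partial>lborel) \<le> emeasure lborel B"
    and inside: "\<And>x. x \<in> B \<Longrightarrow> c \<le> \<phi> x" and outside: "\<And>x. x \<notin> B \<Longrightarrow> \<phi> x \<le> c"
begin

text \<open>The mass that \<open>u\<close> has outside \<open>B\<close> must be missing inside: the
  mass inside is common to both sides and, being finite, cancels.\<close>

lemma defect_le:
  "(\<integral>\<^sup>+ x. ennreal (u x) * indicator (- B) x \<partial>lborel) \<le> (\<integral>\<^sup>+ x. ennreal (1 - u x) * indicator B x \<partial>lborel)"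
proof -
  let ?a = "\<integral>\<^sup>+ x. ennreal (u x) * indicator B x \<partial>lborel"
  have a: "?a \<noteq> \<infinity>"
  proof -
    have "?a \<le> (\<integral>\<^sup>+ x. indicator B x \<partial>lborel)"
      using u_range by (intro nn_integral_mono) (auto simp: indicator_def)
    then show ?thesis using B_finite by (auto simp: top_unique)
  qed
  have "?a + (\<integral>\<^sup>+ x. ennreal (u x) * indicator (- B) x \<partial>lborel) = (\<integral>\<^sup>+ x. ennreal (u x) \<partial>lborel)"
    by (subst nn_integral_add[symmetric]) (auto intro!: nn_integral_cong simp: indicator_def)
  also have "\<dots> \<le> (\<integral>\<^sup>+ x. indicator B x \<partial>lborel)" using mass by simp
  also have "\<dots> = ?a + (\<integral>\<^sup>+ x. ennreal (1 - u x) * indicator B x \<partial>lborel)"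
  proof -
    have "indicator B x = ennreal (u x) * indicator B x + ennreal (1 - u x) * indicator B x" for x
      using mult_split_ennreal[OF u_range, of x "indicator B x"] by simp
    then show ?thesis by (subst nn_integral_add[symmetric]) (auto intro!: nn_integral_cong)
  qed
  finally show ?thesis using a by (simp add: ennreal_add_left_cancel_le)
qed

text \<open>Both integrals contain the part of \<open>u\<close> inside \<open>B\<close>; what
  remains to be compared is the mass outside against the defect inside, separated by the level
  \<open>c\<close>.\<close>

lemma split_integral:
  "(\<integral>\<^sup>+ x. ennreal (u x) * \<phi> x \<partial>lborel)
    = (\<integral>\<^sup>+ x. ennreal (u x) * \<phi> x * indicator B x \<partial>lborel) + (\<integral>\<^sup>+ x. ennreal (u x) * \<phi> x * indicator (- B) x \<partial>lborel)"
  "(\<integral>\<^sup>+ x. ennreal (indicator B x) * \<phi> x \<partial>lborel)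
    = (\<integral>\<^sup>+ x. ennreal (u x) * \<phi> x * indicator B x \<partial>lborel) + (\<integral>\<^sup>+ x. ennreal (1 - u x) * indicator B x * \<phi> x \<partial>lborel)"
proof -
  show "(\<integral>\<^sup>+ x. ennreal (u x) * \<phi> x \<partial>lborel)
    = (\<integral>\<^sup>+ x. ennreal (u x) * \<phi> x * indicator B x \<partial>lborel) + (\<integral>\<^sup>+ x. ennreal (u x) * \<phi> x * indicator (- B) x \<partial>lborel)"
    by (subst nn_integral_add[symmetric]) (auto intro!: nn_integral_cong simp: indicator_def)
  show "(\<integral>\<^sup>+ x. ennreal (indicator B x) * \<phi> x \<partial>lborel)
    = (\<integral>\<^sup>+ x. ennreal (u x) * \<phi> x * indicator B x \<partial>lborel) + (\<integral>\<^sup>+ x. ennreal (1 - u x) * indicator B x * \<phi> x \<partial>lborel)"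
    using mult_split_ennreal[OF u_range, symmetric]
    by (subst nn_integral_add[symmetric]) (auto intro!: nn_integral_cong simp: indicator_def)
qed

lemma outside_le:
  "(\<integral>\<^sup>+ x. ennreal (u x) * \<phi> x * indicator (- B) x \<partial>lborel) \<le> c * (\<integral>\<^sup>+ x. ennreal (1 - u x) * indicator B x \<partial>lborel)"
proof -
  have "(\<integral>\<^sup>+ x. ennreal (u x) * \<phi> x * indicator (- B) x \<partial>lborel) \<le> (\<integral>\<^sup>+ x. c * (ennreal (u x) * indicator (- B) x) \<partial>lborel)"
    using outside by (intro nn_integral_mono) (auto simp: indicator_def mult.commute intro!: mult_right_mono)
  also have "\<dots> = c * (\<integral>\<^sup>+ x. ennreal (u x) * indicator (- B) x \<partial>lborel)"
    by (rule nn_integral_cmult) measurable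
  also have "\<dots> \<le> c * (\<integral>\<^sup>+ x. ennreal (1 - u x) * indicator B x \<partial>lborel)"
    using defect_le by (rule mult_left_mono) simp
  finally show ?thesis .
qed

lemma inside_ge:
  "c * (ennreal (1 - u x) * indicator B x) \<le> ennreal (1 - u x) * indicator B x * \<phi> x"
  using inside[of x] by (auto simp: indicator_def mult.commute intro!: mult_right_mono)

lemma bathtub_le: "(\<integral>\<^sup>+ x. ennreal (u x) * \<phi> x \<partial>lborel) \<le> (\<integral>\<^sup>+ x. ennreal (indicator B x) * \<phi> x \<partial>lborel)"
proof -
  have "c * (\<integral>\<^sup>+ x. ennreal (1 - u x) * indicator B x \<partial>lborel)
    = (\<integral>\<^sup>+ x. c * (ennreal (1 - u x) * indicator B x) \<partial>lborel)"
    by (rule nn_integral_cmult[symmetric]) measurable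
  also have "\<dots> \<le> (\<integral>\<^sup>+ x. ennreal (1 - u x) * indicator B x * \<phi> x \<partial>lborel)"
    by (intro nn_integral_mono inside_ge)
  finally show ?thesis
    unfolding split_integral using outside_le by (intro add_left_mono) (rule order_trans)
qed

text \<open>Equality collapses the chain from the outside part through \<open>c\<close> times the
  defect to the weighted defect. Since \<open>\<phi>\<close> exceeds \<open>c\<close> on
  \<open>B\<close>, the defect vanishes there, and \<open>defect_le\<close> then removes the mass
  outside.\<close>

lemma bathtub_unique:
  assumes strict: "\<And>x. x \<in> B \<Longrightarrow> c < \<phi> x"
    and fin: "(\<integral>\<^sup>+ x. ennreal (indicator B x) * \<phi> x \<partial>lborel) \<noteq> \<infinity>"
    and ge: "(\<integral>\<^sup>+ x. ennreal (indicator B x) * \<phi> x \<partial>lborel) \<le> (\<integral>\<^sup>+ x. ennreal (u x) * \<phi> x \<partial>lborel)"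
  shows "AE x in lborel. u x = indicator B x"
proof -
  have a: "(\<integral>\<^sup>+ x. ennreal (u x) * \<phi> x * indicator B x \<partial>lborel) \<noteq> \<infinity>"
    and b: "(\<integral>\<^sup>+ x. ennreal (1 - u x) * indicator B x * \<phi> x \<partial>lborel) \<noteq> \<infinity>"
    using fin unfolding split_integral by auto
  have c: "(\<integral>\<^sup>+ x. c * (ennreal (1 - u x) * indicator B x) \<partial>lborel)
    = c * (\<integral>\<^sup>+ x. ennreal (1 - u x) * indicator B x \<partial>lborel)"
    by (rule nn_integral_cmult) measurable
  have le: "(\<integral>\<^sup>+ x. c * (ennreal (1 - u x) * indicator B x) \<partial>lborel)
    \<le> (\<integral>\<^sup>+ x. ennreal (1 - u x) * indicator B x * \<phi> x \<partial>lborel)"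
    by (intro nn_integral_mono inside_ge)
  have "(\<integral>\<^sup>+ x. ennreal (1 - u x) * indicator B x * \<phi> x \<partial>lborel)
      \<le> (\<integral>\<^sup>+ x. ennreal (u x) * \<phi> x * indicator (- B) x \<partial>lborel)"
    using ge a unfolding split_integral by (simp add: ennreal_add_left_cancel_le)
  then have "(\<integral>\<^sup>+ x. ennreal (1 - u x) * indicator B x * \<phi> x \<partial>lborel)
      \<le> (\<integral>\<^sup>+ x. c * (ennreal (1 - u x) * indicator B x) \<partial>lborel)"
    using outside_le unfolding c by (rule order_trans)
  then have "AE x in lborel. c * (ennreal (1 - u x) * indicator B x) = ennreal (1 - u x) * indicator B x * \<phi> x"
    using b le by (intro nn_integral_eq_imp_AE) (auto simp: inside_ge top_unique)
  then have in_B: "AE x in lborel. x \<in> B \<longrightarrow> u x = 1"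
  proof eventually_elim
    case (elim x)
    show ?case
    proof (intro impI, rule ccontr)
      assume x: "x \<in> B" and "u x \<noteq> 1"
      then have "1 - u x > 0" using u_range(2)[of x] by simp
      moreover have "c * ennreal (1 - u x) = \<phi> x * ennreal (1 - u x)"
        using elim x by (simp add: mult.commute)
      ultimately show False
        using strict[OF x] by (metis ennreal_mult_cancel_left ennreal_neq_top ennreal_less_zero_iff
              less_irrefl mult.commute)
    qed
  qed
  then have "(\<integral>\<^sup>+ x. ennreal (1 - u x) * indicator B x \<partial>lborel) = 0"
    by (subst nn_integral_0_iff_AE) (auto elim!: eventually_mono simp: indicator_def)
  then have "(\<integral>\<^sup>+ x. ennreal (u x) * indicator (- B) x \<partial>lborel) = 0"
    using defect_le by simp
  then have "AE x in lborel. ennreal (u x) * indicator (- B) x = 0"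
    by (subst (asm) nn_integral_0_iff_AE) auto
  with in_B show ?thesis
  proof eventually_elim
    case (elim x)
    then show ?case
      using u_range[of x] by (auto simp: indicator_def ennreal_eq_0_iff split: if_splits)
  qed
qed

end

section \<open>Replacing densities by balls once a potential is radial\<close>

text \<open>The mirror is the perpendicular bisector of \<open>x\<close> and \<open>y\<close>. The
  formula for \<open>s\<close> is exported because its sign tells on which side the origin lies, and
  because it is later compared with the threshold of the direction \<open>e\<close>.\<close>

lemma ex_mirror:
  fixes x y :: "'a::euclidean_space"
  assumes "x \<noteq> y"
  obtains e s where "norm e = 1" "mirror e s x = y" "x \<bullet> e < s"
    "e = (y - x) /\<^sub>R norm (y - x)" "2 * norm (y - x) * s = (norm y)\<^sup>2 - (norm x)\<^sup>2"
proof -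
  define d where "d = norm (y - x)"
  define e where "e = (y - x) /\<^sub>R d"
  define s where "s = ((norm y)\<^sup>2 - (norm x)\<^sup>2) / (2 * d)"
  have d: "d > 0" using assms by (simp add: d_def)
  have dd: "d * d = y \<bullet> y - 2 * (x \<bullet> y) + x \<bullet> x"
    unfolding d_def power2_eq_square[symmetric] power2_norm_eq_inner
    by (simp add: algebra_simps inner_commute)
  have xe: "x \<bullet> e = (x \<bullet> y - x \<bullet> x) / d"
    by (simp add: e_def inner_diff_right divide_inverse mult.commute)
  have "(s - x \<bullet> e) * (2 * d) = d * d"
    unfolding dd xe s_def using d
    by (simp add: power2_norm_eq_inner algebra_simps add_divide_distrib diff_divide_distrib)
  then have se: "s - x \<bullet> e = d / 2" using d by simp
  have "2 * (x \<bullet> e - s) = - d" using se by simp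
  then have "mirror e s x = y"
    unfolding mirror_def using d by (simp add: e_def)
  moreover have "norm e = 1" using d by (simp add: e_def d_def)
  moreover have "x \<bullet> e < s" using se d by simp
  moreover have "2 * norm (y - x) * s = (norm y)\<^sup>2 - (norm x)\<^sup>2"
    using d by (simp add: s_def flip: d_def)
  ultimately show thesis by (intro that) (auto simp: e_def d_def)
qed

lemma borel_measurable_indicator_ball[measurable, simp]: "indicat_real (ball a r) \<in> borel_measurable borel"
  by (rule borel_measurable_indicator) simp

context radial_kernel
begin

lemma borel_measurable_potential[measurable]:
  assumes [measurable]: "u \<in> borel_measurable borel"
  shows "potential K u \<in> borel_measurable borel"
  unfolding potential_def[abs_def] by measurable

text \<open>The bisector of \<open>x\<close> and \<open>y\<close> has \<open>s > 0\<close> because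
  \<open>x\<close> has the smaller norm, so \<open>x\<close> lies on the side of the origin, where
  \<open>v\<close> is larger.\<close>

lemma potential_radial:
  assumes [measurable]: "v \<in> borel_measurable borel" and v: "\<And>x. 0 \<le> v x"
    and ord: "\<And>e s. norm e = 1 \<Longrightarrow> 0 < s \<Longrightarrow> AE z in lborel. z \<bullet> e < s \<longrightarrow> v (mirror e s z) \<le> v z"
    and xy: "norm x < norm y"
  shows "potential K v y \<le> potential K v x"
proof -
  have "x \<noteq> y" using xy by auto
  then obtain e s where e: "norm e = 1" "mirror e s x = y" "x \<bullet> e < s"
    and s: "2 * norm (y - x) * s = (norm y)\<^sup>2 - (norm x)\<^sup>2"
    by (rule ex_mirror)
  have "(norm x)\<^sup>2 < (norm y)\<^sup>2" using xy by (intro power_strict_mono) auto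
  then have "0 < s" using s \<open>x \<noteq> y\<close>
    by (metis diff_gt_0_iff_gt zero_less_mult_pos mult_pos_pos zero_less_norm_iff right_minus_eq zero_less_numeral)
  then show ?thesis
    using potential_mirror_le[OF assms(1) v e(1) ord, of s x] e by simp
qed

lemma energy_le_ball:
  assumes [measurable]: "u \<in> borel_measurable borel" "v \<in> borel_measurable borel"
    and u: "\<And>x. 0 \<le> u x" "\<And>x. u x \<le> 1" and v: "\<And>x. 0 \<le> v x"
    and mass: "(\<integral>\<^sup>+ x. ennreal (u x) \<partial>lborel) \<le> emeasure lborel (ball 0 r :: 'a set)"
    and radial: "\<And>x y. norm x < norm y \<Longrightarrow> potential K v y \<le> potential K v x"
  shows "energy K u v \<le> energy K (indicator (ball 0 r)) v"
proof -
  \<comment> \<open>Radial monotonicity makes the supremum of the potential outside the ball a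
    separating level.\<close>
  have "bathtub (ball 0 r) (potential K v) u (SUP x\<in>- ball 0 r. potential K v x)"
  proof
    show "c \<in> ball 0 r \<Longrightarrow> (SUP x\<in>- ball 0 r. potential K v x) \<le> potential K v c" for c
      by (intro SUP_least radial) auto
    show "emeasure lborel (ball 0 r :: 'a set) \<noteq> \<infinity>"
      using emeasure_lborel_ball_finite[of "0 :: 'a" r] by simp
  qed (use u mass in \<open>auto intro: SUP_upper\<close>)
  then interpret bathtub "ball 0 r" "potential K v" u "SUP x\<in>- ball 0 r. potential K v x" .
  have i: "energy K w v = (\<integral>\<^sup>+ x. ennreal (w x) * potential K v x \<partial>lborel)"
    if [measurable]: "w \<in> borel_measurable borel" and "\<And>x. 0 \<le> w x" for w
    using that v by (subst energy_commute) (auto intro!: energy_eq_potential)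
  show ?thesis using bathtub_le i[OF _ u_range(1)] i[of "indicator (ball 0 r)"] by simp
qed

end

lemma indicator_ball_mirror:
  assumes "norm e = 1" "0 < s" "z \<bullet> e < s"
  shows "indicator (ball 0 r) (mirror e s z) \<le> (indicator (ball 0 r) z :: real)"
proof -
  have "(norm z)\<^sup>2 \<le> (norm (mirror e s z))\<^sup>2"
    using norm_mirror_sq0[OF assms(1), of s z] assms by (simp add: mult_nonneg_nonpos)
  then have "norm z \<le> norm (mirror e s z)" by (simp add: power2_le_iff_abs_le)
  then show ?thesis by (auto simp: indicator_def)
qed

lemma (in radial_kernel) potential_ball_radial:
  assumes "norm x < norm y"
  shows "potential K (indicator (ball 0 r)) y \<le> potential K (indicator (ball 0 r)) x"
  using assms by (intro potential_radial) (auto intro: indicator_ball_mirror)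

text \<open>It is enough that one potential is radial: it replaces \<open>u\<close> by a ball, and
  the potential of that ball, radial in its turn, replaces \<open>v\<close>.\<close>

lemma (in radial_kernel) energy_le_balls:
  assumes [measurable]: "u \<in> borel_measurable borel" "v \<in> borel_measurable borel"
    and u: "\<And>x. 0 \<le> u x" "\<And>x. u x \<le> 1" and v: "\<And>x. 0 \<le> v x" "\<And>x. v x \<le> 1"
    and mass: "(\<integral>\<^sup>+ x. ennreal (u x) \<partial>lborel) \<le> emeasure lborel (ball 0 r1 :: 'a set)"
      "(\<integral>\<^sup>+ x. ennreal (v x) \<partial>lborel) \<le> emeasure lborel (ball 0 r2 :: 'a set)"
    and radial: "\<And>x y. norm x < norm y \<Longrightarrow> potential K v y \<le> potential K v x"
  shows "energy K u v \<le> energy K (indicator (ball 0 r1)) (indicator (ball 0 r2))"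
proof -
  have "energy K u v \<le> energy K (indicator (ball 0 r1)) v"
    by (rule energy_le_ball) (use u v mass radial in auto)
  also have "\<dots> = energy K v (indicator (ball 0 r1))"
    by (rule energy_commute) auto
  also have "\<dots> \<le> energy K (indicator (ball 0 r2)) (indicator (ball 0 r1))"
    by (rule energy_le_ball) (use v mass potential_ball_radial in auto)
  also have "\<dots> = energy K (indicator (ball 0 r1)) (indicator (ball 0 r2))"
    by (rule energy_commute) auto
  finally show ?thesis .
qed

section \<open>Compact classes of densities\<close>

lemma polarize_add_mirror:
  assumes "norm e = 1"
  shows "polarize e s u x + polarize e s u (mirror e s x) = u x + u (mirror e s x)"
proof (cases "x \<bullet> e" s rule: linorder_cases)
  case equal
  then show ?thesis by (simp add: polarize_def mirror_fixed)
qed (auto simp: polarize_def inner_mirror[OF assms] mirror_mirror[OF assms])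

lemma nn_integral_double:
  fixes f :: "'a::euclidean_space \<Rightarrow> ennreal"
  assumes [measurable]: "f \<in> borel_measurable borel" and e: "norm e = 1"
  shows "2 * (\<integral>\<^sup>+ x. f x \<partial>lborel) = (\<integral>\<^sup>+ x. f x + f (mirror e s x) \<partial>lborel)"
  by (simp add: nn_integral_add nn_integral_mirror[OF assms] mult_2)

lemma nn_integral_polarize:
  assumes [measurable]: "u \<in> borel_measurable borel" and u: "\<And>x. 0 \<le> u x" and e: "norm e = 1"
  shows "(\<integral>\<^sup>+ x. ennreal (polarize e s u x) \<partial>lborel) = (\<integral>\<^sup>+ x. ennreal (u x) \<partial>lborel)"
proof -
  have p: "0 \<le> polarize e s u x" for x
    using u by (auto simp: polarize_def max_def)
  have "2 * (\<integral>\<^sup>+ x. ennreal (polarize e s u x) \<partial>lborel) = 2 * (\<integral>\<^sup>+ x. ennreal (u x) \<partial>lborel)"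
    using u p
    by (simp add: nn_integral_double[OF _ e, of _ s] polarize_add_mirror[OF e] flip: ennreal_plus)
  then show ?thesis by (simp add: ennreal_mult_cancel_left)
qed

section \<open>A strictly radial weight\<close>

definition weight :: "'a::euclidean_space \<Rightarrow> real" where
  "weight x = 1 / (1 + norm x)"

lemma weight_pos: "0 < weight x" and weight_le_1: "weight x \<le> 1"
  by (auto simp: weight_def add_pos_nonneg field_simps)

lemma weight_less: "norm x < norm y \<Longrightarrow> weight y < weight x"
  unfolding weight_def by (intro divide_strict_left_mono) (auto simp: add_pos_nonneg)

lemma borel_measurable_weight[measurable]: "weight \<in> borel_measurable borel"
  unfolding weight_def[abs_def] by measurable

lemma weight_mirror:
  assumes e: "norm e = 1" and s: "0 < s"
  shows "x \<bullet> e < s \<Longrightarrow> weight (mirror e s x) < weight x" "x \<bullet> e > s \<Longrightarrow> weight x < weight (mirror e s x)"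
proof -
  show "weight (mirror e s x) < weight x" if "x \<bullet> e < s"
  proof (rule weight_less)
    have "(norm x)\<^sup>2 < (norm (mirror e s x))\<^sup>2"
      using norm_mirror_sq0[OF e, of s x] that s by (simp add: mult_pos_neg)
    then show "norm x < norm (mirror e s x)" by (rule power2_less_imp_less) simp
  qed
  show "weight x < weight (mirror e s x)" if "x \<bullet> e > s"
  proof (rule weight_less)
    have "(norm (mirror e s x))\<^sup>2 < (norm x)\<^sup>2"
      using norm_mirror_sq0[OF e, of s x] that s by simp
    then show "norm (mirror e s x) < norm x" by (rule power2_less_imp_less) simp
  qed
qed

definition weighted_mass :: "('a::euclidean_space \<Rightarrow> real) \<Rightarrow> ennreal" where
  "weighted_mass u = (\<integral>\<^sup>+ x. ennreal (u x * weight x) \<partial>lborel)"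

text \<open>Polarization keeps the sum of the two mirror values and moves the excess to the point
  nearer to the origin, where the weight is larger. The gain is excess times weight difference, and
  it is zero only if nothing moved.\<close>

lemma polarize_weight:
  assumes e: "norm e = 1" and s: "0 < s"
  shows "u x * weight x + u (mirror e s x) * weight (mirror e s x)
      \<le> polarize e s u x * weight x + polarize e s u (mirror e s x) * weight (mirror e s x)" (is "?L \<le> ?R")
    and "u x * weight x + u (mirror e s x) * weight (mirror e s x)
      = polarize e s u x * weight x + polarize e s u (mirror e s x) * weight (mirror e s x)
      \<Longrightarrow> polarize e s u x = u x"
proof -
  have m: "polarize e s u (mirror e s x) = u x + u (mirror e s x) - polarize e s u x"
    using polarize_add_mirror[OF e, of s u x] by simp
  have eq: "?R = ?L + (polarize e s u x - u x) * (weight x - weight (mirror e s x))"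
    unfolding m by (simp add: algebra_simps)
  have "0 \<le> (polarize e s u x - u x) * (weight x - weight (mirror e s x))
    \<and> ((polarize e s u x - u x) * (weight x - weight (mirror e s x)) = 0 \<longrightarrow> polarize e s u x = u x)"
  proof (cases "x \<bullet> e" s rule: linorder_cases)
    case less
    then show ?thesis using weight_mirror(1)[OF e s less] by (auto simp: polarize_def)
  next
    case greater
    then show ?thesis using weight_mirror(2)[OF e s greater]
      by (auto simp: polarize_def intro!: mult_nonpos_nonpos)
  qed (simp add: polarize_def mirror_fixed)
  then show "?L \<le> ?R" "?L = ?R \<Longrightarrow> polarize e s u x = u x" using eq by auto
qed

lemma weighted_mass_double:
  assumes [measurable]: "u \<in> borel_measurable borel" and u: "\<And>x. 0 \<le> u x" and e: "norm e = 1"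
  shows "2 * weighted_mass u
    = (\<integral>\<^sup>+ x. ennreal (u x * weight x + u (mirror e s x) * weight (mirror e s x)) \<partial>lborel)"
  unfolding weighted_mass_def
  by (subst nn_integral_double[OF _ e, of _ s])
    (auto intro!: nn_integral_cong simp: u weight_pos less_imp_le)

lemma weighted_mass_polarize:
  assumes [measurable]: "u \<in> borel_measurable borel" and u: "\<And>x. 0 \<le> u x" and e: "norm e = 1"
    and s: "0 < s"
  shows "weighted_mass u \<le> weighted_mass (polarize e s u)"
    and "weighted_mass (polarize e s u) \<le> weighted_mass u \<Longrightarrow> weighted_mass u \<noteq> \<infinity>
      \<Longrightarrow> AE x in lborel. polarize e s u x = u x"
proof -
  have p: "0 \<le> polarize e s u x" for x
    using u by (auto simp: polarize_def max_def)
  let ?f = "\<lambda>x. u x * weight x + u (mirror e s x) * weight (mirror e s x)"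
  let ?g = "\<lambda>x. polarize e s u x * weight x + polarize e s u (mirror e s x) * weight (mirror e s x)"
  have f: "2 * weighted_mass u = (\<integral>\<^sup>+ x. ennreal (?f x) \<partial>lborel)"
    using u e by (intro weighted_mass_double) auto
  have g: "2 * weighted_mass (polarize e s u) = (\<integral>\<^sup>+ x. ennreal (?g x) \<partial>lborel)"
    using p e by (intro weighted_mass_double) auto
  have "2 * weighted_mass u \<le> 2 * weighted_mass (polarize e s u)"
    unfolding f g by (intro nn_integral_mono ennreal_leI polarize_weight[OF e s])
  then show "weighted_mass u \<le> weighted_mass (polarize e s u)" by (simp add: ennreal_mult_le_mult_iff)
  assume a: "weighted_mass (polarize e s u) \<le> weighted_mass u" "weighted_mass u \<noteq> \<infinity>"
  have "AE x in lborel. ennreal (?f x) = ennreal (?g x)"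
    by (rule nn_integral_eq_imp_AE)
      (use a in \<open>auto intro!: ennreal_leI polarize_weight[OF e s] mult_left_mono
        simp: ennreal_mult_eq_top_iff simp flip: f g\<close>)
  then show "AE x in lborel. polarize e s u x = u x"
  proof eventually_elim
    case (elim x)
    then have "?f x = ?g x"
      using u p less_imp_le[OF weight_pos] by (subst (asm) ennreal_inj) (auto intro!: add_nonneg_nonneg mult_nonneg_nonneg)
    then show ?case by (rule polarize_weight(2)[OF e s])
  qed
qed

text \<open>Densities with a common modulus of continuity \<open>d\<close> and a common bounded support: a
  compact class which is stable under polarization.\<close>

definition density_class :: "(real \<Rightarrow> real) \<Rightarrow> real \<Rightarrow> ennreal \<Rightarrow> ('a::euclidean_space \<Rightarrow> real) set" where
  "density_class d R m = {f. (\<forall>x. 0 \<le> f x \<and> f x \<le> 1) \<and> (\<forall>x. R < norm x \<longrightarrow> f x = 0)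
    \<and> (\<forall>\<epsilon>>0. \<forall>x y. dist x y < d \<epsilon> \<longrightarrow> \<bar>f x - f y\<bar> \<le> \<epsilon>)
    \<and> (\<integral>\<^sup>+ x. ennreal (f x) \<partial>lborel) \<le> m}"

lemma density_classD:
  assumes "f \<in> density_class d R m"
  shows "0 \<le> f x" "f x \<le> 1" "R < norm x \<Longrightarrow> f x = 0"
    "\<epsilon> > 0 \<Longrightarrow> dist x y < d \<epsilon> \<Longrightarrow> \<bar>f x - f y\<bar> \<le> \<epsilon>"
    "(\<integral>\<^sup>+ x. ennreal (f x) \<partial>lborel) \<le> m"
  using assms unfolding density_class_def by auto

lemma density_class_measurable:
  assumes f: "f \<in> density_class d R m" and d: "\<And>\<epsilon>. \<epsilon> > 0 \<Longrightarrow> d \<epsilon> > 0"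
  shows "f \<in> borel_measurable borel"
proof (rule borel_measurable_continuous_onI)
  show "continuous_on UNIV f"
    unfolding continuous_on_iff
  proof (intro ballI allI impI)
    fix x and \<epsilon> :: real assume "0 < \<epsilon>"
    then show "\<exists>\<delta>>0. \<forall>x'\<in>UNIV. dist x' x < \<delta> \<longrightarrow> dist (f x') (f x) < \<epsilon>"
      using density_classD(4)[OF f, of "\<epsilon> / 2"] d[of "\<epsilon> / 2"]
      by (intro exI[of _ "d (\<epsilon> / 2)"]) (force simp: dist_real_def)
  qed
qed

text \<open>Mirrors are isometries, and across the mirror \<open>x\<close> is no farther from the
  image of \<open>y\<close> than from \<open>y\<close>, so the maximum and minimum inherit the
  modulus. For the support, \<open>s > 0\<close> makes the image of a point on the origin side at
  least as large in norm.\<close>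

lemma density_class_polarize:
  assumes f: "f \<in> density_class d R m" and d: "\<And>\<epsilon>. \<epsilon> > 0 \<Longrightarrow> d \<epsilon> > 0"
    and e: "norm e = 1" and s: "0 < s"
  shows "polarize e s f \<in> density_class d R m"
  unfolding density_class_def
proof (intro CollectI conjI allI impI)
  note D = density_classD[OF f]
  fix x y :: 'a and \<epsilon> :: real
  show "0 \<le> polarize e s f x" "polarize e s f x \<le> 1"
    using D(1,2) by (auto simp: polarize_def max_def min_def)
  show "(\<integral>\<^sup>+ x. ennreal (polarize e s f x) \<partial>lborel) \<le> m"
    using nn_integral_polarize[OF density_class_measurable[OF f d] D(1) e] D(5) by simp
  show "polarize e s f x = 0" if R: "R < norm x"
  proof (cases "x \<bullet> e \<le> s")
    case True
    have "(norm x)\<^sup>2 \<le> (norm (mirror e s x))\<^sup>2"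
      using norm_mirror_sq0[OF e, of s x] True s by (simp add: mult_nonneg_nonpos)
    then have "norm x \<le> norm (mirror e s x)" by (simp add: power2_le_iff_abs_le)
    then show ?thesis using True D(3)[OF R] D(3)[of "mirror e s x"] R by (simp add: polarize_def)
  next
    case False
    then show ?thesis using D(3)[OF R] D(1) by (simp add: polarize_def min_def antisym)
  qed
  assume \<epsilon>: "0 < \<epsilon>" and xy: "dist x y < d \<epsilon>"
  note L = D(4)[OF \<epsilon>]
  let ?x = "mirror e s x" and ?y = "mirror e s y"
  have 1: "\<bar>f x - f y\<bar> \<le> \<epsilon>" "\<bar>f ?x - f ?y\<bar> \<le> \<epsilon>"
    using xy norm_mirror_mirror[OF e, of s x y] by (auto intro!: L simp: dist_norm)
  show "\<bar>polarize e s f x - polarize e s f y\<bar> \<le> \<epsilon>"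
  proof (cases "(x \<bullet> e \<le> s) = (y \<bullet> e \<le> s)")
    case True
    then show ?thesis using 1 by (auto simp: polarize_def max_def min_def abs_le_iff)
  next
    case False
    then have "(x \<bullet> e - s) * (y \<bullet> e - s) \<le> 0"
      by (auto simp: mult_le_0_iff)
    then have "norm (x - ?y) \<le> norm (x - y)" by (rule norm_mirror_opp_side[OF e])
    then have "\<bar>f x - f ?y\<bar> \<le> \<epsilon>" "\<bar>f ?x - f y\<bar> \<le> \<epsilon>"
      using xy norm_mirror_swap[OF e, of s x y] by (auto intro!: L simp: dist_norm)
    with 1 show ?thesis using False by (auto simp: polarize_def max_def min_def abs_le_iff)
  qed
qed

lemma nn_integral_Fatou_le:
  assumes "\<And>n. f n \<in> borel_measurable M" "AE x in M. (\<lambda>n. f n x) \<longlonglongrightarrow> (g x :: ennreal)"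
    and "\<And>n. (\<integral>\<^sup>+ x. f n x \<partial>M) \<le> c"
  shows "(\<integral>\<^sup>+ x. g x \<partial>M) \<le> c"
proof -
  have "(\<integral>\<^sup>+ x. g x \<partial>M) = (\<integral>\<^sup>+ x. liminf (\<lambda>n. f n x) \<partial>M)"
    using assms(2) by (intro nn_integral_cong_AE, eventually_elim) (simp add: lim_imp_Liminf)
  also have "\<dots> \<le> liminf (\<lambda>n. \<integral>\<^sup>+ x. f n x \<partial>M)"
    by (rule nn_integral_liminf) (use assms in auto)
  also have "\<dots> \<le> c"
    using assms(3) by (intro Liminf_le) auto
  finally show ?thesis .
qed

text \<open>Arzela-Ascoli is applied to the pair-valued functions, so that one subsequence serves
  both densities; the mass bound survives by Fatou.\<close>

lemma density_class_compact:
  fixes f :: "nat \<Rightarrow> ('a::euclidean_space \<Rightarrow> real) \<times> ('a \<Rightarrow> real)"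
  assumes f: "\<And>n. f n \<in> density_class d R m1 \<times> density_class d R m2"
    and d: "\<And>\<epsilon>. \<epsilon> > 0 \<Longrightarrow> d \<epsilon> > 0"
  obtains u v r where "u \<in> density_class d R m1" "v \<in> density_class d R m2" "strict_mono (r :: nat \<Rightarrow> nat)"
    "\<And>x. (\<lambda>n. fst (f (r n)) x) \<longlonglongrightarrow> u x" "\<And>x. (\<lambda>n. snd (f (r n)) x) \<longlonglongrightarrow> v x"
proof -
  have f1: "fst (f n) \<in> density_class d R m1" and f2: "snd (f n) \<in> density_class d R m2" for n
    using f[of n] by (auto simp: mem_Times_iff)
  let ?F = "\<lambda>n x. (fst (f n) x, snd (f n) x)"
  obtain g r where r: "strict_mono (r :: nat \<Rightarrow> nat)"
    and g: "\<And>\<epsilon>. 0 < \<epsilon> \<Longrightarrow> \<exists>N. \<forall>n x. n \<ge> N \<and> x \<in> cball (0::'a) R \<longrightarrow> norm (?F (r n) x - g x) < \<epsilon>"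
  proof (rule Arzela_Ascoli[of "cball (0::'a) R" ?F 2])
    show "compact (cball (0::'a) R)" by simp
    show "norm (?F n x) \<le> 2" for n x
    proof -
      have "norm (?F n x) \<le> norm (fst (f n) x) + norm (snd (f n) x)" by (rule norm_Pair_le)
      also have "\<dots> \<le> 2"
        using density_classD(1,2)[OF f1, of n x] density_classD(1,2)[OF f2, of n x] by simp
      finally show ?thesis .
    qed
    show "\<exists>\<delta>>0. \<forall>n y. y \<in> cball 0 R \<and> norm (x - y) < \<delta> \<longrightarrow> norm (?F n x - ?F n y) < \<epsilon>" if "0 < \<epsilon>" for x \<epsilon>
    proof (intro exI conjI allI impI)
      show "0 < d (\<epsilon> / 3)" using d that by simp
      fix n y assume y: "y \<in> cball 0 R \<and> norm (x - y) < d (\<epsilon> / 3)"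
      have "norm (?F n x - ?F n y) \<le> norm (fst (f n) x - fst (f n) y) + norm (snd (f n) x - snd (f n) y)"
        using norm_Pair_le[of "fst (f n) x - fst (f n) y" "snd (f n) x - snd (f n) y"] by simp
      also have "\<dots> \<le> \<epsilon> / 3 + \<epsilon> / 3"
        using density_classD(4)[OF f1, of "\<epsilon> / 3" x y n] density_classD(4)[OF f2, of "\<epsilon> / 3" x y n] that y
        by (intro add_mono) (auto simp: dist_norm)
      finally show "norm (?F n x - ?F n y) < \<epsilon>" using that by simp
    qed
  qed blast
  \<comment> \<open>Convergence is known on the closed ball only; outside it every member of the
    class vanishes.\<close>
  define G where "G x = (if x \<in> cball 0 R then g x else 0)" for x
  have lim: "(\<lambda>n. ?F (r n) x) \<longlonglongrightarrow> G x" for x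
  proof (cases "x \<in> cball 0 R")
    case True
    show ?thesis
    proof (rule LIMSEQ_I)
      fix \<epsilon> :: real assume "0 < \<epsilon>"
      from g[OF this] True show "\<exists>N. \<forall>n\<ge>N. norm (?F (r n) x - G x) < \<epsilon>" by (auto simp: G_def)
    qed
  next
    case False
    then have "?F (r n) x = 0" for n
      using density_classD(3)[OF f1] density_classD(3)[OF f2] by (simp add: zero_prod_def)
    then show ?thesis using False by (simp add: G_def)
  qed
  have l1: "(\<lambda>n. fst (f (r n)) x) \<longlonglongrightarrow> fst (G x)" and l2: "(\<lambda>n. snd (f (r n)) x) \<longlonglongrightarrow> snd (G x)" for x
    using tendsto_fst[OF lim] tendsto_snd[OF lim] by simp_all
  have closed: "h \<in> density_class d R m"
    if F: "\<And>n. F n \<in> density_class d R m" and F_lim: "\<And>x. (\<lambda>n. F n x) \<longlonglongrightarrow> h x" for F :: "nat \<Rightarrow> 'a \<Rightarrow> real" and h m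
    unfolding density_class_def
  proof (intro CollectI conjI allI impI)
    note D = density_classD[OF F]
    fix x y :: 'a and \<epsilon> :: real
    show "0 \<le> h x" using LIMSEQ_le_const[OF F_lim] D(1) by blast
    show "h x \<le> 1" using LIMSEQ_le_const2[OF F_lim] D(2) by blast
    show "h x = 0" if "R < norm x"
      using F_lim[of x] D(3)[OF that] by (simp add: LIMSEQ_const_iff)
    show "\<bar>h x - h y\<bar> \<le> \<epsilon>" if "0 < \<epsilon>" "dist x y < d \<epsilon>"
      using D(4)[OF that] by (intro LIMSEQ_le_const2[OF tendsto_rabs[OF tendsto_diff[OF F_lim F_lim]]]) blast
    show "(\<integral>\<^sup>+ x. ennreal (h x) \<partial>lborel) \<le> m"
    proof (rule nn_integral_Fatou_le)
      have [measurable]: "F n \<in> borel_measurable borel" for n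
        by (rule density_class_measurable[OF F d])
      show "(\<lambda>x. ennreal (F n x)) \<in> borel_measurable lborel" for n by measurable
      show "AE x in lborel. (\<lambda>n. ennreal (F n x)) \<longlonglongrightarrow> ennreal (h x)"
        by (intro AE_I2 tendsto_ennrealI F_lim)
    qed (rule D(5))
  qed
  have "(\<lambda>x. fst (G x)) \<in> density_class d R m1" "(\<lambda>x. snd (G x)) \<in> density_class d R m2"
    by (rule closed[OF f1 l1], rule closed[OF f2 l2])
  from that[OF this r l1 l2] show thesis .
qed

section \<open>The Riesz inequality for balls\<close>

lemma energy_pair:
  assumes [measurable]: "K \<in> borel_measurable borel" "u \<in> borel_measurable borel" "v \<in> borel_measurable borel"
  shows "energy K u v
    = (\<integral>\<^sup>+ z. ennreal (u (fst z) * v (snd z) * K (fst z - snd z)) \<partial>(lborel \<Otimes>\<^sub>M lborel))"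
  unfolding energy_def by (subst lborel_pair.nn_integral_snd[symmetric]) auto

text \<open>Passing an upper bound to the limit requires only lower semicontinuity, so kernel and
  densities may vary together and no energy has to be finite.\<close>

lemma energy_Fatou:
  fixes K :: "'a::euclidean_space \<Rightarrow> real"
  assumes [measurable]: "\<And>n. Kn n \<in> borel_measurable borel" "\<And>n. un n \<in> borel_measurable borel"
      "\<And>n. vn n \<in> borel_measurable borel"
    and K: "\<And>z. (\<lambda>n. Kn n z) \<longlonglongrightarrow> K z"
    and u: "AE x in lborel. (\<lambda>n. un n x) \<longlonglongrightarrow> u x" and v: "AE x in lborel. (\<lambda>n. vn n x) \<longlonglongrightarrow> v x"
    and le: "\<And>n. energy (Kn n) (un n) (vn n) \<le> c"
  shows "energy K u v \<le> c"
proof -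
  let ?f = "\<lambda>n x y. ennreal (un n x * vn n y * Kn n (x - y))"
  have "energy K u v \<le> (\<integral>\<^sup>+ y. liminf (\<lambda>n. \<integral>\<^sup>+ x. ?f n x y \<partial>lborel) \<partial>lborel)"
    unfolding energy_def using v
  proof (intro nn_integral_mono_AE, eventually_elim)
    case (elim y)
    have "(\<integral>\<^sup>+ x. ennreal (u x * v y * K (x - y)) \<partial>lborel) = (\<integral>\<^sup>+ x. liminf (\<lambda>n. ?f n x y) \<partial>lborel)"
      using u
    proof (intro nn_integral_cong_AE, eventually_elim)
      case (elim x)
      have "(\<lambda>n. ?f n x y) \<longlonglongrightarrow> ennreal (u x * v y * K (x - y))"
        using elim \<open>(\<lambda>n. vn n y) \<longlonglongrightarrow> v y\<close> K by (intro tendsto_ennrealI tendsto_mult)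
      then show ?case by (simp add: lim_imp_Liminf)
    qed
    also have "\<dots> \<le> liminf (\<lambda>n. \<integral>\<^sup>+ x. ?f n x y \<partial>lborel)"
      by (rule nn_integral_liminf) measurable
    finally show ?case .
  qed
  also have "\<dots> \<le> liminf (\<lambda>n. energy (Kn n) (un n) (vn n))"
    unfolding energy_def by (rule nn_integral_liminf) measurable
  also have "\<dots> \<le> c"
    using le by (intro Liminf_le) auto
  finally show ?thesis .
qed

text \<open>The explicit bound supplies a dominating function for the energies of densities with
  common bounded support, hence their finiteness and continuity.\<close>

locale bounded_radial_kernel = radial_kernel +
  fixes M :: real
  assumes K_le: "K z \<le> M"
begin

lemma class_bounds:
  fixes u v :: "'a \<Rightarrow> real"
  assumes u: "u \<in> density_class d R m1" and v: "v \<in> density_class d R m2"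
  shows "ennreal (u x * v y * K (x - y)) \<le> ennreal M * indicator (cball 0 R \<times> cball 0 R) (x, y)"
    and "ennreal (u x * weight x) \<le> indicator (cball 0 R) x"
proof -
  note U = density_classD[OF u] and V = density_classD[OF v]
  show "ennreal (u x * v y * K (x - y)) \<le> ennreal M * indicator (cball 0 R \<times> cball 0 R) (x, y)"
  proof (cases "x \<in> cball 0 R \<and> y \<in> cball 0 R")
    case True
    have "u x * v y * K (x - y) \<le> (1 * 1) * M"
      using U(1,2)[of x] V(1,2)[of y] K_nonneg K_le by (intro mult_mono) auto
    then show ?thesis using True by (simp add: ennreal_leI)
  next
    case False
    then show ?thesis using U(3)[of x] V(3)[of y] by auto
  qed
  show "ennreal (u x * weight x) \<le> indicator (cball 0 R) x"
  proof (cases "x \<in> cball 0 R")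
    case True
    have "u x * weight x \<le> 1 * 1"
      using U(1,2)[of x] weight_le_1[of x] weight_pos[of x] by (intro mult_mono) auto
    then show ?thesis using True by (simp add: ennreal_le_1)
  next
    case False
    then show ?thesis using U(3)[of x] by auto
  qed
qed

lemma cball_finite: "emeasure lborel (cball (0::'a) R) < \<infinity>"
  by (rule emeasure_lborel_cball_finite)

lemma pair_bound_finite:
  "(\<integral>\<^sup>+ z. ennreal M * indicator (cball (0::'a) R \<times> cball (0::'a) R) z \<partial>(lborel \<Otimes>\<^sub>M lborel)) < \<infinity>"
  using cball_finite[of R]
  by (subst nn_integral_cmult_indicator)
    (auto simp: lborel.emeasure_pair_measure_Times ennreal_mult_less_top)

lemma class_finite:
  fixes u v :: "'a \<Rightarrow> real"
  assumes u: "u \<in> density_class d R m1" and v: "v \<in> density_class d R m2"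
    and d: "\<And>\<epsilon>. \<epsilon> > 0 \<Longrightarrow> d \<epsilon> > 0"
  shows "energy K u v < \<infinity>" "weighted_mass u \<le> emeasure lborel (cball (0::'a) R)"
proof -
  note [measurable] = density_class_measurable[OF u d] density_class_measurable[OF v d]
  show "weighted_mass u \<le> emeasure lborel (cball (0::'a) R)"
  proof -
    have "weighted_mass u \<le> (\<integral>\<^sup>+ x. indicator (cball (0::'a) R) x \<partial>lborel)"
      unfolding weighted_mass_def by (intro nn_integral_mono class_bounds(2)[OF u v])
    then show ?thesis by simp
  qed
  have "energy K u v \<le> (\<integral>\<^sup>+ z. ennreal M * indicator (cball (0::'a) R \<times> cball (0::'a) R) z \<partial>(lborel \<Otimes>\<^sub>M lborel))"
    by (subst energy_pair) (auto intro!: nn_integral_mono class_bounds[OF u v])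
  then show "energy K u v < \<infinity>" using pair_bound_finite by (rule le_less_trans)
qed

lemma class_converges:
  fixes u v :: "'a \<Rightarrow> real"
  assumes un: "\<And>n. un n \<in> density_class d R m1" and vn: "\<And>n. vn n \<in> density_class d R m2"
    and u: "u \<in> density_class d R m1" and v: "v \<in> density_class d R m2"
    and d: "\<And>\<epsilon>. \<epsilon> > 0 \<Longrightarrow> d \<epsilon> > 0"
    and u_lim: "\<And>x. (\<lambda>n. un n x) \<longlonglongrightarrow> u x" and v_lim: "\<And>x. (\<lambda>n. vn n x) \<longlonglongrightarrow> v x"
  shows "(\<lambda>n. energy K (un n) (vn n)) \<longlonglongrightarrow> energy K u v" "(\<lambda>n. weighted_mass (un n)) \<longlonglongrightarrow> weighted_mass u"
proof -
  note [measurable] = density_class_measurable[OF u d] density_class_measurable[OF v d]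
    density_class_measurable[OF un d] density_class_measurable[OF vn d]
  show "(\<lambda>n. weighted_mass (un n)) \<longlonglongrightarrow> weighted_mass u"
    unfolding weighted_mass_def
  proof (rule nn_integral_dominated_convergence[where w = "indicator (cball (0::'a) R)"])
    show "AE x in lborel. (\<lambda>n. ennreal (un n x * weight x)) \<longlonglongrightarrow> ennreal (u x * weight x)"
      by (intro AE_I2 tendsto_ennrealI tendsto_mult u_lim tendsto_const)
    show "(\<integral>\<^sup>+ x. indicator (cball (0::'a) R) x \<partial>lborel) < \<infinity>"
      using cball_finite by simp
    show "AE x in lborel. ennreal (un n x * weight x) \<le> indicator (cball 0 R) x" for n
      by (intro AE_I2 class_bounds(2)[OF un v])
    show "indicator (cball (0::'a) R) \<in> borel_measurable lborel"
      by (rule borel_measurable_indicator) simp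
  qed measurable
  have pair: "energy K u v = (\<integral>\<^sup>+ z. ennreal (u (fst z) * v (snd z) * K (fst z - snd z)) \<partial>(lborel \<Otimes>\<^sub>M lborel))"
    "energy K (un n) (vn n)
      = (\<integral>\<^sup>+ z. ennreal (un n (fst z) * vn n (snd z) * K (fst z - snd z)) \<partial>(lborel \<Otimes>\<^sub>M lborel))" for n
    by (rule energy_pair; measurable)+
  show "(\<lambda>n. energy K (un n) (vn n)) \<longlonglongrightarrow> energy K u v"
    unfolding pair
  proof (rule nn_integral_dominated_convergence
      [where w = "\<lambda>z. ennreal M * indicator (cball (0::'a) R \<times> cball (0::'a) R) z"])
    show "AE z in lborel \<Otimes>\<^sub>M lborel. (\<lambda>n. ennreal (un n (fst z) * vn n (snd z) * K (fst z - snd z)))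
        \<longlonglongrightarrow> ennreal (u (fst z) * v (snd z) * K (fst z - snd z))"
      by (intro AE_I2 tendsto_ennrealI tendsto_mult u_lim v_lim tendsto_const)
    show "AE z in lborel \<Otimes>\<^sub>M lborel. ennreal (un n (fst z) * vn n (snd z) * K (fst z - snd z))
        \<le> ennreal M * indicator (cball 0 R \<times> cball 0 R) z" for n
      using class_bounds(1)[OF un vn, of n "fst z" n "snd z" for z] by (intro AE_I2) simp
  qed (use pair_bound_finite in auto)
qed

text \<open>A maximizer of the energy, perturbed by a strictly radially decreasing weight, cannot be
  changed by any polarization whose half-space contains the origin in its interior.\<close>

lemma energy_le_balls_class:
  fixes u v :: "'a \<Rightarrow> real"
  assumes u: "u \<in> density_class d R m1" and v: "v \<in> density_class d R m2"
    and d: "\<And>\<epsilon>. \<epsilon> > 0 \<Longrightarrow> d \<epsilon> > 0"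
    and m: "m1 = emeasure lborel (ball (0::'a) r1)" "m2 = emeasure lborel (ball (0::'a) r2)"
  shows "energy K u v \<le> energy K (indicator (ball 0 r1)) (indicator (ball 0 r2))"
proof (rule ennreal_le_epsilon)
  fix \<epsilon> :: real assume \<epsilon>: "0 < \<epsilon>"
  \<comment> \<open>Each weighted mass is at most the volume of the support ball, so the
    perturbation costs at most \<open>\<epsilon>\<close>; the added 1 keeps the denominator positive
    when that volume is zero.\<close>
  define \<delta> where "\<delta> = \<epsilon> / (2 * measure lborel (cball (0::'a) R) + 1)"
  have den: "0 < 2 * measure lborel (cball (0::'a) R) + 1" by (simp add: add_nonneg_pos)
  have \<delta>: "0 < \<delta>" unfolding \<delta>_def using \<epsilon> den by simp
  define G where "G p = energy K (fst p) (snd p) + ennreal \<delta> * (weighted_mass (fst p) + weighted_mass (snd p))"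
    for p :: "('a \<Rightarrow> real) \<times> ('a \<Rightarrow> real)"
  let ?F = "density_class d R m1 \<times> density_class d R m2"
  have "G ` ?F \<noteq> {}" using u v by auto
  from ennreal_Sup_countable_SUP[OF this] obtain g :: "nat \<Rightarrow> ennreal"
    where g: "incseq g" "range g \<subseteq> G ` ?F" "Sup (G ` ?F) = (SUP i. g i)" by blast
  then have "\<forall>n. \<exists>p. p \<in> ?F \<and> g n = G p" by blast
  then obtain f where f: "\<And>n. f n \<in> ?F" "\<And>n. g n = G (f n)" by metis
  obtain a b r where ab: "a \<in> density_class d R m1" "b \<in> density_class d R m2"
    and r: "strict_mono (r :: nat \<Rightarrow> nat)"
    and lim: "\<And>x. (\<lambda>n. fst (f (r n)) x) \<longlonglongrightarrow> a x" "\<And>x. (\<lambda>n. snd (f (r n)) x) \<longlonglongrightarrow> b x"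
    using density_class_compact[of f d R m1 m2] f(1) d by blast
  have f1: "fst (f n) \<in> density_class d R m1" and f2: "snd (f n) \<in> density_class d R m2" for n
    using f(1)[of n] by (auto simp: mem_Times_iff)
  have "(\<lambda>n. g (r n)) \<longlonglongrightarrow> Sup (G ` ?F)"
    using LIMSEQ_subseq_LIMSEQ[OF LIMSEQ_SUP[OF g(1)] r] by (simp add: g(3) comp_def)
  moreover have "(\<lambda>n. g (r n)) \<longlonglongrightarrow> G (a, b)"
    unfolding f(2) G_def fst_conv snd_conv
    using class_converges(1)[OF f1 f2 ab d lim] class_converges(2)[OF f1 f2 ab d lim]
      class_converges(2)[OF f2 f1 ab(2,1) d lim(2,1)]
    by (intro tendsto_add ennreal_tendsto_cmult) auto
  ultimately have max: "Sup (G ` ?F) = G (a, b)" by (rule LIMSEQ_unique)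
  have G_le: "G p \<le> G (a, b)" if "p \<in> ?F" for p
    unfolding max[symmetric] using that by (intro Sup_upper) auto
  note [measurable] = density_class_measurable[OF ab(1) d] density_class_measurable[OF ab(2) d]
  note A = density_classD[OF ab(1)] and B = density_classD[OF ab(2)]
  have fin: "energy K a b < \<infinity>" "weighted_mass a < \<infinity>" "weighted_mass b < \<infinity>"
    using class_finite[OF ab d] class_finite(2)[OF ab(2,1) d] cball_finite by (auto intro: le_less_trans)
  \<comment> \<open>Polarizing lowers neither the energy nor the weighted mass of \<open>a\<close>.
    By maximality the weighted mass of \<open>b\<close> cannot increase, and strictness of the
    weight leaves \<open>b\<close> unchanged.\<close>
  have radial: "AE x in lborel. polarize e s b x = b x" if e: "norm e = 1" and s: "0 < s" for e s
  proof -
    let ?a = "polarize e s a" and ?b = "polarize e s b"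
    have 1: "energy K a b \<le> energy K ?a ?b"
      by (rule energy_polarize) (use A B e in auto)
    have 2: "weighted_mass a \<le> weighted_mass ?a"
      by (rule weighted_mass_polarize(1)) (use A e s in auto)
    have "?a \<in> density_class d R m1" "?b \<in> density_class d R m2"
      using ab d e s by (auto intro!: density_class_polarize)
    then have "G (?a, ?b) \<le> G (a, b)" by (intro G_le) auto
    then have "energy K a b + ennreal \<delta> * (weighted_mass a + weighted_mass ?b) \<le> G (a, b)"
      unfolding G_def fst_conv snd_conv using 1 2
      by (elim order_trans[rotated]) (intro add_mono mult_left_mono, auto)
    then have "ennreal \<delta> * (weighted_mass a + weighted_mass ?b) \<le> ennreal \<delta> * (weighted_mass a + weighted_mass b)"
      unfolding G_def fst_conv snd_conv using fin(1) by (auto simp: ennreal_add_left_cancel_le)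
    then have "weighted_mass ?b \<le> weighted_mass b"
      using \<delta> fin(2) by (auto simp: ennreal_mult_le_mult_iff ennreal_add_left_cancel_le)
    then show ?thesis
      by (intro weighted_mass_polarize(2)) (use B e s fin in auto)
  qed
  have "potential K b y \<le> potential K b x" if "norm x < norm y" for x y
  proof (rule potential_radial[OF _ _ _ that])
    show "AE z in lborel. z \<bullet> e < s \<longrightarrow> b (mirror e s z) \<le> b z" if "norm e = 1" "0 < s" for e s
      using radial[OF that] by eventually_elim (auto simp: polarize_def max_def split: if_splits)
  qed (use B in auto)
  then have E: "energy K a b \<le> energy K (indicator (ball 0 r1)) (indicator (ball 0 r2))"
    by (intro energy_le_balls) (use A B m in auto)
  have "energy K u v \<le> G (u, v)" by (simp add: G_def)
  also have "\<dots> \<le> G (a, b)" using u v by (intro G_le) auto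
  also have "\<dots> \<le> energy K (indicator (ball 0 r1)) (indicator (ball 0 r2)) + ennreal \<epsilon>"
    unfolding G_def fst_conv snd_conv
  proof (rule add_mono[OF E])
    have "ennreal \<delta> * (weighted_mass a + weighted_mass b)
      \<le> ennreal \<delta> * (emeasure lborel (cball (0::'a) R) + emeasure lborel (cball (0::'a) R))"
      by (intro mult_left_mono add_mono class_finite(2)[OF ab d] class_finite(2)[OF ab(2,1) d]) auto
    also have "\<dots> = ennreal (\<delta> * (2 * measure lborel (cball (0::'a) R)))"
      using \<delta> cball_finite[of R]
      by (simp add: emeasure_eq_ennreal_measure ennreal_mult flip: ennreal_plus)
    also have "\<dots> \<le> ennreal \<epsilon>"
      using den \<epsilon> by (intro ennreal_leI) (simp add: \<delta>_def field_simps)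
    finally show "ennreal \<delta> * (weighted_mass a + weighted_mass b) \<le> ennreal \<epsilon>" .
  qed
  finally show "energy K u v \<le> energy K (indicator (ball 0 r1)) (indicator (ball 0 r2)) + ennreal \<epsilon>" .
qed

end

section \<open>Approximation by continuous densities with bounded support\<close>

lemma continuous_modulus:
  fixes f :: "'a::euclidean_space \<Rightarrow> real"
  assumes cont: "continuous_on UNIV f" and supp: "\<And>x. R < norm x \<Longrightarrow> f x = 0" and \<epsilon>: "0 < \<epsilon>"
  shows "\<exists>\<delta>>0. \<forall>x y. dist x y < \<delta> \<longrightarrow> \<bar>f x - f y\<bar> \<le> \<epsilon>"
proof -
  \<comment> \<open>The extra unit handles pairs with a point beyond radius \<open>R + 1\<close>: at
    distance below 1 the other point is still outside radius \<open>R\<close>, and both values are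
    0.\<close>
  have "uniformly_continuous_on (cball 0 (R + 1)) f"
    using cont by (intro compact_uniformly_continuous continuous_on_subset[OF cont]) auto
  then obtain \<delta> where \<delta>: "0 < \<delta>"
    "\<And>x y. x \<in> cball 0 (R + 1) \<Longrightarrow> y \<in> cball 0 (R + 1) \<Longrightarrow> dist y x < \<delta> \<Longrightarrow> dist (f y) (f x) < \<epsilon>"
    using \<epsilon> unfolding uniformly_continuous_on_def by blast
  show ?thesis
  proof (intro exI conjI allI impI)
    show "0 < min \<delta> 1" using \<delta> by simp
    fix x y :: 'a assume xy: "dist x y < min \<delta> 1"
    show "\<bar>f x - f y\<bar> \<le> \<epsilon>"
    proof (cases "norm x \<le> R + 1 \<and> norm y \<le> R + 1")
      case True
      then show ?thesis using \<delta>(2)[of y x] xy by (simp add: dist_real_def dist_commute)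
    next
      case False
      have "norm x \<le> norm y + dist x y" "norm y \<le> norm x + dist x y"
        using norm_triangle_sub[of x y] norm_triangle_sub[of y x] by (auto simp: dist_norm norm_minus_commute)
      then have "R < norm x" "R < norm y" using False xy by auto
      then show ?thesis using supp \<epsilon> by simp
    qed
  qed
qed

definition cutoff :: "real \<Rightarrow> 'a::euclidean_space \<Rightarrow> real" where
  "cutoff R x = max 0 (min 1 (R - norm x))"

lemma cutoff_bounds: "0 \<le> cutoff R x" "cutoff R x \<le> 1"
  by (auto simp: cutoff_def)

lemma cutoff_eq_0: "R < norm x \<Longrightarrow> cutoff R x = 0"
  by (auto simp: cutoff_def)

lemma borel_measurable_cutoff[measurable]: "cutoff R \<in> borel_measurable borel"
  unfolding cutoff_def[abs_def] by measurable

lemma cutoff_tendsto: "(\<lambda>n. cutoff (real n) x) \<longlonglongrightarrow> 1"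
proof (rule tendsto_eventually)
  show "\<forall>\<^sub>F n in sequentially. cutoff (real n) x = 1"
    using filterlim_real_sequentially[unfolded filterlim_at_top, rule_format, of "norm x + 1"]
    by eventually_elim (simp add: cutoff_def)
qed

text \<open>A measurable function is an almost everywhere limit of continuous ones. Clamping and
  cutting these off gives range and support, but the masses obey the bound only in the limit, which
  a final rescaling repairs.\<close>

lemma approx_continuous:
  fixes u :: "'a::euclidean_space \<Rightarrow> real"
  assumes u[measurable]: "u \<in> borel_measurable borel" and u_range: "\<And>x. 0 \<le> u x" "\<And>x. u x \<le> 1"
    and mass: "(\<integral>\<^sup>+ x. ennreal (u x) \<partial>lborel) \<le> ennreal m" and m: "0 < m"
  obtains f where "\<And>n. continuous_on UNIV (f n)" "\<And>n x. 0 \<le> f n x" "\<And>n x. f n x \<le> 1"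
    "\<And>n x. R < norm x \<Longrightarrow> f n x = 0" "\<And>n. (\<integral>\<^sup>+ x. ennreal (f n x) \<partial>lborel) \<le> ennreal m"
    "AE x in lborel. (\<lambda>n. f n x) \<longlonglongrightarrow> u x * cutoff R x"
proof -
  have "u measurable_on UNIV"
    by (rule lebesgue_measurable_imp_measurable_on) (use u in \<open>auto intro: measurable_completion\<close>)
  then obtain N g where N: "negligible N" and g: "\<And>n. continuous_on UNIV (g n)"
    and g_lim: "\<And>x. x \<notin> N \<Longrightarrow> (\<lambda>n. g n x) \<longlonglongrightarrow> u x"
    unfolding measurable_on_def by (auto split: if_splits)
  define h where "h n x = max 0 (min 1 (g n x)) * cutoff R x" for n x
  define w where "w x = u x * cutoff R x" for x
  have h_cont: "continuous_on UNIV (h n)" for n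
    unfolding h_def cutoff_def by (intro continuous_intros g)
  have [measurable]: "h n \<in> borel_measurable borel" for n
    by (rule borel_measurable_continuous_onI[OF h_cont])
  have [measurable]: "w \<in> borel_measurable borel" unfolding w_def by measurable
  have h_range: "0 \<le> h n x" "h n x \<le> 1" for n x
    using cutoff_bounds[of R x] by (auto simp: h_def intro!: mult_nonneg_nonneg mult_le_one)
  have h_supp: "h n x = 0" if "R < norm x" for n x
    using cutoff_eq_0[OF that] by (simp add: h_def)
  have AE_N: "AE x in lborel. x \<notin> N"
    using N by (auto simp: negligible_iff_null_sets AE_completion_iff dest!: AE_not_in)
  have h_lim: "AE x in lborel. (\<lambda>n. h n x) \<longlonglongrightarrow> w x"
    using AE_N
  proof eventually_elim
    case (elim x)
    have "(\<lambda>n. h n x) \<longlonglongrightarrow> max 0 (min 1 (u x)) * cutoff R x"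
      unfolding h_def by (intro tendsto_intros g_lim elim)
    then show ?case using u_range[of x] by (simp add: w_def)
  qed
  define I where "I n = (\<integral>\<^sup>+ x. ennreal (h n x) \<partial>lborel)" for n
  have ball: "emeasure lborel (cball (0::'a) R) < \<infinity>" by (rule emeasure_lborel_cball_finite)
  have h_le: "ennreal (h n x) \<le> indicator (cball 0 R) x" for n x
    using h_range(2)[of n x] h_supp[of x n] by (auto simp: indicator_def not_le)
  have I_lim: "I \<longlonglongrightarrow> (\<integral>\<^sup>+ x. ennreal (w x) \<partial>lborel)"
    unfolding I_def
  proof (rule nn_integral_dominated_convergence[where w = "indicator (cball (0::'a) R)"])
    show "indicator (cball (0::'a) R) \<in> borel_measurable lborel"
      by (rule borel_measurable_indicator) simp
    show "AE x in lborel. (\<lambda>n. ennreal (h n x)) \<longlonglongrightarrow> ennreal (w x)"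
      using h_lim by eventually_elim (rule tendsto_ennrealI)
  qed (use h_le ball in auto)
  have w_mass: "(\<integral>\<^sup>+ x. ennreal (w x) \<partial>lborel) \<le> ennreal m"
  proof -
    have "(\<integral>\<^sup>+ x. ennreal (w x) \<partial>lborel) \<le> (\<integral>\<^sup>+ x. ennreal (u x) \<partial>lborel)"
      using cutoff_bounds[of R] u_range
      by (intro nn_integral_mono ennreal_leI) (auto simp: w_def intro: mult_right_le_one_le)
    then show ?thesis using mass by (rule order_trans)
  qed
  have I_fin: "I n < top" for n
  proof -
    have "I n \<le> (\<integral>\<^sup>+ x. indicator (cball (0::'a) R) x \<partial>lborel)"
      unfolding I_def by (intro nn_integral_mono h_le)
    then show ?thesis using ball by (simp add: order.strict_trans1)
  qed
  \<comment> \<open>This factor is 1 when the mass is already at most \<open>m\<close> and otherwise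
    reduces it to \<open>m\<close>. It tends to 1 because the masses converge to a value not
    exceeding \<open>m\<close>.\<close>
  define c where "c n = m / max m (enn2real (I n))" for n
  have c: "0 \<le> c n" "c n \<le> 1" for n
    using m by (auto simp: c_def divide_le_eq_1)
  have c_I: "ennreal (c n) * I n \<le> ennreal m" for n
  proof -
    have "ennreal (c n) * I n = ennreal (c n * enn2real (I n))"
      using I_fin[of n] c by (simp add: ennreal_mult')
    also have "\<dots> \<le> ennreal m"
    proof (rule ennreal_leI)
      have "m * enn2real (I n) \<le> m * max m (enn2real (I n))" using m by simp
      then show "c n * enn2real (I n) \<le> m" using m by (simp add: c_def divide_le_eq less_max_iff_disj)
    qed
    finally show ?thesis .
  qed
  have c_lim: "c \<longlonglongrightarrow> 1"
  proof -
    let ?w = "enn2real (\<integral>\<^sup>+ x. ennreal (w x) \<partial>lborel)"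
    have "(\<lambda>n. enn2real (I n)) \<longlonglongrightarrow> ?w"
    proof (rule tendsto_enn2real)
      have "(\<integral>\<^sup>+ x. ennreal (w x) \<partial>lborel) < top"
        using w_mass by (rule le_less_trans) simp
      then show "I \<longlonglongrightarrow> ennreal ?w" using I_lim by simp
    qed simp
    then have "c \<longlonglongrightarrow> m / max m ?w"
      unfolding c_def[abs_def] using m by (intro tendsto_divide tendsto_const tendsto_max) auto
    moreover have "?w \<le> m" using w_mass m by (simp add: enn2real_leI)
    ultimately show ?thesis using m by (simp add: max_def split: if_splits)
  qed
  show thesis
  proof (rule that[of "\<lambda>n x. c n * h n x"])
    show "continuous_on UNIV (\<lambda>x. c n * h n x)" for n
      by (intro continuous_intros h_cont)
    show "0 \<le> c n * h n x" "c n * h n x \<le> 1" "R < norm x \<Longrightarrow> c n * h n x = 0" for n x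
      using c[of n] h_range[of n x] h_supp[of x n] by (auto intro: mult_le_one)
    show "(\<integral>\<^sup>+ x. ennreal (c n * h n x) \<partial>lborel) \<le> ennreal m" for n
      using c_I[of n] c[of n] h_range by (simp add: ennreal_mult nn_integral_cmult I_def)
    show "AE x in lborel. (\<lambda>n. c n * h n x) \<longlonglongrightarrow> u x * cutoff R x"
      using h_lim
    proof eventually_elim
      case (elim x)
      from tendsto_mult[OF c_lim elim] show ?case by (simp add: w_def)
    qed
  qed
qed

text \<open>Two limits by \<open>energy_Fatou\<close>: continuous approximations at a fixed cutoff
  radius, and then the radius tending to infinity.\<close>

lemma (in bounded_radial_kernel) energy_le_balls_bounded:
  fixes u v :: "'a \<Rightarrow> real"
  assumes [measurable]: "u \<in> borel_measurable borel" "v \<in> borel_measurable borel"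
    and u: "\<And>x. 0 \<le> u x" "\<And>x. u x \<le> 1" and v: "\<And>x. 0 \<le> v x" "\<And>x. v x \<le> 1"
    and mass: "(\<integral>\<^sup>+ x. ennreal (u x) \<partial>lborel) \<le> emeasure lborel (ball 0 r1 :: 'a set)"
      "(\<integral>\<^sup>+ x. ennreal (v x) \<partial>lborel) \<le> emeasure lborel (ball 0 r2 :: 'a set)"
    and r: "0 < r1" "0 < r2"
  shows "energy K u v \<le> energy K (indicator (ball 0 r1)) (indicator (ball 0 r2))"
proof -
  let ?E = "energy K (indicator (ball 0 r1)) (indicator (ball 0 r2))"
  have emeasure: "emeasure lborel (ball 0 r :: 'a set) = ennreal (measure lborel (ball 0 r :: 'a set))" for r
    using emeasure_lborel_ball_finite[of "0::'a" r] by (simp add: emeasure_eq_ennreal_measure)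
  have pos: "0 < measure lborel (ball 0 r :: 'a set)" if "0 < r" for r
    using content_ball_pos[OF that, of "0::'a"] by (simp add: measure_def)
  have cut: "energy K (\<lambda>x. u x * cutoff R x) (\<lambda>x. v x * cutoff R x) \<le> ?E" for R
  proof -
    obtain f where f: "\<And>n. continuous_on UNIV (f n)" "\<And>n x. 0 \<le> f n x" "\<And>n x. f n x \<le> 1"
      "\<And>n x. R < norm x \<Longrightarrow> f n x = 0"
      "\<And>n. (\<integral>\<^sup>+ x. ennreal (f n x) \<partial>lborel) \<le> ennreal (measure lborel (ball 0 r1 :: 'a set))"
      "AE x in lborel. (\<lambda>n. f n x) \<longlonglongrightarrow> u x * cutoff R x"
      by (rule approx_continuous[OF assms(1) u mass(1)[unfolded emeasure] pos[OF r(1)], of R]) blast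
    obtain g where g: "\<And>n. continuous_on UNIV (g n)" "\<And>n x. 0 \<le> g n x" "\<And>n x. g n x \<le> 1"
      "\<And>n x. R < norm x \<Longrightarrow> g n x = 0"
      "\<And>n. (\<integral>\<^sup>+ x. ennreal (g n x) \<partial>lborel) \<le> ennreal (measure lborel (ball 0 r2 :: 'a set))"
      "AE x in lborel. (\<lambda>n. g n x) \<longlonglongrightarrow> v x * cutoff R x"
      by (rule approx_continuous[OF assms(2) v mass(2)[unfolded emeasure] pos[OF r(2)], of R]) blast
    show ?thesis
    proof (rule energy_Fatou[where Kn = "\<lambda>_. K"])
      fix n
      show "f n \<in> borel_measurable borel" "g n \<in> borel_measurable borel"
        using f(1) g(1) by (auto intro: borel_measurable_continuous_onI)
      have "\<forall>\<epsilon>>0. \<exists>\<delta>>0. \<forall>x y. dist x y < \<delta> \<longrightarrow> \<bar>f n x - f n y\<bar> \<le> \<epsilon> \<and> \<bar>g n x - g n y\<bar> \<le> \<epsilon>"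
      proof (intro allI impI)
        fix \<epsilon> :: real assume \<epsilon>: "0 < \<epsilon>"
        obtain \<delta> where \<delta>: "\<delta> > 0" "\<And>x y. dist x y < \<delta> \<Longrightarrow> \<bar>f n x - f n y\<bar> \<le> \<epsilon>"
          using continuous_modulus[OF f(1) f(4) \<epsilon>] by metis
        obtain \<delta>' where \<delta>': "\<delta>' > 0" "\<And>x y. dist x y < \<delta>' \<Longrightarrow> \<bar>g n x - g n y\<bar> \<le> \<epsilon>"
          using continuous_modulus[OF g(1) g(4) \<epsilon>] by metis
        show "\<exists>\<delta>>0. \<forall>x y. dist x y < \<delta> \<longrightarrow> \<bar>f n x - f n y\<bar> \<le> \<epsilon> \<and> \<bar>g n x - g n y\<bar> \<le> \<epsilon>"
          using \<delta> \<delta>' by (intro exI[of _ "min \<delta> \<delta>'"]) auto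
      qed
      \<comment> \<open>At each stage the two continuous functions define their own class: a common
        modulus for this one pair suffices, uniformity in \<open>n\<close> being irrelevant.\<close>
      then obtain d where d: "\<And>\<epsilon>. \<epsilon> > 0 \<Longrightarrow> d \<epsilon> > 0"
        "\<And>\<epsilon> x y. \<epsilon> > 0 \<Longrightarrow> dist x y < d \<epsilon> \<Longrightarrow> \<bar>f n x - f n y\<bar> \<le> \<epsilon> \<and> \<bar>g n x - g n y\<bar> \<le> \<epsilon>"
        by metis
      show "energy K (f n) (g n) \<le> ?E"
      proof (rule energy_le_balls_class[OF _ _ d(1) refl refl])
        show "f n \<in> density_class d R (emeasure lborel (ball (0::'a) r1))"
          unfolding density_class_def emeasure using f(2-5) d(2) by blast
        show "g n \<in> density_class d R (emeasure lborel (ball (0::'a) r2))"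
          unfolding density_class_def emeasure using g(2-5) d(2) by blast
      qed
    qed (use f(6) g(6) in auto)
  qed
  show ?thesis
  proof (rule energy_Fatou[where Kn = "\<lambda>_. K" and un = "\<lambda>n x. u x * cutoff (real n) x"
        and vn = "\<lambda>n x. v x * cutoff (real n) x"])
    have "(\<lambda>n. w x * cutoff (real n) x) \<longlonglongrightarrow> w x" for w :: "'a \<Rightarrow> real" and x
      using tendsto_mult_left[OF cutoff_tendsto, of "w x" x] by simp
    then show "AE x in lborel. (\<lambda>n. u x * cutoff (real n) x) \<longlonglongrightarrow> u x"
      "AE x in lborel. (\<lambda>n. v x * cutoff (real n) x) \<longlonglongrightarrow> v x"
      by (auto intro: AE_I2)
    show "energy K (\<lambda>x. u x * cutoff (real n) x) (\<lambda>x. v x * cutoff (real n) x) \<le> ?E" for n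
      by (rule cut)
  qed auto
qed

text \<open>Truncation at height \<open>n\<close> preserves radial monotonicity, supplies the bound
  of the previous locale, and agrees with \<open>K z\<close> from some \<open>n\<close> on.\<close>

theorem (in radial_kernel) riesz_balls:
  fixes u v :: "'a \<Rightarrow> real"
  assumes [measurable]: "u \<in> borel_measurable borel" "v \<in> borel_measurable borel"
    and u: "\<And>x. 0 \<le> u x" "\<And>x. u x \<le> 1" and v: "\<And>x. 0 \<le> v x" "\<And>x. v x \<le> 1"
    and mass: "(\<integral>\<^sup>+ x. ennreal (u x) \<partial>lborel) \<le> emeasure lborel (ball 0 r1 :: 'a set)"
      "(\<integral>\<^sup>+ x. ennreal (v x) \<partial>lborel) \<le> emeasure lborel (ball 0 r2 :: 'a set)"
    and r: "0 < r1" "0 < r2"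
  shows "energy K u v \<le> energy K (indicator (ball 0 r1)) (indicator (ball 0 r2))"
proof -
  let ?K = "\<lambda>n z. min (K z) (real n)"
  show ?thesis
  proof (rule energy_Fatou[where Kn = ?K and un = "\<lambda>_. u" and vn = "\<lambda>_. v"])
    show "(\<lambda>n. ?K n z) \<longlonglongrightarrow> K z" for z
    proof (rule tendsto_eventually)
      show "\<forall>\<^sub>F n in sequentially. ?K n z = K z"
        using eventually_ge_at_top[of "nat \<lceil>K z\<rceil>"]
        by eventually_elim (simp add: min_def nat_le_iff ceiling_le_iff)
    qed
    fix n
    interpret b: bounded_radial_kernel "?K n" "real n"
      by unfold_locales (auto intro: K_nonneg min.mono K_antimono min.coboundedI1)
    have "energy (?K n) u v \<le> energy (?K n) (indicator (ball 0 r1)) (indicator (ball 0 r2))"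
      by (rule b.energy_le_balls_bounded) (use u v mass r in auto)
    also have "\<dots> \<le> energy K (indicator (ball 0 r1)) (indicator (ball 0 r2))"
      unfolding energy_def by (intro nn_integral_mono ennreal_leI mult_left_mono) auto
    finally show "energy (?K n) u v \<le> energy K (indicator (ball 0 r1)) (indicator (ball 0 r2))" .
  qed auto
qed

section \<open>Maximizers of the energy\<close>

lemma AE_ex_ball:
  fixes a :: "'a::euclidean_space"
  assumes "AE x in lborel. P x" and r: "0 < r"
  shows "\<exists>x\<in>ball a r. P x"
proof (rule ccontr)
  assume "\<not> ?thesis"
  then have "AE x in lborel. x \<notin> ball a r"
    using assms(1) by (auto elim!: eventually_mono)
  then have "emeasure lborel (ball a r) = 0"
    by (subst (asm) AE_iff_measurable[OF _ refl]) (auto simp: ball_def)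
  then show False using content_ball_pos[OF r, of a] by (simp add: measure_def)
qed

lemma AE_ex_not:
  assumes "AE x in M. Q x" "\<not> (AE x in M. P x)"
  shows "\<exists>x. Q x \<and> \<not> P x"
proof (rule ccontr)
  assume "\<not> ?thesis"
  then have "AE x in M. P x" using assms(1) by (auto elim: eventually_mono)
  with assms(2) show False ..
qed

section \<open>Symmetry, order and mass across parallel mirrors\<close>

definition mirror_sym :: "'a::euclidean_space \<Rightarrow> real \<Rightarrow> ('a \<Rightarrow> real) \<Rightarrow> bool" where
  "mirror_sym e s w \<longleftrightarrow> (AE x in lborel. w (mirror e s x) = w x)"

definition mirror_ord :: "'a::euclidean_space \<Rightarrow> real \<Rightarrow> ('a \<Rightarrow> real) \<Rightarrow> bool" where
  "mirror_ord e s w \<longleftrightarrow> (AE x in lborel. x \<bullet> e < s \<longrightarrow> w (mirror e s x) \<le> w x)"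

text \<open>The opposite open half-space is covered too: \<open>(- e, - s)\<close> describes the
  same mirror with its sides exchanged, so \<open>half_mass (- e) (- s) w\<close> is the mass where
  \<open>x \<bullet> e > s\<close>.\<close>

definition half_mass :: "'a::euclidean_space \<Rightarrow> real \<Rightarrow> ('a \<Rightarrow> real) \<Rightarrow> ennreal" where
  "half_mass e s w = (\<integral>\<^sup>+ x. ennreal (w x) * indicator {x. x \<bullet> e < s} x \<partial>lborel)"

lemma mirror_sym_minus: "mirror_sym (- e) (- s) w = mirror_sym e s w"
  by (simp add: mirror_sym_def mirror_minus)

lemma mirror_symI:
  assumes e: "norm e = 1" and "AE x in lborel. x \<bullet> e < s \<longrightarrow> w (mirror e s x) = w x"
  shows "mirror_sym e s w"
  unfolding mirror_sym_def using AE_mirror[OF assms, of s] assms(2)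
proof eventually_elim
  case (elim x)
  show ?case
  proof (cases "x \<bullet> e" s rule: linorder_cases)
    case greater
    then show ?thesis using elim(1) by (simp add: inner_mirror[OF e] mirror_mirror[OF e])
  qed (use elim(2) in \<open>simp_all add: mirror_fixed\<close>)
qed

lemma half_mass_mono: "s \<le> t \<Longrightarrow> half_mass e s w \<le> half_mass e t w"
  unfolding half_mass_def by (intro nn_integral_mono) (auto simp: indicator_def)

lemma half_space_measurable[measurable]: "{x::'a::euclidean_space. x \<bullet> e < s} \<in> sets borel"
  by measurable

lemma half_mass_mirror:
  assumes [measurable]: "w \<in> borel_measurable borel" and e: "norm e = 1"
  shows "half_mass (- e) (- t) w
    = (\<integral>\<^sup>+ x. ennreal (w (mirror e s x)) * indicator {x. x \<bullet> e < 2 * s - t} x \<partial>lborel)"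
proof -
  have "half_mass (- e) (- t) w
    = (\<integral>\<^sup>+ x. ennreal (w (mirror e s x)) * indicator {x. x \<bullet> (- e) < - t} (mirror e s x) \<partial>lborel)"
    unfolding half_mass_def by (rule nn_integral_mirror[symmetric, OF _ e]) measurable
  also have "\<dots> = (\<integral>\<^sup>+ x. ennreal (w (mirror e s x)) * indicator {x. x \<bullet> e < 2 * s - t} x \<partial>lborel)"
    by (intro nn_integral_cong) (auto simp: indicator_def inner_mirror[OF e])
  finally show ?thesis .
qed

lemma half_mass_sym:
  assumes w[measurable]: "w \<in> borel_measurable borel" and e: "norm e = 1" and "mirror_sym e s w"
  shows "half_mass (- e) (- t) w = half_mass e (2 * s - t) w"
  unfolding half_mass_mirror[OF w e, of t s]
  using assms(3) unfolding half_mass_def mirror_sym_def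
  by (intro nn_integral_cong_AE, eventually_elim) simp

lemma half_mass_le: "half_mass e s w \<le> (\<integral>\<^sup>+ x. ennreal (w x) \<partial>lborel)"
  unfolding half_mass_def by (intro nn_integral_mono) (auto simp: indicator_def)

text \<open>If the heavier side did not have strictly more mass, the ordered mirror values would
  coincide almost everywhere.\<close>

lemma half_mass_ord_less:
  assumes w[measurable]: "w \<in> borel_measurable borel" and w0: "\<And>x. 0 \<le> w x" and e: "norm e = 1"
    and ord: "mirror_ord e s w" and asym: "\<not> mirror_sym e s w"
    and fin: "(\<integral>\<^sup>+ x. ennreal (w x) \<partial>lborel) \<noteq> \<infinity>"
  shows "half_mass (- e) (- s) w < half_mass e s w"
proof (rule ccontr)
  assume n: "\<not> ?thesis"
  have m: "half_mass (- e) (- s) w = (\<integral>\<^sup>+ x. ennreal (w (mirror e s x)) * indicator {x. x \<bullet> e < s} x \<partial>lborel)"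
    using half_mass_mirror[OF w e, of s s] by simp
  have "AE x in lborel. ennreal (w (mirror e s x)) * indicator {x. x \<bullet> e < s} x
      = ennreal (w x) * indicator {x. x \<bullet> e < s} x"
  proof (rule nn_integral_eq_imp_AE)
    show "AE x in lborel. ennreal (w (mirror e s x)) * indicator {x. x \<bullet> e < s} x
        \<le> ennreal (w x) * indicator {x. x \<bullet> e < s} x"
      using ord unfolding mirror_ord_def by eventually_elim (auto simp: indicator_def ennreal_leI)
    show "(\<integral>\<^sup>+ x. ennreal (w x) * indicator {x. x \<bullet> e < s} x \<partial>lborel)
      \<le> (\<integral>\<^sup>+ x. ennreal (w (mirror e s x)) * indicator {x. x \<bullet> e < s} x \<partial>lborel)"
      using n unfolding m[symmetric] half_mass_def[of e s w, symmetric] by (simp add: not_less)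
    show "(\<integral>\<^sup>+ x. ennreal (w (mirror e s x)) * indicator {x. x \<bullet> e < s} x \<partial>lborel) \<noteq> \<infinity>"
      using half_mass_le[of "- e" "- s" w] fin unfolding m[symmetric] by (auto simp: top_unique)
  qed measurable
  then have "AE x in lborel. x \<bullet> e < s \<longrightarrow> w (mirror e s x) = w x"
    using w0 by (auto elim!: eventually_mono simp: indicator_def)
  with asym mirror_symI[OF e] show False by blast
qed

lemma nn_integral_total_half_mass:
  assumes [measurable]: "w \<in> borel_measurable borel"
  shows "half_mass (- e) (- s) w + half_mass e s w \<le> (\<integral>\<^sup>+ x. ennreal (w x) \<partial>lborel)"
proof -
  have "half_mass (- e) (- s) w + half_mass e s w = (\<integral>\<^sup>+ x. ennreal (w x) * indicator {x. x \<bullet> (- e) < - s} x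
      + ennreal (w x) * indicator {x. x \<bullet> e < s} x \<partial>lborel)"
    unfolding half_mass_def by (rule nn_integral_add[symmetric]) measurable
  also have "\<dots> \<le> (\<integral>\<^sup>+ x. ennreal (w x) \<partial>lborel)"
    by (intro nn_integral_mono) (auto simp: indicator_def)
  finally show ?thesis .
qed

text \<open>Two parallel mirrors generate a translation, and an integrable translation invariant
  function vanishes.\<close>

lemma mirror_sym_unique:
  assumes w[measurable]: "w \<in> borel_measurable borel" and w0: "\<And>x. 0 \<le> w x" and e: "norm e = 1"
    and fin: "(\<integral>\<^sup>+ x. ennreal (w x) \<partial>lborel) \<noteq> \<infinity>" and pos: "(\<integral>\<^sup>+ x. ennreal (w x) \<partial>lborel) \<noteq> 0"
    and sym: "mirror_sym e s1 w" "mirror_sym e s2 w"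
  shows "s1 = s2"
proof (rule ccontr)
  have False if sym: "mirror_sym e s1 w" "mirror_sym e s2 w" and "s1 < s2" for s1 s2
  proof -
    define \<tau> where "\<tau> = 2 * (s2 - s1)"
    have \<tau>: "0 < \<tau>" using \<open>s1 < s2\<close> by (simp add: \<tau>_def)
    have per: "half_mass e (a + \<tau>) w = half_mass e a w" for a
      using half_mass_sym[OF w e sym(1), of "2 * s1 - a"] half_mass_sym[OF w e sym(2), of "2 * s1 - a"]
      by (simp add: \<tau>_def algebra_simps)
    have pern: "half_mass e (a + real n * \<tau>) w = half_mass e a w" for a n
    proof (induction n)
      case (Suc n)
      then show ?case using per[of "a + real n * \<tau>"] by (simp add: algebra_simps)
    qed simp
    \<comment> \<open>A nondecreasing periodic function is constant; every slab between two parallel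
      hyperplanes therefore carries no mass.\<close>
    have const: "half_mass e b w \<le> half_mass e a w" for a b
    proof -
      obtain n :: nat where "(b - a) / \<tau> < real n" using reals_Archimedean2 by blast
      then have "b \<le> a + real n * \<tau>" using \<tau> by (simp add: divide_less_eq)
      from half_mass_mono[OF this, of e w] show ?thesis by (simp add: pern)
    qed
    have slab: "AE x in lborel. - real n \<le> x \<bullet> e \<and> x \<bullet> e < real n \<longrightarrow> w x = 0" for n
    proof -
      let ?S = "{x. - real n \<le> x \<bullet> e \<and> x \<bullet> e < real n}"
      have [measurable]: "?S \<in> sets borel" by measurable
      have "half_mass e (real n) w = half_mass e (- real n) w + (\<integral>\<^sup>+ x. ennreal (w x) * indicator ?S x \<partial>lborel)"
        unfolding half_mass_def
        by (subst nn_integral_add[symmetric]) (auto intro!: nn_integral_cong simp: indicator_def)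
      then have "half_mass e (- real n) w + (\<integral>\<^sup>+ x. ennreal (w x) * indicator ?S x \<partial>lborel)
          \<le> half_mass e (- real n) w + 0"
        using const[of "real n" "- real n"] by simp
      moreover have "half_mass e (- real n) w \<noteq> \<infinity>"
        using half_mass_le[of e "- real n" w] fin by (auto simp: top_unique)
      ultimately have "(\<integral>\<^sup>+ x. ennreal (w x) * indicator ?S x \<partial>lborel) = 0"
        by (simp only: ennreal_add_left_cancel_le) simp
      then show ?thesis
        using w0 by (subst (asm) nn_integral_0_iff_AE)
          (auto elim!: eventually_mono simp: indicator_def ennreal_eq_0_iff intro: antisym)
    qed
    have "AE x in lborel. \<forall>n::nat. - real n \<le> x \<bullet> e \<and> x \<bullet> e < real n \<longrightarrow> w x = 0"
      unfolding AE_all_countable using slab by blast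
    then have "AE x in lborel. ennreal (w x) = 0"
    proof eventually_elim
      case (elim x)
      obtain n :: nat where "\<bar>x \<bullet> e\<bar> < real n" using reals_Archimedean2 by blast
      then have "- real n \<le> x \<bullet> e \<and> x \<bullet> e < real n" by linarith
      then have "w x = 0" using elim by blast
      then show ?case by simp
    qed
    then show False using pos by (subst (asm) nn_integral_0_iff_AE[symmetric]) auto
  qed
  moreover assume "s1 \<noteq> s2"
  ultimately show False using sym by (metis linorder_neqE)
qed

text \<open>If one half never outweighed the other, twice its mass would stay below the total,
  although the half-mass tends to the total as \<open>s\<close> grows.\<close>

lemma half_mass_large:
  assumes w[measurable]: "w \<in> borel_measurable borel"
    and fin: "(\<integral>\<^sup>+ x. ennreal (w x) \<partial>lborel) \<noteq> \<infinity>" and pos: "(\<integral>\<^sup>+ x. ennreal (w x) \<partial>lborel) \<noteq> 0"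
  shows "\<exists>s. half_mass (- e) (- s) w < half_mass e s w"
proof (rule ccontr)
  assume "\<not> ?thesis"
  then have n: "half_mass e s w \<le> half_mass (- e) (- s) w" for s by (simp add: not_less)
  let ?T = "\<integral>\<^sup>+ x. ennreal (w x) \<partial>lborel"
  have "(\<lambda>n. half_mass e (real n) w) \<longlonglongrightarrow> ?T"
    unfolding half_mass_def
  proof (rule nn_integral_dominated_convergence[where w = "\<lambda>x. ennreal (w x)"])
    show "AE x in lborel. (\<lambda>n. ennreal (w x) * indicator {x. x \<bullet> e < real n} x) \<longlonglongrightarrow> ennreal (w x)"
    proof (intro AE_I2 tendsto_eventually)
      fix x
      show "\<forall>\<^sub>F n in sequentially. ennreal (w x) * indicator {x. x \<bullet> e < real n} x = ennreal (w x)"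
        using filterlim_real_sequentially[unfolded filterlim_at_top_dense, rule_format, of "x \<bullet> e"]
        by eventually_elim simp
    qed
  qed (use fin in \<open>auto simp: indicator_def less_top\<close>)
  then have "(\<lambda>n. half_mass e (real n) w + half_mass e (real n) w) \<longlonglongrightarrow> ?T + ?T"
    by (intro tendsto_add)
  moreover have "half_mass e (real k) w + half_mass e (real k) w \<le> ?T" for k
    using add_right_mono[OF n[of "real k"]] nn_integral_total_half_mass[OF w, of e "real k"]
    by (rule order_trans)
  ultimately have "?T + ?T \<le> ?T" by (intro LIMSEQ_le_const2) auto
  then have "?T + ?T \<le> ?T + 0" by simp
  then show False using fin pos by (simp only: ennreal_add_left_cancel_le) auto
qed

section \<open>Mirrors and thresholds of a maximizing pair\<close>

locale energy_maximizer = strict_radial_kernel K for K :: "'a::euclidean_space \<Rightarrow> real" +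
  fixes u v :: "'a \<Rightarrow> real" and r1 r2 :: real
  assumes u_meas[measurable]: "u \<in> borel_measurable borel" and v_meas[measurable]: "v \<in> borel_measurable borel"
    and u_range: "\<And>x. 0 \<le> u x" "\<And>x. u x \<le> 1" and v_range: "\<And>x. 0 \<le> v x" "\<And>x. v x \<le> 1"
    and u_mass: "(\<integral>\<^sup>+ x. ennreal (u x) \<partial>lborel) \<le> emeasure lborel (ball 0 r1 :: 'a set)"
    and v_mass: "(\<integral>\<^sup>+ x. ennreal (v x) \<partial>lborel) \<le> emeasure lborel (ball 0 r2 :: 'a set)"
    and r_pos: "0 < r1" "0 < r2"
    and maximal: "energy K u v = energy K (indicator (ball 0 r1)) (indicator (ball 0 r2))"
    and finite_energy: "energy K u v \<noteq> \<infinity>"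
begin

text \<open>The assumptions are symmetric in the two densities, so a second interpretation transfers
  every fact about \<open>u\<close> to \<open>v\<close>.\<close>

lemma swap: "energy_maximizer K v u r2 r1"
proof
  show "energy K v u = energy K (indicator (ball 0 r2)) (indicator (ball 0 r1))" "energy K v u \<noteq> \<infinity>"
    using maximal finite_energy by (simp_all add: energy_commute[of v u] energy_commute[of "indicator (ball 0 r2)"])
qed (use u_range v_range u_mass v_mass r_pos in auto)

lemma u_finite: "(\<integral>\<^sup>+ x. ennreal (u x) \<partial>lborel) \<noteq> \<infinity>"
  using u_mass emeasure_lborel_ball_finite[of "0::'a" r1] by (auto simp: top_unique)

lemma K_pos: "0 < K x"
proof -
  obtain y :: 'a where "norm y = norm x + 1" using vector_choose_size[of "norm x + 1"] by auto
  then have "K y < K x" by (intro K_strict) simp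
  then show ?thesis using K_nonneg[of y] by simp
qed

lemma energy_pos: "energy K u v \<noteq> 0"
proof
  assume "energy K u v = 0"
  then have "(\<integral>\<^sup>+ y. ennreal (indicator (ball 0 r2) y) * potential K (indicator (ball 0 r1)) y \<partial>lborel) = 0"
    unfolding maximal by (subst (asm) energy_eq_potential) auto
  then have "AE y in lborel. ennreal (indicator (ball 0 r2) y) * potential K (indicator (ball 0 r1)) y = 0"
    by (subst (asm) nn_integral_0_iff_AE) auto
  from AE_ex_ball[OF this r_pos(2), of 0] obtain y where "potential K (indicator (ball 0 r1)) y = 0"
    by auto
  then have "AE x in lborel. ennreal (indicator (ball 0 r1) x * K (x - y)) = 0"
    unfolding potential_def by (subst (asm) nn_integral_0_iff_AE) auto
  from AE_ex_ball[OF this r_pos(1), of 0] obtain x where "ennreal (K (x - y)) = 0"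
    by auto
  then show False using K_pos[of "x - y"] by (simp add: ennreal_eq_0_iff)
qed

lemma u_nonzero: "(\<integral>\<^sup>+ x. ennreal (u x) \<partial>lborel) \<noteq> 0"
proof
  assume "(\<integral>\<^sup>+ x. ennreal (u x) \<partial>lborel) = 0"
  then have "AE x in lborel. u x = 0"
    using u_range by (subst (asm) nn_integral_0_iff_AE) (auto elim!: eventually_mono simp: ennreal_eq_0_iff intro: antisym)
  then have "(\<integral>\<^sup>+ x. ennreal (u x * v y * K (x - y)) \<partial>lborel) = 0" for y
    by (subst nn_integral_0_iff_AE) (auto elim!: eventually_mono)
  then show False using energy_pos by (simp add: energy_def)
qed

text \<open>Finite energy of the balls yields a point \<open>z\<close> at which the potential of the
  first ball is finite, hence integrability of \<open>K\<close> near 0. Farther away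
  \<open>K\<close> is at most its value at distance \<open>\<delta>\<close>, and \<open>u\<close>
  has finite mass.\<close>

lemma potential_finite: "potential K u y \<noteq> \<infinity>"
proof -
  have "(\<integral>\<^sup>+ y. ennreal (indicator (ball 0 r2) y) * potential K (indicator (ball 0 r1)) y \<partial>lborel) \<noteq> \<infinity>"
    using finite_energy unfolding maximal by (subst (asm) energy_eq_potential) auto
  then have "AE y in lborel. ennreal (indicator (ball 0 r2) y) * potential K (indicator (ball 0 r1)) y \<noteq> \<infinity>"
    by (intro nn_integral_noteq_infinite) auto
  from AE_ex_ball[OF this, of "min r1 r2" 0] obtain z where z: "norm z < r1" "norm z < r2"
    "potential K (indicator (ball 0 r1)) z \<noteq> \<infinity>"
    using r_pos by auto
  define \<delta> where "\<delta> = r1 - norm z"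
  have \<delta>: "0 < \<delta>" using z by (simp add: \<delta>_def)
  obtain p :: 'a where p: "norm p = \<delta>" using vector_choose_size[of \<delta>] \<delta> by auto
  let ?L = "\<lambda>x. ennreal (indicator (ball 0 \<delta>) x * K x)"
  have "(\<integral>\<^sup>+ x. ?L x \<partial>lborel) = (\<integral>\<^sup>+ x. ?L (x + - z) \<partial>lborel)"
    by (rule nn_integral_translate[symmetric]) measurable
  also have "\<dots> \<le> potential K (indicator (ball 0 r1)) z"
    unfolding potential_def
  proof (intro nn_integral_mono ennreal_leI)
    fix x
    have "norm x \<le> norm (x - z) + norm z" by (metis norm_triangle_sub add.commute)
    then show "indicator (ball 0 \<delta>) (x + - z) * K (x + - z) \<le> indicator (ball 0 r1) x * K (x - z)"
      using K_nonneg by (auto simp: indicator_def \<delta>_def)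
  qed
  finally have L: "(\<integral>\<^sup>+ x. ?L x \<partial>lborel) \<noteq> \<infinity>" using z(3) by (auto simp: top_unique)
  have "potential K u y \<le> (\<integral>\<^sup>+ x. ?L (x + - y) + ennreal (K p) * ennreal (u x) \<partial>lborel)"
    unfolding potential_def
  proof (rule nn_integral_mono)
    fix x
    have "u x * K (x - y) \<le> indicator (ball 0 \<delta>) (x + - y) * K (x + - y) + K p * u x"
    proof (cases "norm (x - y) < \<delta>")
      case True
      have "u x * K (x - y) \<le> 1 * K (x - y)" using u_range K_nonneg by (intro mult_right_mono) auto
      moreover have "0 \<le> K p * u x" using u_range K_nonneg by simp
      ultimately show ?thesis using True by (simp add: indicator_def)
    next
      case False
      then have "K (x - y) \<le> K p" by (intro K_antimono) (simp add: p)
      then have "u x * K (x - y) \<le> K p * u x" using mult_right_mono[of "K (x - y)" "K p" "u x"] u_range(1)[of x] by (simp add: mult.commute)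
      then show ?thesis using False by (simp add: indicator_def)
    qed
    then have "ennreal (u x * K (x - y)) \<le> ennreal (indicator (ball 0 \<delta>) (x + - y) * K (x + - y) + K p * u x)"
      by (rule ennreal_leI)
    also have "\<dots> = ?L (x + - y) + ennreal (K p) * ennreal (u x)"
      using K_nonneg u_range by (subst ennreal_plus) (auto simp: ennreal_mult)
    finally show "ennreal (u x * K (x - y)) \<le> ?L (x + - y) + ennreal (K p) * ennreal (u x)" .
  qed
  also have "\<dots> = (\<integral>\<^sup>+ x. ?L (x + - y) \<partial>lborel) + (\<integral>\<^sup>+ x. ennreal (K p) * ennreal (u x) \<partial>lborel)"
    by (rule nn_integral_add) measurable
  also have "(\<integral>\<^sup>+ x. ?L (x + - y) \<partial>lborel) = (\<integral>\<^sup>+ x. ?L x \<partial>lborel)"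
    by (rule nn_integral_translate) measurable
  also have "(\<integral>\<^sup>+ x. ennreal (K p) * ennreal (u x) \<partial>lborel) = ennreal (K p) * (\<integral>\<^sup>+ x. ennreal (u x) \<partial>lborel)"
    by (rule nn_integral_cmult) measurable
  finally show ?thesis using L u_finite by (auto simp: top_unique ennreal_mult_eq_top_iff)
qed

text \<open>The polarized pair is again a competitor, so equality holds in the polarization
  inequality. A single \<open>y\<close> with positive mirror difference of \<open>v\<close> forces
  the order of \<open>u\<close>, and one with negative difference forces the reverse order. If both
  signs occur, \<open>u\<close> is symmetric; if neither does, \<open>v\<close> is.\<close>

lemma trichotomy:
  assumes e: "norm e = 1"
  shows "mirror_sym e s u \<or> mirror_sym e s v \<or> (mirror_ord e s u \<and> mirror_ord e s v)
    \<or> (mirror_ord (- e) (- s) u \<and> mirror_ord (- e) (- s) v)"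
proof -
  let ?a = "\<lambda>x. u x - u (mirror e s x)" and ?b = "\<lambda>y. v y - v (mirror e s y)"
  have "energy K (polarize e s u) (polarize e s v) \<le> energy K u v"
    unfolding maximal
  proof (rule riesz_balls)
    show "0 \<le> polarize e s u x" "polarize e s u x \<le> 1" "0 \<le> polarize e s v x" "polarize e s v x \<le> 1" for x
      using u_range v_range by (auto simp: polarize_def max_def min_def)
    show "(\<integral>\<^sup>+ x. ennreal (polarize e s u x) \<partial>lborel) \<le> emeasure lborel (ball 0 r1 :: 'a set)"
      "(\<integral>\<^sup>+ x. ennreal (polarize e s v x) \<partial>lborel) \<le> emeasure lborel (ball 0 r2 :: 'a set)"
      using u_mass v_mass u_range v_range e by (simp_all add: nn_integral_polarize)
  qed (use r_pos in auto)
  then have prod: "AE y in lborel. AE x in lborel. x \<bullet> e < s \<and> y \<bullet> e < s \<longrightarrow> 0 \<le> ?a x * ?b y"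
    by (intro energy_polarize_eq) (use u_range v_range e finite_energy in auto)
  have flip: "mirror_ord (- e) (- s) w" if "AE x in lborel. x \<bullet> e < s \<longrightarrow> w x \<le> w (mirror e s x)" for w :: "'a \<Rightarrow> real"
    unfolding mirror_ord_def mirror_minus using AE_mirror[OF e that, of s]
    by eventually_elim (simp add: inner_mirror[OF e] mirror_mirror[OF e])
  have pos: "mirror_ord e s u" if nb: "\<not> (AE y in lborel. y \<bullet> e < s \<longrightarrow> ?b y \<le> 0)"
  proof -
    obtain y where "y \<bullet> e < s" "0 < ?b y" "AE x in lborel. x \<bullet> e < s \<and> y \<bullet> e < s \<longrightarrow> 0 \<le> ?a x * ?b y"
      using AE_ex_not[OF prod nb] by (auto simp: not_le)
    from this(3) show ?thesis unfolding mirror_ord_def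
    proof eventually_elim
      case (elim x)
      then show ?case using \<open>y \<bullet> e < s\<close> \<open>0 < ?b y\<close> by (auto simp: zero_le_mult_iff)
    qed
  qed
  have neg: "AE x in lborel. x \<bullet> e < s \<longrightarrow> u x \<le> u (mirror e s x)"
    if nb: "\<not> (AE y in lborel. y \<bullet> e < s \<longrightarrow> 0 \<le> ?b y)"
  proof -
    obtain y where "y \<bullet> e < s" "?b y < 0" "AE x in lborel. x \<bullet> e < s \<and> y \<bullet> e < s \<longrightarrow> 0 \<le> ?a x * ?b y"
      using AE_ex_not[OF prod nb] by (auto simp: not_le)
    from this(3) show ?thesis
    proof eventually_elim
      case (elim x)
      then show ?case using \<open>y \<bullet> e < s\<close> \<open>?b y < 0\<close> by (auto simp: zero_le_mult_iff)
    qed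
  qed
  consider (zero) "AE y in lborel. y \<bullet> e < s \<longrightarrow> ?b y \<le> 0" "AE y in lborel. y \<bullet> e < s \<longrightarrow> 0 \<le> ?b y"
    | (both) "\<not> (AE y in lborel. y \<bullet> e < s \<longrightarrow> ?b y \<le> 0)" "\<not> (AE y in lborel. y \<bullet> e < s \<longrightarrow> 0 \<le> ?b y)"
    | (up) "\<not> (AE y in lborel. y \<bullet> e < s \<longrightarrow> ?b y \<le> 0)" "AE y in lborel. y \<bullet> e < s \<longrightarrow> 0 \<le> ?b y"
    | (down) "AE y in lborel. y \<bullet> e < s \<longrightarrow> ?b y \<le> 0" "\<not> (AE y in lborel. y \<bullet> e < s \<longrightarrow> 0 \<le> ?b y)"
    by blast
  then show ?thesis
  proof cases
    case zero
    then have "AE y in lborel. y \<bullet> e < s \<longrightarrow> v (mirror e s y) = v y" by eventually_elim auto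
    then show ?thesis using mirror_symI[OF e] by blast
  next
    case both
    have "AE x in lborel. x \<bullet> e < s \<longrightarrow> u (mirror e s x) = u x"
      using pos[OF both(1)] neg[OF both(2)] unfolding mirror_ord_def by eventually_elim auto
    then show ?thesis using mirror_symI[OF e] by blast
  next
    case up
    have "mirror_ord e s v" unfolding mirror_ord_def using up(2) by eventually_elim auto
    then show ?thesis using pos[OF up(1)] by blast
  next
    case down
    have "mirror_ord (- e) (- s) v" using down(1) by (intro flip) (auto elim!: eventually_mono)
    then show ?thesis using flip[OF neg[OF down(2)]] by blast
  qed
qed

end

context energy_maximizer
begin

text \<open>Strictness means only that neither density is symmetric up to null sets, which suffices
  for strict inequalities between half masses and between potentials.\<close>

definition ordered :: "'a \<Rightarrow> real \<Rightarrow> bool" where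
  "ordered e s \<longleftrightarrow> (mirror_ord e s u \<and> \<not> mirror_sym e s u) \<and> (mirror_ord e s v \<and> \<not> mirror_sym e s v)"

lemma ordered_half_mass:
  assumes e: "norm e = 1" and "ordered e s"
  shows "half_mass (- e) (- s) u < half_mass e s u" "half_mass (- e) (- s) v < half_mass e s v"
proof -
  interpret s: energy_maximizer K v u r2 r1 by (rule swap)
  show "half_mass (- e) (- s) u < half_mass e s u" "half_mass (- e) (- s) v < half_mass e s v"
    using assms u_range v_range u_finite s.u_finite
    by (auto intro!: half_mass_ord_less simp: ordered_def)
qed

text \<open>Moving the mirror further away from the heavier side only widens the gap between the
  half masses, while symmetry would make them equal.\<close>

lemma not_symmetric_above:
  assumes e: "norm e = 1" and "ordered e t" "t \<le> s"
  shows "\<not> mirror_sym e s u" "\<not> mirror_sym e s v"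
proof -
  have "\<not> mirror_sym e s w" if [measurable]: "w \<in> borel_measurable borel"
    and w: "half_mass (- e) (- t) w < half_mass e t w" for w
  proof
    assume "mirror_sym e s w"
    then have "half_mass (- e) (- s) w = half_mass e s w"
      using half_mass_sym[OF that(1) e, of s s] by simp
    moreover have "half_mass (- e) (- s) w \<le> half_mass (- e) (- t) w" "half_mass e t w \<le> half_mass e s w"
      using assms(3) by (auto intro: half_mass_mono)
    ultimately show False using w by (metis leD le_less_trans order.trans)
  qed
  then show "\<not> mirror_sym e s u" "\<not> mirror_sym e s v"
    using ordered_half_mass[OF e assms(2)] u_meas v_meas by auto
qed

text \<open>All but at most two mirrors orthogonal to \<open>e\<close> order both densities strictly, and the
  side of the larger values is the one carrying the larger part of the mass of \<open>u\<close>.\<close>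

lemma ex_ordered_threshold:
  assumes e: "norm e = 1"
  shows "\<exists>t. (\<forall>s>t. ordered e s) \<and> (\<forall>s<t. ordered (- e) (- s))"
proof -
  interpret s: energy_maximizer K v u r2 r1 by (rule swap)
  have e': "norm (- e) = 1" using e by simp
  \<comment> \<open>The mirrors whose far side carries more of \<open>u\<close>; this set is closed
    downwards, and its supremum will be the threshold.\<close>
  define P where "P = {s. half_mass e s u < half_mass (- e) (- s) u}"
  define E where "E = {s. mirror_sym e s u} \<union> {s. mirror_sym e s v}"
  have "finite {s. mirror_sym e s w}" if "w \<in> borel_measurable borel" "\<And>x. 0 \<le> w x"
    "(\<integral>\<^sup>+ x. ennreal (w x) \<partial>lborel) \<noteq> \<infinity>" "(\<integral>\<^sup>+ x. ennreal (w x) \<partial>lborel) \<noteq> 0" for w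
  proof (cases "\<exists>s. mirror_sym e s w")
    case True
    then obtain s where "mirror_sym e s w" by blast
    then have "{s. mirror_sym e s w} \<subseteq> {s}"
      using mirror_sym_unique[OF that(1,2) e that(3,4)] by blast
    then show ?thesis by (rule finite_subset) simp
  qed simp
  then have E: "finite E"
    unfolding E_def using u_range v_range u_finite s.u_finite u_nonzero s.u_nonzero by auto
  have dich: "ordered e s \<or> ordered (- e) (- s)" if "s \<notin> E" for s
    using trichotomy[OF e, of s] that by (auto simp: E_def ordered_def mirror_sym_minus)
  have up: "s \<notin> P" if "ordered e s" for s
    using ordered_half_mass(1)[OF e that] by (auto simp: P_def)
  have down: "s \<in> P" if "ordered (- e) (- s)" for s
    using ordered_half_mass(1)[OF e' that] by (auto simp: P_def)
  have closed: "s \<in> P" if "t \<in> P" "s \<le> t" for s t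
  proof -
    have "half_mass e s u \<le> half_mass e t u" "half_mass (- e) (- t) u \<le> half_mass (- e) (- s) u"
      using that(2) by (auto intro: half_mass_mono)
    then show ?thesis using that(1) unfolding P_def by (auto intro: le_less_trans less_le_trans)
  qed
  obtain b where "half_mass (- e) (- b) u < half_mass e b u"
    using half_mass_large[OF u_meas u_finite u_nonzero] by blast
  then have "b \<notin> P" by (auto simp: P_def)
  then have bdd: "bdd_above P" using closed by (intro bdd_aboveI[of _ b]) (metis linear)
  obtain a where "half_mass (- (- e)) (- a) u < half_mass (- e) a u"
    using half_mass_large[OF u_meas u_finite u_nonzero] by blast
  then have "- a \<in> P" by (simp add: P_def)
  then have ne: "P \<noteq> {}" by blast
  have above: "s \<notin> P" if "Sup P < s" for s
    using that cSup_upper[OF _ bdd] by force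
  have below: "s \<in> P" if "s < Sup P" for s
    using that less_cSup_iff[OF ne bdd] closed by (meson less_imp_le)
  have generic: "\<exists>r. a < r \<and> r < b \<and> r \<notin> E" if "a < b" for a b
    using infinite_Ioo[OF that] E by (metis finite_subset greaterThanLessThan_iff subsetI)
  show ?thesis
  proof (intro exI conjI allI impI)
    fix s assume s: "Sup P < s"
    \<comment> \<open>A non-exceptional mirror between the threshold and \<open>s\<close> is
      ordered, and \<open>not_symmetric_above\<close> carries this on to exclude symmetry at
      \<open>s\<close> itself. Exceptional mirrors can thus only sit at the threshold.\<close>
    obtain r where r: "Sup P < r" "r < s" "r \<notin> E" using generic[OF s] by blast
    then have "ordered e r" using dich[of r] down[of r] above[of r] by blast
    then have "s \<notin> E" using not_symmetric_above[OF e, of r s] r by (simp add: E_def)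
    then show "ordered e s" using dich[of s] down[of s] above[OF s] by blast
  next
    fix s assume s: "s < Sup P"
    obtain r where r: "s < r" "r < Sup P" "r \<notin> E" using generic[OF s] by blast
    then have "ordered (- e) (- r)" using dich[of r] up[of r] below[of r] by blast
    then have "s \<notin> E"
      using not_symmetric_above[OF e', of "- r" "- s"] r by (simp add: E_def mirror_sym_minus)
    then show "ordered (- e) (- s)" using dich[of s] up[of s] below[OF s] by blast
  qed
qed

lemma ordered_potential:
  assumes e: "norm e = 1" and "ordered e s" "x \<bullet> e < s"
  shows "potential K u (mirror e s x) < potential K u x" "potential K v (mirror e s x) < potential K v x"
proof -
  interpret s: energy_maximizer K v u r2 r1 by (rule swap)
  show "potential K u (mirror e s x) < potential K u x" "potential K v (mirror e s x) < potential K v x"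
    using assms u_range v_range potential_finite s.potential_finite
    by (auto intro!: potential_mirror_less simp: ordered_def mirror_ord_def mirror_sym_def)
qed

end

section \<open>Linearity of the threshold\<close>

text \<open>Cramer's rule in the span of \<open>a\<close> and \<open>b\<close>; the Gram determinant
  vanishes only for dependent vectors.\<close>

lemma solve_two_inner:
  fixes a b :: "'a::euclidean_space"
  assumes "\<not> (\<exists>c. b = c *\<^sub>R a)" "a \<noteq> 0"
  shows "\<exists>x. x \<bullet> a = p \<and> x \<bullet> b = q"
proof -
  define A B D where "A = a \<bullet> a" and "B = b \<bullet> b" and "D = a \<bullet> b"
  have "A * B - D * D \<noteq> 0"
  proof
    assume z: "A * B - D * D = 0"
    have A: "A \<noteq> 0" using assms(2) by (simp add: A_def)
    define c where "c = D / A"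
    have "(b - c *\<^sub>R a) \<bullet> (b - c *\<^sub>R a) = B - 2 * c * D + c * c * A"
      by (simp add: A_def B_def D_def inner_diff_left inner_diff_right inner_commute algebra_simps)
    also have "\<dots> = 0" using z A by (simp add: c_def field_simps)
    finally have "b = c *\<^sub>R a" by simp
    then show False using assms(1) by blast
  qed
  moreover have "((p * B - q * D) * A + (q * A - p * D) * D) / (A * B - D * D) = p * (A * B - D * D) / (A * B - D * D)"
    "((p * B - q * D) * D + (q * A - p * D) * B) / (A * B - D * D) = q * (A * B - D * D) / (A * B - D * D)"
    by (simp_all add: algebra_simps)
  ultimately have "(p * B - q * D) / (A * B - D * D) * A + (q * A - p * D) / (A * B - D * D) * D = p"
    "(p * B - q * D) / (A * B - D * D) * D + (q * A - p * D) / (A * B - D * D) * B = q"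
    by (simp_all only: times_divide_eq_left add_divide_distrib[symmetric]) simp_all
  then show ?thesis
    by (intro exI[of _ "((p * B - q * D) / (A * B - D * D)) *\<^sub>R a + ((q * A - p * D) / (A * B - D * D)) *\<^sub>R b"])
      (simp add: inner_add_left inner_commute[of b a] flip: A_def B_def D_def)
qed

text \<open>Going around a triangle \<open>0, d, d + d'\<close> based at a suitable point, a defect of additivity of
  the threshold \<open>h\<close> would make \<open>\<phi>\<close> increase along a closed path.\<close>

lemma threshold_linear:
  fixes \<phi> :: "'a::euclidean_space \<Rightarrow> 'b::linorder" and h :: "'a \<Rightarrow> real"
  assumes dec: "\<And>x d. d \<noteq> 0 \<Longrightarrow> h d < x \<bullet> d + (d \<bullet> d) / 2 \<Longrightarrow> \<phi> (x + d) < \<phi> x"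
    and inc: "\<And>x d. d \<noteq> 0 \<Longrightarrow> x \<bullet> d + (d \<bullet> d) / 2 < h d \<Longrightarrow> \<phi> x < \<phi> (x + d)"
    and scale: "\<And>c d. 0 < c \<Longrightarrow> h (c *\<^sub>R d) = c * h d" and zero: "h 0 = 0"
  shows "\<exists>x0. \<forall>d. h d = x0 \<bullet> d"
proof -
  have half: "a < (a - b) / 2" "b < - ((a - b) / 2)" if "a < - b" for a b :: real
    using that by (auto simp: field_simps)
  have half': "(a - b) / 2 < a" "- ((a - b) / 2) < b" if "- b < a" for a b :: real
    using that by (auto simp: field_simps)
  have odd: "h (- d) = - h d" for d
  proof (cases "d = 0")
    case False
    \<comment> \<open>The midpoint between \<open>h d\<close> and \<open>- h (- d)\<close>: if these
      differ, going from \<open>x\<close> to \<open>x + d\<close> and back changes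
      \<open>\<phi>\<close> in the same direction twice.\<close>
    define p where "p = (h d - h (- d)) / 2"
    define x where "x = ((p - (d \<bullet> d) / 2) / (d \<bullet> d)) *\<^sub>R d"
    have x: "x \<bullet> d + (d \<bullet> d) / 2 = p" using False by (simp add: x_def)
    then have y: "(x + d) \<bullet> (- d) + (- d \<bullet> - d) / 2 = - p" by (simp add: inner_add_left)
    show ?thesis
    proof (cases "h d" "- h (- d)" rule: linorder_cases)
      case less
      then have "h d < p" "h (- d) < - p" unfolding p_def using half by blast+
      then have "\<phi> (x + d) < \<phi> x" "\<phi> (x + d + - d) < \<phi> (x + d)"
        using dec[of d x] dec[of "- d" "x + d"] x y False by auto
      then show ?thesis by simp
    next
      case greater
      then have "p < h d" "- p < h (- d)" unfolding p_def using half' by blast+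
      then have "\<phi> x < \<phi> (x + d)" "\<phi> (x + d) < \<phi> (x + d + - d)"
        using inc[of d x] inc[of "- d" "x + d"] x y False by auto
      then show ?thesis by simp
    qed simp
  qed (simp add: zero)
  have hom: "h (c *\<^sub>R d) = c * h d" for c d
  proof (cases c "0::real" rule: linorder_cases)
    case less
    then show ?thesis using scale[of "- c" "- d"] by (simp add: odd)
  qed (simp_all add: zero scale)
  have add: "h (a + b) = h a + h b" for a b
  \<comment> \<open>Dependent vectors are settled by homogeneity, since the base point of the
    triangle is found only for independent ones.\<close>
  proof (cases "a = 0 \<or> (\<exists>c. b = c *\<^sub>R a)")
    case True
    then show ?thesis
    proof
      assume "\<exists>c. b = c *\<^sub>R a"
      then obtain c where "b = c *\<^sub>R a" by blast
      then have "a + b = (1 + c) *\<^sub>R a" by (simp add: scaleR_left_distrib)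
      then show ?thesis using \<open>b = c *\<^sub>R a\<close> by (simp only: hom) (simp add: algebra_simps)
    qed (simp add: zero)
  next
    case False
    have b0: "b \<noteq> 0" using False by (metis scaleR_zero_left)
    have ab0: "a + b \<noteq> 0" using False by (metis add_eq_0_iff scaleR_minus1_left)
    \<comment> \<open>The additivity defect is shared equally by the three edges: with the
      \<open>x\<close> below, each edge misses its threshold by exactly \<open>\<delta>\<close>,
      with signs that agree around the triangle.\<close>
    define \<delta> where "\<delta> = (h (a + b) - h a - h b) / 3"
    obtain x where x: "x \<bullet> a = h a + \<delta> - (a \<bullet> a) / 2" "x \<bullet> b = h b + \<delta> - a \<bullet> b - (b \<bullet> b) / 2"
      using solve_two_inner[of b a] False by blast
    have 1: "x \<bullet> a + (a \<bullet> a) / 2 = h a + \<delta>" using x by simp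
    have 2: "(x + a) \<bullet> b + (b \<bullet> b) / 2 = h b + \<delta>" using x by (simp add: inner_add_left)
    have 3: "x \<bullet> (a + b) + ((a + b) \<bullet> (a + b)) / 2 = h (a + b) - \<delta>"
    proof -
      have "((a + b) \<bullet> (a + b)) / 2 = (a \<bullet> a) / 2 + a \<bullet> b + (b \<bullet> b) / 2"
        by (simp add: inner_add_left inner_add_right inner_commute)
      moreover have "h (a + b) = h a + h b + 3 * \<delta>" by (simp add: \<delta>_def diff_divide_distrib)
      ultimately show ?thesis using x by (simp only: inner_add_right[of x])
    qed
    show ?thesis
    proof (cases \<delta> "0::real" rule: linorder_cases)
      case less
      have "\<phi> x < \<phi> (x + a)" using inc[of a x] 1 less False by simp
      moreover have "\<phi> (x + a) < \<phi> (x + a + b)" using inc[of b "x + a"] 2 less b0 by simp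
      moreover have "\<phi> (x + (a + b)) < \<phi> x" using dec[of "a + b" x] 3 less ab0 by simp
      ultimately show ?thesis by (simp add: add.assoc)
    next
      case equal
      then show ?thesis by (simp add: \<delta>_def)
    next
      case greater
      have "\<phi> (x + a) < \<phi> x" using dec[of a x] 1 greater False by simp
      moreover have "\<phi> (x + a + b) < \<phi> (x + a)" using dec[of b "x + a"] 2 greater b0 by simp
      moreover have "\<phi> x < \<phi> (x + (a + b))" using inc[of "a + b" x] 3 greater ab0 by simp
      ultimately show ?thesis by (simp add: add.assoc)
    qed
  qed
  have "linear h" by (rule linearI) (auto simp: add hom)
  then have "h d = adjoint h 1 \<bullet> d" for d
    using adjoint_works[of h d 1] by (simp add: inner_commute)
  then show ?thesis by blast
qed

context energy_maximizer
begin

text \<open>Scaling the threshold by \<open>norm d\<close> turns the comparison of \<open>s\<close>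
  with \<open>T e\<close>, for the mirror taking \<open>x\<close> to \<open>x + d\<close>, into one
  of \<open>x \<bullet> d + (d \<bullet> d) / 2\<close> with \<open>h d\<close>. Transitivity of the
  potential of \<open>u\<close> alone makes \<open>h\<close> linear, and \<open>dec\<close> with the
  same \<open>h\<close> then applies to both potentials.\<close>

lemma potentials_strictly_radial:
  "\<exists>x0. \<forall>x y. norm (x - x0) < norm (y - x0) \<longrightarrow>
    potential K u y < potential K u x \<and> potential K v y < potential K v x"
proof -
  obtain T where T: "\<And>e s. norm e = 1 \<Longrightarrow> T e < s \<Longrightarrow> ordered e s"
    "\<And>e s. norm e = 1 \<Longrightarrow> s < T e \<Longrightarrow> ordered (- e) (- s)"
    using ex_ordered_threshold by metis
  define h where "h d = norm d * T (d /\<^sub>R norm d)" for d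
  have dec: "potential K u (x + d) < potential K u x \<and> potential K v (x + d) < potential K v x"
    if "d \<noteq> 0" "h d < x \<bullet> d + (d \<bullet> d) / 2" for x d
  proof -
    have "x \<noteq> x + d" using that by simp
    then obtain e s where e: "norm e = 1" "mirror e s x = x + d" "x \<bullet> e < s"
      "e = (x + d - x) /\<^sub>R norm (x + d - x)" "2 * norm (x + d - x) * s = (norm (x + d))\<^sup>2 - (norm x)\<^sup>2"
      by (rule ex_mirror)
    have "norm d * s = x \<bullet> d + (d \<bullet> d) / 2"
      using e(5) by (simp add: power2_norm_eq_inner inner_add_left inner_add_right inner_commute)
    then have "norm d * T e < norm d * s" using that(2) e(4) by (simp add: h_def)
    then have "T e < s" by (simp add: mult_less_cancel_left)
    then show ?thesis using ordered_potential[OF e(1) T(1) e(3)] e by auto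
  qed
  have inc: "potential K u x < potential K u (x + d) \<and> potential K v x < potential K v (x + d)"
    if "d \<noteq> 0" "x \<bullet> d + (d \<bullet> d) / 2 < h d" for x d
  proof -
    have "x \<noteq> x + d" using that by simp
    then obtain e s where e: "norm e = 1" "mirror e s x = x + d" "x \<bullet> e < s"
      "e = (x + d - x) /\<^sub>R norm (x + d - x)" "2 * norm (x + d - x) * s = (norm (x + d))\<^sup>2 - (norm x)\<^sup>2"
      by (rule ex_mirror)
    have "norm d * s = x \<bullet> d + (d \<bullet> d) / 2"
      using e(5) by (simp add: power2_norm_eq_inner inner_add_left inner_add_right inner_commute)
    then have "norm d * s < norm d * T e" using that(2) e(4) by (simp add: h_def)
    then have "s < T e" by (simp add: mult_less_cancel_left)
    then have o: "ordered (- e) (- s)" using T(2) e(1) by blast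
    have "(x + d) \<bullet> e > s" using inner_mirror[OF e(1), of s x] e by simp
    then have "(x + d) \<bullet> (- e) < - s" by simp
    moreover have "mirror (- e) (- s) (x + d) = x"
      using e mirror_mirror[OF e(1), of s x] by (simp add: mirror_minus)
    ultimately show ?thesis using ordered_potential[OF _ o, of "x + d"] e(1) by simp
  qed
  have scale: "h (c *\<^sub>R d) = c * h d" if "0 < c" for c d
  proof -
    have "(c *\<^sub>R d) /\<^sub>R norm (c *\<^sub>R d) = ((inverse c * c) * inverse (norm d)) *\<^sub>R d"
      using that by (simp add: mult.commute mult.left_commute)
    then have "(c *\<^sub>R d) /\<^sub>R norm (c *\<^sub>R d) = d /\<^sub>R norm d" using that by simp
    then show ?thesis unfolding h_def by (simp only: norm_scaleR) (use that in simp)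
  qed
  obtain x0 where x0: "\<And>d. h d = x0 \<bullet> d"
    using threshold_linear[of h "potential K u"] dec inc scale by (auto simp: h_def)
  show ?thesis
  proof (intro exI allI impI)
    fix x y assume xy: "norm (x - x0) < norm (y - x0)"
    have "(norm (x - x0))\<^sup>2 < (norm (y - x0))\<^sup>2" using xy by (intro power_strict_mono) auto
    \<comment> \<open>With \<open>h d = x0 \<bullet> d\<close> this inequality is half the
      difference of the squared distances to \<open>x0\<close>.\<close>
    then have "h (y - x) < x \<bullet> (y - x) + ((y - x) \<bullet> (y - x)) / 2"
      unfolding x0 power2_norm_eq_inner
      by (simp add: inner_diff_left inner_diff_right inner_commute add_divide_distrib diff_divide_distrib)
    then show "potential K u y < potential K u x \<and> potential K v y < potential K v x"
      using dec[of "y - x" x] xy by auto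
  qed
qed

text \<open>The ball about \<open>x0\<close> competes with \<open>u\<close>, so \<open>u\<close>
  does at least as well against the potential of \<open>v\<close>, and the uniqueness part of the
  bathtub principle applies.\<close>

lemma maximizer_eq_ball:
  assumes radial: "\<And>x y. norm (x - x0) < norm (y - x0) \<Longrightarrow> potential K v y < potential K v x"
  shows "AE x in lborel. u x = indicator (ball x0 r1) x"
proof -
  interpret s: energy_maximizer K v u r2 r1 by (rule swap)
  let ?B = "ball x0 r1"
  let ?c = "SUP x\<in>- ?B. potential K v x"
  have vol: "emeasure lborel ?B = emeasure lborel (ball (0::'a) r1)"
    using r_pos(1) by (simp add: emeasure_ball)
  have "bathtub ?B (potential K v) u ?c"
  proof
    show "x \<in> ?B \<Longrightarrow> ?c \<le> potential K v x" for x
      by (intro SUP_least less_imp_le radial) (auto simp: dist_norm norm_minus_commute)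
    show "emeasure lborel ?B \<noteq> \<infinity>"
      using emeasure_lborel_ball_finite[of x0 r1] by simp
    show "(\<integral>\<^sup>+ x. ennreal (u x) \<partial>lborel) \<le> emeasure lborel ?B" using u_mass vol by simp
  qed (use u_range in \<open>auto intro: SUP_upper\<close>)
  then interpret b: bathtub ?B "potential K v" u ?c .
  have i: "energy K w v = (\<integral>\<^sup>+ x. ennreal (w x) * potential K v x \<partial>lborel)"
    if [measurable]: "w \<in> borel_measurable borel" and "\<And>x. 0 \<le> w x" for w
    using that v_range by (subst energy_commute) (auto intro!: energy_eq_potential)
  have le: "energy K (indicator ?B) v \<le> energy K u v"
    unfolding maximal
  proof (rule riesz_balls)
    show "(\<integral>\<^sup>+ x. ennreal (indicator ?B x) \<partial>lborel) \<le> emeasure lborel (ball (0::'a) r1)"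
      by (simp add: ennreal_indicator vol)
  qed (use v_range v_mass r_pos in auto)
  show ?thesis
  proof (rule b.bathtub_unique)
    show "(\<integral>\<^sup>+ x. ennreal (indicator ?B x) * potential K v x \<partial>lborel) \<noteq> \<infinity>"
      using le finite_energy by (auto simp: i top_unique)
    show "(\<integral>\<^sup>+ x. ennreal (indicator ?B x) * potential K v x \<partial>lborel)
        \<le> (\<integral>\<^sup>+ x. ennreal (u x) * potential K v x \<partial>lborel)"
      using le u_range by (simp add: i)
    fix x assume x: "x \<in> ?B"
    \<comment> \<open>A radius strictly between that of \<open>x\<close> and \<open>r1\<close> keeps
      the supremum outside the ball strictly below the potential at \<open>x\<close>, even if it is
      not attained.\<close>
    obtain p :: 'a where p: "norm p = (norm (x - x0) + r1) / 2"
      using vector_choose_size[of "(norm (x - x0) + r1) / 2"] r_pos by (metis add_nonneg_nonneg divide_nonneg_pos less_imp_le norm_ge_zero zero_less_numeral)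
    have r: "norm (x - x0) < norm (x0 + p - x0)" "norm (x0 + p - x0) < r1"
      using x p by (auto simp: dist_norm norm_minus_commute)
    have "?c \<le> potential K v (x0 + p)"
      using r(2) by (intro SUP_least less_imp_le radial) (auto simp: dist_norm norm_minus_commute)
    also have "\<dots> < potential K v x" using r(1) by (rule radial)
    finally show "?c < potential K v x" .
  qed
qed

text \<open>Each density is identified through the potential of the other; the centre is common
  because one threshold serves both densities in every direction.\<close>

theorem maximizers_are_concentric_balls:
  "\<exists>x0. (AE x in lborel. u x = indicator (ball x0 r1) x) \<and> (AE x in lborel. v x = indicator (ball x0 r2) x)"
proof -
  interpret s: energy_maximizer K v u r2 r1 by (rule swap)
  show ?thesis
    using potentials_strictly_radial maximizer_eq_ball s.maximizer_eq_ball by blast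
qed

end

section \<open>Reduction of the functional to the energy\<close>

lemma (in radial_kernel) energy_translate:
  assumes [measurable]: "u \<in> borel_measurable borel" "v \<in> borel_measurable borel"
  shows "energy K (\<lambda>x. u (x - a)) (\<lambda>x. v (x - a)) = energy K u v"
proof -
  define F where "F y = (\<integral>\<^sup>+ x. ennreal (u x * v y * K (x - y)) \<partial>lborel)" for y
  have [measurable]: "F \<in> borel_measurable borel" unfolding F_def[abs_def] by measurable
  have "(\<integral>\<^sup>+ x. ennreal (u (x - a) * v (y - a) * K (x - y)) \<partial>lborel) = F (y + - a)" for y
    unfolding F_def
    using nn_integral_translate[of "\<lambda>x. ennreal (u x * v (y - a) * K (x - (y - a)))" "- a"]
    by simp
  then have "energy K (\<lambda>x. u (x - a)) (\<lambda>x. v (x - a)) = (\<integral>\<^sup>+ y. F (y + - a) \<partial>lborel)"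
    by (simp add: energy_def)
  also have "\<dots> = energy K u v"
    unfolding energy_def F_def[symmetric] by (rule nn_integral_translate) measurable
  finally show ?thesis .
qed

lemma radial_kernelI:
  fixes j :: "real \<Rightarrow> real"
  assumes nonneg: "\<And>r. 0 \<le> r \<Longrightarrow> 0 \<le> j r" and anti: "antimono_on {0..} j"
  shows "radial_kernel (\<lambda>z::'a::euclidean_space. j (norm z))"
proof
  \<comment> \<open>Freezing \<open>j\<close> at its value at 0 for negative arguments makes it
    monotone on the whole line, hence Borel.\<close>
  have "mono (\<lambda>r. - j (max r 0))"
    using anti by (intro monoI) (auto simp: monotone_on_def)
  then have "(\<lambda>r. - (- j (max r 0))) \<in> borel_measurable borel"
    by (intro borel_measurable_uminus borel_measurable_mono)
  then have [measurable]: "(\<lambda>r. j (max r 0)) \<in> borel_measurable borel" by simp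
  have "(\<lambda>z::'a. j (max (norm z) 0)) \<in> borel_measurable borel" by measurable
  then show "(\<lambda>z::'a. j (norm z)) \<in> borel_measurable borel" by simp
  show "0 \<le> j (norm z)" for z :: 'a using nonneg by simp
  show "j (norm y) \<le> j (norm x)" if "norm x \<le> norm y" for x y :: 'a
    using anti that by (auto simp: monotone_on_def)
qed

lemma admissible_normalize:
  fixes f :: "real^'n \<Rightarrow> real"
  assumes f: "f \<in> admissible k l" and k: "0 < k" and l: "0 < l"
  obtains u where "u \<in> borel_measurable borel" "\<And>x. 0 \<le> u x" "\<And>x. u x \<le> 1"
    "AE x in lborel. f x = k * u x" "(\<integral>\<^sup>+ x. ennreal (u x) \<partial>lborel) \<le> ennreal (l / k)"
proof -
  have fm: "f \<in> borel_measurable lebesgue" and f0: "0 \<le> f x" and fk: "f x \<le> k"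
    and fl: "(\<integral>\<^sup>+ x. ennreal (f x) \<partial>lborel) \<le> ennreal l" for x
    using f by (auto simp: admissible_def nn_integral_completion)
  obtain g where g[measurable]: "g \<in> borel_measurable lborel" and fg: "AE x in lborel. f x = g x"
    using completion_ex_borel_measurable_real[OF fm] by blast
  define u where "u x = max 0 (min 1 (g x / k))" for x
  have um[measurable]: "u \<in> borel_measurable borel"
    using g unfolding u_def by measurable
  have u: "0 \<le> u x" "u x \<le> 1" for x by (auto simp: u_def)
  have fu: "AE x in lborel. f x = k * u x"
    using fg
  proof eventually_elim
    case (elim x)
    then show ?case using f0[of x] fk[of x] k by (auto simp: u_def max_def min_def divide_simps)
  qed
  have "ennreal k * (\<integral>\<^sup>+ x. ennreal (u x) \<partial>lborel) = (\<integral>\<^sup>+ x. ennreal (k * u x) \<partial>lborel)"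
    using k u by (simp add: nn_integral_cmult ennreal_mult)
  also have "\<dots> = (\<integral>\<^sup>+ x. ennreal (f x) \<partial>lborel)"
    using fu by (intro nn_integral_cong_AE) (auto elim: eventually_mono)
  also have "\<dots> \<le> ennreal k * ennreal (l / k)"
    using fl k l by (simp flip: ennreal_mult)
  finally have "(\<integral>\<^sup>+ x. ennreal (u x) \<partial>lborel) \<le> ennreal (l / k)"
    using k by (simp add: ennreal_mult_le_mult_iff)
  then show thesis using that um u fu by blast
qed

text \<open>The star inequalities are (\<Psi>3) for increments that start on an axis, where
  \<open>\<Psi>\<close> vanishes.\<close>

locale star_shaped_interaction =
  fixes \<Psi> :: "real \<Rightarrow> real \<Rightarrow> real" and j :: "real \<Rightarrow> real" and k1 k2 :: real
  assumes k_pos: "0 < k1" "0 < k2"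
    and axes: "\<And>s. 0 \<le> s \<Longrightarrow> \<Psi> s 0 = 0" "\<And>s. 0 \<le> s \<Longrightarrow> \<Psi> 0 s = 0"
    and nonneg: "0 \<le> \<Psi> k1 k2"
    and star1: "\<And>t s. 0 \<le> s \<Longrightarrow> 0 < t \<Longrightarrow> t < 1 \<Longrightarrow> \<Psi> (t * k1) s \<le> t * \<Psi> k1 s"
    and star2: "\<And>t. 0 < t \<Longrightarrow> t < 1 \<Longrightarrow> \<Psi> k1 (t * k2) \<le> t * \<Psi> k1 k2"
    and j_nonneg: "\<And>r. 0 \<le> r \<Longrightarrow> 0 \<le> j r"
    and j_antimono: "antimono_on {0..} j"
begin

abbreviation kernel :: "real^'n \<Rightarrow> real" where
  "kernel \<equiv> \<lambda>z. j (norm z)"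

lemma kernel: "radial_kernel kernel"
  using j_nonneg j_antimono by (rule radial_kernelI)

lemma Psi_le_product:
  assumes "0 \<le> s" "s \<le> 1" "0 \<le> t" "t \<le> 1"
  shows "\<Psi> (k1 * s) (k2 * t) \<le> \<Psi> k1 k2 * (s * t)"
proof -
  have "\<Psi> (k1 * s) (k2 * t) \<le> s * \<Psi> k1 (k2 * t)"
    using assms star1[of "k2 * t" s] axes(2)[of "k2 * t"] k_pos
    by (cases "s = 0 \<or> s = 1") (auto simp: mult.commute)
  also have "\<Psi> k1 (k2 * t) \<le> t * \<Psi> k1 k2"
    using assms star2[of t] axes(1)[of k1] k_pos
    by (cases "t = 0 \<or> t = 1") (auto simp: mult.commute)
  then have "s * \<Psi> k1 (k2 * t) \<le> s * (t * \<Psi> k1 k2)"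
    using assms(1) by (rule mult_left_mono)
  finally show ?thesis by (simp add: ac_simps)
qed

lemma J_functional_AE:
  fixes f g :: "real^'n \<Rightarrow> real"
  assumes f: "AE x in lborel. f x = k1 * u x" and g: "AE x in lborel. g x = k2 * v x"
  shows "J_functional \<Psi> j f g
    = (\<integral>\<^sup>+ y. (\<integral>\<^sup>+ x. ennreal (\<Psi> (k1 * u x) (k2 * v y) * kernel (x - y)) \<partial>lborel) \<partial>lborel)"
  unfolding J_functional_def nn_integral_completion
  using g
proof (intro nn_integral_cong_AE, eventually_elim)
  case (elim y)
  show ?case
    using f by (intro nn_integral_cong_AE, eventually_elim) (simp add: elim)
qed

lemma energy_cmult:
  fixes u v :: "real^'n \<Rightarrow> real"
  assumes [measurable]: "u \<in> borel_measurable borel" "v \<in> borel_measurable borel"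
    and u: "\<And>x. 0 \<le> u x" and v: "\<And>x. 0 \<le> v x"
  shows "(\<integral>\<^sup>+ y. (\<integral>\<^sup>+ x. ennreal (\<Psi> k1 k2 * (u x * v y) * kernel (x - y)) \<partial>lborel) \<partial>lborel)
    = ennreal (\<Psi> k1 k2) * energy kernel u v"
proof -
  interpret radial_kernel "kernel :: real^'n \<Rightarrow> real" by (rule kernel)
  have "ennreal (\<Psi> k1 k2 * (u x * v y) * kernel (x - y)) = ennreal (\<Psi> k1 k2) * ennreal (u x * v y * kernel (x - y))"
    for x y
    using nonneg u v j_nonneg by (simp add: mult.assoc flip: ennreal_mult)
  then show ?thesis
    using K_measurable unfolding energy_def by (simp add: nn_integral_cmult)
qed

lemma J_functional_le:
  fixes f g :: "real^'n \<Rightarrow> real"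
  assumes f: "AE x in lborel. f x = k1 * u x" and g: "AE x in lborel. g x = k2 * v x"
    and [measurable]: "u \<in> borel_measurable borel" "v \<in> borel_measurable borel"
    and u: "\<And>x. 0 \<le> u x" "\<And>x. u x \<le> 1" and v: "\<And>x. 0 \<le> v x" "\<And>x. v x \<le> 1"
  shows "J_functional \<Psi> j f g \<le> ennreal (\<Psi> k1 k2) * energy kernel u v"
  unfolding J_functional_AE[OF f g] energy_cmult[OF assms(3,4) u(1) v(1), symmetric]
  using Psi_le_product u v j_nonneg
  by (intro nn_integral_mono ennreal_leI mult_right_mono) auto

lemma J_functional_indicator:
  fixes f g :: "real^'n \<Rightarrow> real"
  assumes f: "AE x in lborel. f x = k1 * indicator A x" and g: "AE x in lborel. g x = k2 * indicator B x"
    and [measurable]: "A \<in> sets borel" "B \<in> sets borel"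
  shows "J_functional \<Psi> j f g = ennreal (\<Psi> k1 k2) * energy kernel (indicator A) (indicator B)"
proof -
  have "\<Psi> (k1 * indicator A x) (k2 * indicator B y) = \<Psi> k1 k2 * (indicator A x * indicator B y)" for x y :: "real^'n"
    using axes k_pos by (auto simp: indicator_def)
  then show ?thesis
    by (simp add: J_functional_AE[OF f g] energy_cmult)
qed

end

lemma emeasure_ball_radius_pos:
  assumes "emeasure lebesgue (ball (0::'a::euclidean_space) r) = ennreal m" "0 < m"
  shows "0 < r" "emeasure lborel (ball (0::'a) r) = ennreal m"
proof -
  show "0 < r"
  proof (rule ccontr)
    assume "\<not> 0 < r"
    then have "ball (0::'a) r = {}" by simp
    then have "ennreal m = 0" using assms(1) by (simp only: emeasure_empty)
    then show False using assms(2) by simp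
  qed
  show "emeasure lborel (ball (0::'a) r) = ennreal m" using assms(1) by simp
qed

section \<open>Assembly of the inequality and the equality case\<close>

theorem mainTheorem1:
  fixes k1 k2 l1 l2 :: real
    and \<Psi> :: "real \<Rightarrow> real \<Rightarrow> real"
    and j :: "real \<Rightarrow> real"
    and B1 B2 :: "(real ^ 'n) set"
    and C :: "(((real ^ 'n) \<Rightarrow> real) \<times> ((real ^ 'n) \<Rightarrow> real)) set"
    and J :: "((real ^ 'n) \<Rightarrow> real) \<Rightarrow> ((real ^ 'n) \<Rightarrow> real) \<Rightarrow> ennreal"
  defines "C \<equiv> admissible_pairs k1 l1 k2 l2"
    and "J \<equiv> J_functional \<Psi> j"
  assumes pos: "0 < k1" "0 < k2" "0 < l1" "0 < l2"
    and Psi_borel: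
      "(\<lambda>(s1, s2). \<Psi> s1 s2) \<in> borel_measurable (restrict_space borel ({0..} \<times> {0..}))"
    and Psi1: "\<And>s1. 0 \<le> s1 \<Longrightarrow> \<Psi> s1 0 = 0" "\<And>s2. 0 \<le> s2 \<Longrightarrow> \<Psi> 0 s2 = 0"
    and Psi2: "\<And>a b c d. 0 \<le> a \<Longrightarrow> a < b \<Longrightarrow> 0 \<le> c \<Longrightarrow> c < d \<Longrightarrow>
      \<Psi> b d - \<Psi> b c - \<Psi> a d + \<Psi> a c \<ge> 0"
    and Psi3_i: "\<And>x b1 b2 t. 0 \<le> x \<Longrightarrow> 0 \<le> b1 \<Longrightarrow> b1 < b2 \<Longrightarrow> 0 < t \<Longrightarrow> t < 1 \<Longrightarrow>
      \<Psi> (t * x) b2 - t * \<Psi> x b2 - \<Psi> (t * x) b1 + t * \<Psi> x b1 \<le> 0"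
    and Psi3_ii: "\<And>y a1 a2 t. 0 \<le> y \<Longrightarrow> 0 \<le> a1 \<Longrightarrow> a1 < a2 \<Longrightarrow> 0 < t \<Longrightarrow> t < 1 \<Longrightarrow>
      \<Psi> a2 (t * y) - t * \<Psi> a2 y - \<Psi> a1 (t * y) + t * \<Psi> a1 y \<le> 0"
    and j_nonneg: "\<And>r. 0 \<le> r \<Longrightarrow> 0 \<le> j r"
    and j1: "antimono_on {0..} j"
    and Psi_cont: "\<And>s2. 0 \<le> s2 \<Longrightarrow> continuous_on {0..} (\<lambda>s1. \<Psi> s1 s2)"
      "\<And>s1. 0 \<le> s1 \<Longrightarrow> continuous_on {0..} (\<lambda>s2. \<Psi> s1 s2)"
    and Psi_Luzin: "\<And>s2. 0 \<le> s2 \<Longrightarrow> N_Luzin (\<lambda>s1. \<Psi> s1 s2)"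
      "\<And>s1. 0 \<le> s1 \<Longrightarrow> N_Luzin (\<lambda>s2. \<Psi> s1 s2)"
    and B1: "\<exists>r. B1 = ball 0 r" "emeasure lebesgue B1 = ennreal (l1 / k1)"
    and B2: "\<exists>r. B2 = ball 0 r" "emeasure lebesgue B2 = ennreal (l2 / k2)"
  shows "(\<forall>(f1, f2) \<in> C. J f1 f2 \<le> J (\<lambda>x. k1 * indicator B1 x) (\<lambda>x. k2 * indicator B2 x))
    \<and> ((\<forall>a b c d. 0 \<le> a \<and> a < b \<and> 0 \<le> c \<and> c < d \<longrightarrow>
            \<Psi> b d - \<Psi> b c - \<Psi> a d + \<Psi> a c > 0)
        \<and> (\<forall>x b1 b2 t. 0 < x \<and> 0 \<le> b1 \<and> b1 < b2 \<and> 0 < t \<and> t < 1 \<longrightarrow>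
            \<Psi> (t * x) b2 - t * \<Psi> x b2 - \<Psi> (t * x) b1 + t * \<Psi> x b1 < 0)
        \<and> (\<forall>y a1 a2 t. 0 < y \<and> 0 \<le> a1 \<and> a1 < a2 \<and> 0 < t \<and> t < 1 \<longrightarrow>
            \<Psi> a2 (t * y) - t * \<Psi> a2 y - \<Psi> a1 (t * y) + t * \<Psi> a1 y < 0)
        \<and> strict_antimono_on {0..} j
        \<and> (\<forall>(f1, f2) \<in> C. J f1 f2 < \<infinity>)
      \<longrightarrow> (\<forall>(h1, h2) \<in> C.
            J h1 h2 = (SUP (f, g) \<in> C. J f g) \<longleftrightarrow>
            (\<exists>x0. (AE x in lebesgue. h1 x = k1 * indicator B1 (x - x0))
                \<and> (AE x in lebesgue. h2 x = k2 * indicator B2 (x - x0)))))"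
proof -
  interpret star_shaped_interaction \<Psi> j k1 k2
  proof
    show "0 \<le> \<Psi> k1 k2" using Psi2[of 0 k1 0 k2] pos Psi1 by simp
    \<comment> \<open>The increment starts at \<open>b1 = 0\<close>; the value \<open>s = 0\<close>,
      excluded by \<open>b1 < b2\<close>, is covered by the axis condition.\<close>
    show "\<Psi> (t * k1) s \<le> t * \<Psi> k1 s" if "0 \<le> s" "0 < t" "t < 1" for t s
      using Psi3_i[of k1 0 s t] that pos Psi1(1) by (cases "s = 0") auto
    show "\<Psi> k1 (t * k2) \<le> t * \<Psi> k1 k2" if "0 < t" "t < 1" for t
      using Psi3_ii[of k2 0 k1 t] that pos Psi1(2) by auto
  qed (use pos Psi1 j_nonneg j1 in auto)
  interpret K: radial_kernel "kernel :: real^'n \<Rightarrow> real" by (rule kernel)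
  let ?K = "kernel :: real^'n \<Rightarrow> real"
  obtain r1 r2 where B: "B1 = ball 0 r1" "B2 = ball 0 r2" using B1(1) B2(1) by blast
  have lk: "0 < l1 / k1" "0 < l2 / k2" using pos by auto
  note r1 = emeasure_ball_radius_pos[OF B1(2)[unfolded B] lk(1)]
    and r2 = emeasure_ball_radius_pos[OF B2(2)[unfolded B] lk(2)]
  let ?c = "ennreal (\<Psi> k1 k2)"
  let ?E = "energy ?K (indicator B1) (indicator B2)"
  let ?b1 = "\<lambda>x. k1 * indicator B1 x" and ?b2 = "\<lambda>x. k2 * indicator B2 x"
  have J_balls: "J ?b1 ?b2 = ?c * ?E"
    unfolding J_def by (rule J_functional_indicator) (auto simp: B)
  have upper: "J f g \<le> ?c * ?E" if fg: "(f, g) \<in> C" for f g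
  proof -
    have f: "f \<in> admissible k1 l1" and g: "g \<in> admissible k2 l2"
      using fg by (auto simp: C_def admissible_pairs_def)
    obtain u where u: "u \<in> borel_measurable borel" "\<And>x. 0 \<le> u x" "\<And>x. u x \<le> 1"
      "AE x in lborel. f x = k1 * u x" "(\<integral>\<^sup>+ x. ennreal (u x) \<partial>lborel) \<le> ennreal (l1 / k1)"
      by (rule admissible_normalize[OF f pos(1,3)]) blast
    obtain v where v: "v \<in> borel_measurable borel" "\<And>x. 0 \<le> v x" "\<And>x. v x \<le> 1"
      "AE x in lborel. g x = k2 * v x" "(\<integral>\<^sup>+ x. ennreal (v x) \<partial>lborel) \<le> ennreal (l2 / k2)"
      by (rule admissible_normalize[OF g pos(2,4)]) blast
    have "J f g \<le> ?c * energy ?K u v"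
      unfolding J_def by (rule J_functional_le) (use u v in auto)
    also have "\<dots> \<le> ?c * ?E"
      unfolding B by (intro mult_left_mono K.riesz_balls) (use u v r1 r2 in auto)
    finally show ?thesis .
  qed
  have balls_C: "(?b1, ?b2) \<in> C"
  proof -
    have "(\<lambda>x. k * indicator (ball (0::real^'n) r) x) \<in> admissible k l"
      if "0 < k" "0 < l" "emeasure lborel (ball (0::real^'n) r) = ennreal (l / k)" for k l r
    proof -
      have "(\<integral>\<^sup>+ x. ennreal (k * indicator (ball (0::real^'n) r) x) \<partial>lborel)
          = (\<integral>\<^sup>+ x. ennreal k * indicator (ball (0::real^'n) r) x \<partial>lborel)"
        by (intro nn_integral_cong) (auto simp: indicator_def)
      also have "\<dots> = ennreal l"
        using that by (simp add: nn_integral_cmult_indicator flip: ennreal_mult)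
      finally show ?thesis
        using that unfolding admissible_def nn_integral_completion
        by (auto simp: indicator_def intro!: measurable_completion)
    qed
    then show ?thesis using pos r1 r2 by (simp add: C_def admissible_pairs_def B)
  qed
  have max: "(SUP (f, g) \<in> C. J f g) = J ?b1 ?b2"
  proof (rule antisym)
    show "(SUP (f, g) \<in> C. J f g) \<le> J ?b1 ?b2"
      unfolding J_balls using upper by (intro SUP_least) auto
    show "J ?b1 ?b2 \<le> (SUP (f, g) \<in> C. J f g)"
      using SUP_upper[OF balls_C, of "\<lambda>(f, g). J f g"] by simp
  qed
  show ?thesis
  proof (intro conjI impI)
    show "\<forall>(f1, f2) \<in> C. J f1 f2 \<le> J ?b1 ?b2"
      unfolding J_balls using upper by auto
  next
    assume H: "(\<forall>a b c d. 0 \<le> a \<and> a < b \<and> 0 \<le> c \<and> c < d \<longrightarrow>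
            \<Psi> b d - \<Psi> b c - \<Psi> a d + \<Psi> a c > 0)
        \<and> (\<forall>x b1 b2 t. 0 < x \<and> 0 \<le> b1 \<and> b1 < b2 \<and> 0 < t \<and> t < 1 \<longrightarrow>
            \<Psi> (t * x) b2 - t * \<Psi> x b2 - \<Psi> (t * x) b1 + t * \<Psi> x b1 < 0)
        \<and> (\<forall>y a1 a2 t. 0 < y \<and> 0 \<le> a1 \<and> a1 < a2 \<and> 0 < t \<and> t < 1 \<longrightarrow>
            \<Psi> a2 (t * y) - t * \<Psi> a2 y - \<Psi> a1 (t * y) + t * \<Psi> a1 y < 0)
        \<and> strict_antimono_on {0..} j
        \<and> (\<forall>(f1, f2) \<in> C. J f1 f2 < \<infinity>)"
    \<comment> \<open>The strict increment over the rectangle from the origin makes the constant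
      positive, so it can be cancelled and finiteness passes from \<open>J\<close> to the
      energy.\<close>
    have "0 < \<Psi> k1 k2 - \<Psi> k1 0 - \<Psi> 0 k2 + \<Psi> 0 0"
      using H pos by (intro conjunct1[OF H, rule_format]) auto
    then have c: "0 < \<Psi> k1 k2" using Psi1 pos by simp
    have strict: "strict_antimono_on {0..} j" using H by blast
    interpret K: strict_radial_kernel ?K
      using strict by unfold_locales (auto simp: monotone_on_def)
    have "J ?b1 ?b2 < \<infinity>" using H balls_C by blast
    then have E_fin: "?E \<noteq> \<infinity>" unfolding J_balls using c by (auto simp: ennreal_mult_eq_top_iff ennreal_mult_less_top)
    have shift: "indicat_real (ball x0 r) x = indicator (ball 0 r) (x - x0)" for r and x x0 :: "real^'n"
      by (simp add: indicator_def dist_norm norm_minus_commute)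
    show "\<forall>(h1, h2) \<in> C. J h1 h2 = (SUP (f, g) \<in> C. J f g) \<longleftrightarrow>
            (\<exists>x0. (AE x in lebesgue. h1 x = k1 * indicator B1 (x - x0))
                \<and> (AE x in lebesgue. h2 x = k2 * indicator B2 (x - x0)))"
    proof (clarify, rule iffI)
      fix h1 h2 assume hC: "(h1, h2) \<in> C" and "J h1 h2 = (SUP (f, g) \<in> C. J f g)"
      then have h_max: "J h1 h2 = ?c * ?E" by (simp only: max J_balls)
      have f: "h1 \<in> admissible k1 l1" and g: "h2 \<in> admissible k2 l2"
        using hC by (auto simp: C_def admissible_pairs_def)
      obtain u where u: "u \<in> borel_measurable borel" "\<And>x. 0 \<le> u x" "\<And>x. u x \<le> 1"
        "AE x in lborel. h1 x = k1 * u x" "(\<integral>\<^sup>+ x. ennreal (u x) \<partial>lborel) \<le> ennreal (l1 / k1)"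
        by (rule admissible_normalize[OF f pos(1,3)]) blast
      obtain v where v: "v \<in> borel_measurable borel" "\<And>x. 0 \<le> v x" "\<And>x. v x \<le> 1"
        "AE x in lborel. h2 x = k2 * v x" "(\<integral>\<^sup>+ x. ennreal (v x) \<partial>lborel) \<le> ennreal (l2 / k2)"
        by (rule admissible_normalize[OF g pos(2,4)]) blast
      \<comment> \<open>The product bound is used backwards: a maximizer of \<open>J\<close> has
        normalized densities of at least the energy of the balls, hence of exactly that
        energy.\<close>
      have "?c * ?E \<le> ?c * energy ?K u v"
        unfolding h_max[symmetric] J_def by (rule J_functional_le) (use u v in auto)
      then have "?E \<le> energy ?K u v" using c by (simp add: ennreal_mult_le_mult_iff)
      moreover have "energy ?K u v \<le> ?E"
        unfolding B by (rule K.riesz_balls) (use u v r1 r2 in auto)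
      ultimately have eq: "energy ?K u v = ?E" by simp
      interpret m: energy_maximizer ?K u v r1 r2
      proof
        show "energy ?K u v = energy ?K (indicator (ball 0 r1)) (indicator (ball 0 r2))"
          using eq by (simp only: B)
        show "energy ?K u v \<noteq> \<infinity>" using eq E_fin by simp
      qed (use u v r1 r2 in simp_all)
      obtain x0 where x0: "AE x in lborel. u x = indicator (ball x0 r1) x" "AE x in lborel. v x = indicator (ball x0 r2) x"
        using m.maximizers_are_concentric_balls by (elim exE conjE)
      have "AE x in lborel. h1 x = k1 * indicator B1 (x - x0)"
        using u(4) x0(1) by eventually_elim (simp only: B shift[of x0])
      moreover have "AE x in lborel. h2 x = k2 * indicator B2 (x - x0)"
        using v(4) x0(2) by eventually_elim (simp only: B shift[of x0])
      ultimately show "\<exists>x0. (AE x in lebesgue. h1 x = k1 * indicator B1 (x - x0))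
                \<and> (AE x in lebesgue. h2 x = k2 * indicator B2 (x - x0))"
        unfolding AE_completion_iff by blast
    next
      fix h1 h2
      assume "\<exists>x0. (AE x in lebesgue. h1 x = k1 * indicator B1 (x - x0))
                \<and> (AE x in lebesgue. h2 x = k2 * indicator B2 (x - x0))"
      then obtain x0 where x0: "AE x in lborel. h1 x = k1 * indicator (ball x0 r1) x"
        "AE x in lborel. h2 x = k2 * indicator (ball x0 r2) x"
        unfolding AE_completion_iff B shift[symmetric] by blast
      have "J h1 h2 = ?c * energy ?K (indicator (ball x0 r1)) (indicator (ball x0 r2))"
        unfolding J_def by (rule J_functional_indicator[OF x0]) auto
      also have "\<dots> = ?c * ?E"
        using K.energy_translate[of "indicator B1" "indicator B2" x0] by (simp only: B shift[symmetric] borel_measurable_indicator_ball)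
      finally show "J h1 h2 = (SUP (f, g) \<in> C. J f g)" by (simp only: max J_balls)
    qed
  qed
qed

end
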